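(* Let $B:\mathfrak h\to\mathfrak g$ be a relative Rota-Baxter operator (of weight $1$) on a Lie algebra $\mathfrak g$ with respect to an action $(\mathfrak h;\phi)$. Let $G$ and $H$ be the connected and simply connected Lie groups integrating $\mathfrak g$ and $\mathfrak h$ respectively, and let $\Phi:G\to\mathrm{Aut}(H)$ be the integrated action of $\phi$. Then there is a unique local relative Rota-Baxter operator $\mathcal B$ on $G$ with respect to the action $(H;\Phi)$ integrating $B$.
   Context: Lie groups and the Lie algebras they integrate are real and finite-dimensional. An action of $\mathfrak g$ on $\mathfrak h$ is a Lie algebra homomorphism $\phi:\mathfrak g\to\mathrm{Der}(\mathfrak h)$. A relative Rota-Baxter operator (of weight $1$) on $\mathfrak g$ with respect to $(\mathfrak h;\phi)$ is a linear map $B:\mathfrak h\to\mathfrak g$ with $[B(u),B(v)]_{\mathfrak g}=B(\phi(B(u))v-\phi(B(v))u+[u,v]_{\mathfrak h})$ for all $u,v\in\mathfrak h$. An action of $G$ on $H$ is a group homomorphism $\Phi:G\to\mathrm{Aut}(H)$ into the Lie group automorphisms with $(g,h)\mapsto\Phi(g)h$ smooth. Its differentiated action is $\tilde\Phi_{*e_G}:\mathfrak g\to\mathrm{Der}(\mathfrak h)$, where $\tilde\Phi(g)=\Phi(g)_{*e_H}\in\mathrm{Aut}(\mathfrak h)$. When $G,H$ are connected and simply connected, every action $\phi:\mathfrak g\to\mathrm{Der}(\mathfrak h)$ is the differentiated action of a unique action $\Phi$, called the integrated action. A local relative Rota-Baxter operator on $G$ with respect to $(H;\Phi)$ is a smooth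 map $\mathcal B:U\to G$ defined on an open neighborhood $U$ of $e_H$ in $H$ such that, for $h_1,h_2\in U$, $\mathcal B(h_1)\cdot_G\mathcal B(h_2)=\mathcal B(h_1\cdot_H\Phi(\mathcal B(h_1))h_2)$ whenever $h_1\cdot_H\Phi(\mathcal B(h_1))h_2\in U$. Two local relative Rota-Baxter operators $\mathcal B:U\to G$ and $\mathcal B':U'\to G$ are defined to be equal if they agree on some open neighborhood $\bar U\subset U\cap U'$ of $e_H$ (uniqueness is in this sense). $\mathcal B$ integrates $B$ if its tangent map at $e_H$ is $\mathcal B_{*e_H}=B$. *)

theory Defs
  imports "HOL-Analysis.Analysis" "HOL-Algebra.Coset"
begin


section \<open>Finite-dimensional real Lie algebras\<close>

text \<open>
  The class \<open>euclidean_space\<close> excludes the zero-dimensional space, so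
  finite-dimensional spaces are taken to be (normed) real vector spaces with a finite spanning set.
  The norm is auxiliary: all norms on such a space are equivalent.
\<close>

definition finite_dim :: "'a::real_vector itself \<Rightarrow> bool" where
  "finite_dim _ \<longleftrightarrow> (\<exists>B::'a set. finite B \<and> span B = UNIV)"

locale lie_algebra =
  fixes br :: "'a::real_vector \<Rightarrow> 'a \<Rightarrow> 'a"
  assumes finite_dim: "finite_dim TYPE('a)"
    and bilinear: "bilinear br"
    and alternating: "br x x = 0"
    and jacobi: "br x (br y z) + br y (br z x) + br z (br x y) = 0"

definition derivations :: "('a::real_vector \<Rightarrow> 'a \<Rightarrow> 'a) \<Rightarrow> ('a \<Rightarrow> 'a) set" where
  "derivations br = {D. linear D \<and> (\<forall>u v. D (br u v) = br (D u) v + br u (D v))}"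

definition lie_algebra_action ::
  "('a::real_vector \<Rightarrow> 'a \<Rightarrow> 'a) \<Rightarrow> ('b::real_vector \<Rightarrow> 'b \<Rightarrow> 'b) \<Rightarrow> ('a \<Rightarrow> 'b \<Rightarrow> 'b) \<Rightarrow> bool" where
  "lie_algebra_action brg brh \<phi> \<longleftrightarrow>
     (\<forall>x. \<phi> x \<in> derivations brh) \<and> (\<forall>v. linear (\<lambda>x. \<phi> x v)) \<and>
     (\<forall>x y v. \<phi> (brg x y) v = \<phi> x (\<phi> y v) - \<phi> y (\<phi> x v))"

definition relative_rota_baxter ::
  "('a::real_vector \<Rightarrow> 'a \<Rightarrow> 'a) \<Rightarrow> ('b::real_vector \<Rightarrow> 'b \<Rightarrow> 'b) \<Rightarrow> ('a \<Rightarrow> 'b \<Rightarrow> 'b)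
    \<Rightarrow> ('b \<Rightarrow> 'a) \<Rightarrow> bool" where
  "relative_rota_baxter brg brh \<phi> B \<longleftrightarrow> linear B \<and>
     (\<forall>u v. brg (B u) (B v) = B (\<phi> (B u) v - \<phi> (B v) u + brh u v))"


section \<open>Smooth manifolds\<close>

text \<open>
  Only used for open \<open>S\<close> in a finite-dimensional domain, where continuity of all iterated
  directional derivatives is the usual notion of \<open>C\<^sup>k\<close>.
\<close>

primrec Ck_on :: "nat \<Rightarrow> ('a::real_normed_vector \<Rightarrow> 'b::real_normed_vector) \<Rightarrow> 'a set \<Rightarrow> bool" where
  "Ck_on 0 f S \<longleftrightarrow> continuous_on S f"
| "Ck_on (Suc k) f S \<longleftrightarrow> (\<forall>x\<in>S. f differentiable (at x)) \<and>
     (\<forall>v. Ck_on k (\<lambda>x. frechet_derivative f (at x) v) S)"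

definition Cinf_on :: "('a::real_normed_vector \<Rightarrow> 'b::real_normed_vector) \<Rightarrow> 'a set \<Rightarrow> bool" where
  "Cinf_on f S \<longleftrightarrow> (\<forall>k. Ck_on k f S)"

text \<open>
  A chart is a pair of its domain and its coordinate map. Values of a coordinate map outside the
  domain are irrelevant. Atlases are not required to be maximal.
\<close>

type_synonym ('m, 'e) chart = "'m set \<times> ('m \<Rightarrow> 'e)"

definition smooth_atlas ::
  "('m::topological_space, 'e::real_normed_vector) chart set \<Rightarrow> bool" where
  "smooth_atlas A \<longleftrightarrow>
     (\<Union>(U, \<xi>)\<in>A. U) = UNIV \<and>
     (\<forall>(U, \<xi>)\<in>A. open U \<and> open (\<xi> ` U) \<and> homeomorphism U (\<xi> ` U) \<xi> (inv_into U \<xi>)) \<and>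
     (\<forall>(U, \<xi>)\<in>A. \<forall>(V, \<eta>)\<in>A. Cinf_on (\<eta> \<circ> inv_into U \<xi>) (\<xi> ` (U \<inter> V)))"

definition model_atlas :: "('e, 'e) chart set" where
  "model_atlas = {(UNIV, id)}"

definition prod_atlas ::
  "('m, 'e) chart set \<Rightarrow> ('n, 'f) chart set \<Rightarrow> ('m \<times> 'n, 'e \<times> 'f) chart set" where
  "prod_atlas A A' = {(U \<times> V, map_prod \<xi> \<eta>) | U \<xi> V \<eta>. (U, \<xi>) \<in> A \<and> (V, \<eta>) \<in> A'}"

definition smooth_map ::
  "('m::topological_space, 'e::real_normed_vector) chart set
    \<Rightarrow> ('n::topological_space, 'f::real_normed_vector) chart set
    \<Rightarrow> 'm set \<Rightarrow> ('m \<Rightarrow> 'n) \<Rightarrow> bool" where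
  "smooth_map A A' W F \<longleftrightarrow> open W \<and> continuous_on W F \<and>
     (\<forall>(U, \<xi>)\<in>A. \<forall>(V, \<eta>)\<in>A'.
        Cinf_on (\<eta> \<circ> F \<circ> inv_into U \<xi>) (\<xi> ` (U \<inter> W \<inter> F -` V)))"

definition smooth_near ::
  "('m::topological_space, 'e::real_normed_vector) chart set \<Rightarrow> 'm \<Rightarrow> ('m \<Rightarrow> real) \<Rightarrow> bool" where
  "smooth_near A p f \<longleftrightarrow> (\<exists>W. p \<in> W \<and> smooth_map A model_atlas W f)"


section \<open>Tangent vectors\<close>

text \<open>
  The tangent vector at \<open>p\<close> of a smooth curve is the operator sending a function that is smooth
  near \<open>p\<close> to its derivative along the curve. All such operators are set to \<open>0\<close> on functions that
  are not smooth near \<open>p\<close>, so that equality of tangent vectors is equality of HOL functions;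
  the vector space structure of the tangent space is the pointwise one.
\<close>

type_synonym 'm tangent_vector = "('m \<Rightarrow> real) \<Rightarrow> real"

definition smooth_curve_at ::
  "('m::topological_space, 'e::real_normed_vector) chart set \<Rightarrow> 'm \<Rightarrow> (real \<Rightarrow> 'm) \<Rightarrow> bool" where
  "smooth_curve_at A p \<gamma> \<longleftrightarrow> \<gamma> 0 = p \<and> (\<exists>\<epsilon>>0. smooth_map model_atlas A {-\<epsilon><..<\<epsilon>} \<gamma>)"

definition velocity ::
  "('m::topological_space, 'e::real_normed_vector) chart set \<Rightarrow> (real \<Rightarrow> 'm) \<Rightarrow> 'm tangent_vector"
  where
  "velocity A \<gamma> = (\<lambda>f. if smooth_near A (\<gamma> 0) f then deriv (\<lambda>t. f (\<gamma> t)) 0 else 0)"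

definition tangent_space ::
  "('m::topological_space, 'e::real_normed_vector) chart set \<Rightarrow> 'm \<Rightarrow> 'm tangent_vector set" where
  "tangent_space A p = {velocity A \<gamma> | \<gamma>. smooth_curve_at A p \<gamma>}"

text \<open>
  The tangent map at \<open>p\<close> of a map \<open>F\<close> that is smooth near \<open>p\<close>; the atlas is the one of the target.
\<close>

definition tangent_map ::
  "('n::topological_space, 'f::real_normed_vector) chart set \<Rightarrow> ('m \<Rightarrow> 'n) \<Rightarrow> 'm
    \<Rightarrow> 'm tangent_vector \<Rightarrow> 'n tangent_vector" where
  "tangent_map A' F p X = (\<lambda>f. if smooth_near A' (F p) f then X (f \<circ> F) else 0)"


section \<open>Lie groups\<close>

record ('g, 'm) smooth_group = "'g monoid" +
  atlas :: "('g, 'm) chart set"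

locale lie_group = group G
  for G :: "('g::{t2_space, second_countable_topology}, 'm::real_normed_vector) smooth_group"
    (structure) +
  assumes carrier_UNIV: "carrier G = UNIV"
    and finite_dim_model: "finite_dim TYPE('m)"
    and smooth_atlas: "smooth_atlas (atlas G)"
    and smooth_mult:
      "smooth_map (prod_atlas (atlas G) (atlas G)) (atlas G) UNIV (\<lambda>(x, y). x \<otimes> y)"
    and smooth_inv: "smooth_map (atlas G) (atlas G) UNIV (\<lambda>x. inv x)"

text \<open>
  The left-invariant vector field extending a tangent vector at the unit, and the bracket on the
  tangent space at the unit obtained by evaluating the commutator of left-invariant fields there.
\<close>

definition left_invariant_field ::
  "('g, 'm) smooth_group \<Rightarrow> 'g tangent_vector \<Rightarrow> 'g \<Rightarrow> 'g tangent_vector" where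
  "left_invariant_field G X g = (\<lambda>f. X (\<lambda>x. f (g \<otimes>\<^bsub>G\<^esub> x)))"

definition tangent_bracket ::
  "('g::topological_space, 'm::real_normed_vector) smooth_group
    \<Rightarrow> 'g tangent_vector \<Rightarrow> 'g tangent_vector \<Rightarrow> 'g tangent_vector" where
  "tangent_bracket G X Y = (\<lambda>f. if smooth_near (atlas G) \<one>\<^bsub>G\<^esub> f
     then X (\<lambda>g. left_invariant_field G Y g f) - Y (\<lambda>g. left_invariant_field G X g f) else 0)"

text \<open>
  \<open>G\<close> integrates a Lie algebra if its tangent space at the unit is identified with it by an
  isomorphism \<open>\<iota>\<close> of Lie algebras.
\<close>

definition integrates_lie_algebra ::
  "('g::topological_space, 'm::real_normed_vector) smooth_group
    \<Rightarrow> ('a::real_vector \<Rightarrow> 'a \<Rightarrow> 'a) \<Rightarrow> ('a \<Rightarrow> 'g tangent_vector) \<Rightarrow> bool" where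
  "integrates_lie_algebra G br \<iota> \<longleftrightarrow>
     bij_betw \<iota> UNIV (tangent_space (atlas G) \<one>\<^bsub>G\<^esub>) \<and>
     (\<forall>f. linear (\<lambda>x. \<iota> x f)) \<and>
     (\<forall>x y. \<iota> (br x y) = tangent_bracket G (\<iota> x) (\<iota> y))"

definition lie_group_automorphisms ::
  "('h::topological_space, 'n::real_normed_vector) smooth_group \<Rightarrow> ('h \<Rightarrow> 'h) set" where
  "lie_group_automorphisms H = {\<theta> \<in> iso H H. smooth_map (atlas H) (atlas H) UNIV \<theta> \<and>
     smooth_map (atlas H) (atlas H) UNIV (inv_into UNIV \<theta>)}"

definition lie_group_action ::
  "('g::topological_space, 'm::real_normed_vector) smooth_group
    \<Rightarrow> ('h::topological_space, 'n::real_normed_vector) smooth_group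
    \<Rightarrow> ('g \<Rightarrow> 'h \<Rightarrow> 'h) \<Rightarrow> bool" where
  "lie_group_action G H \<Phi> \<longleftrightarrow>
     (\<forall>g. \<Phi> g \<in> lie_group_automorphisms H) \<and>
     (\<forall>g g'. \<Phi> (g \<otimes>\<^bsub>G\<^esub> g') = \<Phi> g \<circ> \<Phi> g') \<and>
     smooth_map (prod_atlas (atlas G) (atlas H)) (atlas H) UNIV (\<lambda>(g, h). \<Phi> g h)"

text \<open>
  The linear automorphism of the Lie algebra of \<open>H\<close> given by the tangent map of \<open>\<Phi> g\<close> at the unit,
  read through the identification \<open>\<iota>H\<close>.
\<close>

definition tangent_action ::
  "('h::topological_space, 'n::real_normed_vector) smooth_group \<Rightarrow> ('b \<Rightarrow> 'h tangent_vector)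
    \<Rightarrow> ('g \<Rightarrow> 'h \<Rightarrow> 'h) \<Rightarrow> 'g \<Rightarrow> 'b \<Rightarrow> 'b" where
  "tangent_action H \<iota>H \<Phi> g v =
     inv_into UNIV \<iota>H (tangent_map (atlas H) (\<Phi> g) \<one>\<^bsub>H\<^esub> (\<iota>H v))"

text \<open>
  \<open>\<phi>\<close> is the tangent map at the unit of \<open>g \<mapsto> tangent_action H \<iota>H \<Phi> g\<close>, computed along smooth
  curves through the unit. Differentiating endomorphisms of a finite-dimensional space
  pointwise in \<open>v\<close> is the same as differentiating them in the space of endomorphisms.
\<close>

definition differentiated_action ::
  "('g::topological_space, 'm::real_normed_vector) smooth_group \<Rightarrow> ('a \<Rightarrow> 'g tangent_vector)
    \<Rightarrow> ('h::topological_space, 'n::real_normed_vector) smooth_group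
    \<Rightarrow> ('b::real_normed_vector \<Rightarrow> 'h tangent_vector)
    \<Rightarrow> ('g \<Rightarrow> 'h \<Rightarrow> 'h) \<Rightarrow> ('a \<Rightarrow> 'b \<Rightarrow> 'b) \<Rightarrow> bool" where
  "differentiated_action G \<iota>G H \<iota>H \<Phi> \<phi> \<longleftrightarrow>
     (\<forall>x v \<gamma>. smooth_curve_at (atlas G) \<one>\<^bsub>G\<^esub> \<gamma> \<and> velocity (atlas G) \<gamma> = \<iota>G x \<longrightarrow>
        ((\<lambda>t. tangent_action H \<iota>H \<Phi> (\<gamma> t) v) has_vector_derivative \<phi> x v) (at 0))"


section \<open>Local relative Rota--Baxter operators\<close>

text \<open>A map \<open>\<B> : U \<rightarrow> G\<close> is a total HOL function whose values outside \<open>U\<close> are irrelevant.\<close>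

definition local_relative_rota_baxter ::
  "('g::topological_space, 'm::real_normed_vector) smooth_group
    \<Rightarrow> ('h::topological_space, 'n::real_normed_vector) smooth_group
    \<Rightarrow> ('g \<Rightarrow> 'h \<Rightarrow> 'h) \<Rightarrow> 'h set \<Rightarrow> ('h \<Rightarrow> 'g) \<Rightarrow> bool" where
  "local_relative_rota_baxter G H \<Phi> U \<B> \<longleftrightarrow>
     open U \<and> \<one>\<^bsub>H\<^esub> \<in> U \<and> smooth_map (atlas H) (atlas G) U \<B> \<and>
     (\<forall>h\<^sub>1\<in>U. \<forall>h\<^sub>2\<in>U. h\<^sub>1 \<otimes>\<^bsub>H\<^esub> \<Phi> (\<B> h\<^sub>1) h\<^sub>2 \<in> U \<longrightarrow>
        \<B> h\<^sub>1 \<otimes>\<^bsub>G\<^esub> \<B> h\<^sub>2 = \<B> (h\<^sub>1 \<otimes>\<^bsub>H\<^esub> \<Phi> (\<B> h\<^sub>1) h\<^sub>2))"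

definition local_operator_eq ::
  "('h::topological_space, 'n) smooth_group
    \<Rightarrow> 'h set \<Rightarrow> ('h \<Rightarrow> 'g) \<Rightarrow> 'h set \<Rightarrow> ('h \<Rightarrow> 'g) \<Rightarrow> bool" where
  "local_operator_eq H U \<B> U' \<B>' \<longleftrightarrow>
     (\<exists>W. open W \<and> \<one>\<^bsub>H\<^esub> \<in> W \<and> W \<subseteq> U \<inter> U' \<and> (\<forall>h\<in>W. \<B> h = \<B>' h))"

definition integrates_operator ::
  "('g::topological_space, 'm::real_normed_vector) smooth_group \<Rightarrow> ('a \<Rightarrow> 'g tangent_vector)
    \<Rightarrow> ('h, 'n) smooth_group \<Rightarrow> ('b \<Rightarrow> 'h tangent_vector)
    \<Rightarrow> ('h \<Rightarrow> 'g) \<Rightarrow> ('b \<Rightarrow> 'a) \<Rightarrow> bool" where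
  "integrates_operator G \<iota>G H \<iota>H \<B> B \<longleftrightarrow>
     (\<forall>u. tangent_map (atlas G) \<B> \<one>\<^bsub>H\<^esub> (\<iota>H u) = \<iota>G (B u))"

end

theory Submission
  imports Defs
begin

text \<open>
  The graph of a local relative Rota--Baxter operator is a local subgroup of the semidirect product
  of \<open>H\<close> and \<open>G\<close>, and \<open>B\<close> is a relative Rota--Baxter operator of weight \<open>1\<close> exactly when its graph is a
  subalgebra of the semidirect product of \<open>\<hh>\<close> and \<open>\<gg>\<close>. The theorem is therefore an instance of the correspondence between Lie
  subalgebras and local subgroups; since the graph of \<open>B\<close> is complementary to \<open>\<gg>\<close>, the local subgroup is
  again a graph near the unit.

  Everything takes place near the unit, in a chart of \<open>H\<close> times a chart of \<open>G\<close>. Let \<open>\<beta>\<close> be \<open>B\<close> in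
  these coordinates and \<open>(q, p)\<close> the coordinates of the unit. The left translates of the graph of \<open>\<beta>\<close>
  are, at a point \<open>z\<close>, the graph of a linear map \<open>A z\<close> (locale \<open>graph_subalgebra\<close>). If the graph of a
  map \<open>b\<close> with \<open>b q = p\<close> and derivative \<open>\<beta>\<close> at \<open>q\<close> is closed under the product, then moving the right
  factor through the unit shows that \<open>b\<close> solves the total differential equation
  \<open>\<D> b a = A (a, b a)\<close> (\<open>closed_graph_total_equation\<close>). Along rays from \<open>q\<close> this is an ordinary
  differential equation with a Lipschitz right-hand side, so two such maps agree near \<open>q\<close>
  (\<open>closed_graph_unique\<close>).

  For existence, the equation is solved by a direct version of the Frobenius theorem
  (\<open>total_equation_solution\<close>). Its integrability condition \<open>A_integrable\<close> combines two facts: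
  the commutator of left-invariant fields is left-invariant (\<open>left_field_commutator\<close>, which follows from
  associativity and the symmetry of second derivatives), and the graph of \<open>\<beta>\<close> is a subalgebra.
  That the graph of the solution is closed under the product is again uniqueness for an ordinary
  differential equation, because the distribution is left-invariant (\<open>closed_graph_exists\<close>).

  The link to the intrinsic definitions consists in evaluating tangent vectors, which are operators on
  functions, at coordinate functions. This identifies the bracket and the differentiated action with
  second-order terms of the multiplications and of the action in coordinates (\<open>bracket_coordinates\<close>,
  \<open>action_coordinates\<close>, \<open>bracket_kprod\<close>), and turns the Rota--Baxter identity into the statement that
  the graph of \<open>\<beta>\<close> is closed under the bracket (\<open>graph_subalgebra_kprod\<close>).
\<close>

section \<open>Finite-dimensional normed spaces\<close>

lemma infdist_scale_le_norm:
  fixes b :: "'a::real_normed_vector"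
  assumes V: "subspace V" and x: "x - t *\<^sub>R b \<in> V"
  shows "\<bar>t\<bar> * infdist b V \<le> norm x"
proof (cases "t = 0")
  case False
  have "- (1 / t) *\<^sub>R (x - t *\<^sub>R b) \<in> V" using V x subspace_scale by blast
  then have "infdist b V \<le> dist b (- (1 / t) *\<^sub>R (x - t *\<^sub>R b))" by (rule infdist_le)
  also have "\<dots> = norm ((1 / t) *\<^sub>R x)"
    using False by (simp add: dist_norm scaleR_diff_right)
  finally show ?thesis using False by (simp add: field_simps)
qed auto

lemma infdist_span_pos:
  fixes b :: "'a::real_normed_vector"
  assumes "complete (span S)" "b \<notin> span S"
  shows "infdist b (span S) > 0"
proof -
  have "infdist b (span S) \<noteq> 0"
    using in_closed_iff_infdist_zero[OF complete_imp_closed[OF assms(1)], of b] assms(2) span_zero by blast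
  then show ?thesis using infdist_nonneg[of b "span S"] by linarith
qed

lemma Cauchy_dominated:
  fixes f :: "nat \<Rightarrow> 'a::real_normed_vector" and g :: "nat \<Rightarrow> 'b::real_normed_vector"
  assumes f: "Cauchy f" and le: "\<And>m n. norm (g m - g n) \<le> C * norm (f m - f n)" and C: "C > 0"
  shows "Cauchy g"
proof (rule CauchyI)
  fix e :: real assume "e > 0"
  then obtain M where M: "\<forall>m\<ge>M. \<forall>n\<ge>M. norm (f m - f n) < e / C"
    using CauchyD[OF f, of "e / C"] C by auto
  have "norm (g m - g n) < e" if "m \<ge> M" "n \<ge> M" for m n
  proof -
    have "C * norm (f m - f n) < e" using M that C by (auto simp: field_simps)
    then show ?thesis using le[of m n] by linarith
  qed
  then show "\<exists>M. \<forall>m\<ge>M. \<forall>n\<ge>M. norm (g m - g n) < e" by blast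
qed

text \<open>
  Adjoining one vector \<open>b\<close> to a complete subspace keeps it complete: \<open>b\<close> has positive distance from the
  subspace, so the coefficients of \<open>b\<close> in a Cauchy sequence form a Cauchy sequence themselves.
\<close>

lemma complete_span_finite:
  fixes S :: "'a::real_normed_vector set"
  assumes "finite S"
  shows "complete (span S)"
  using assms
proof (induction S)
  case empty
  show ?case by (simp add: compact_imp_complete)
next
  case (insert b S)
  show ?case
  proof (cases "b \<in> span S")
    case True
    then show ?thesis using insert.IH by (simp add: span_redundant)
  next
    case False
    define d where "d = infdist b (span S)"
    have d: "d > 0" using infdist_span_pos[OF insert.IH False] by (simp add: d_def)
    show ?thesis
    proof (rule completeI)
      fix f :: "nat \<Rightarrow> 'a"
      assume f: "\<forall>n. f n \<in> span (insert b S)" and C: "Cauchy f"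
      have "\<forall>n. \<exists>t. f n - t *\<^sub>R b \<in> span S" using f by (simp add: span_insert)
      then obtain t where t: "\<And>n. f n - t n *\<^sub>R b \<in> span S" by metis
      have tle: "\<bar>t m - t n\<bar> \<le> norm (f m - f n) / d" for m n
      proof -
        have "(f m - t m *\<^sub>R b) - (f n - t n *\<^sub>R b) \<in> span S" using t span_diff by blast
        then have "(f m - f n) - (t m - t n) *\<^sub>R b \<in> span S" by (simp add: algebra_simps)
        from infdist_scale_le_norm[OF subspace_span this] d show ?thesis
          by (simp add: d_def field_simps)
      qed
      have "Cauchy t" using tle d by (intro Cauchy_dominated[OF C, where C = "1 / d"]) auto
      then obtain T where T: "t \<longlonglongrightarrow> T" using Cauchy_convergent_iff convergent_def by blast
      then have Tb: "(\<lambda>n. t n *\<^sub>R b) \<longlonglongrightarrow> T *\<^sub>R b" by (intro tendsto_intros)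
      have "Cauchy (\<lambda>n. f n - t n *\<^sub>R b)"
      proof (rule Cauchy_dominated[OF C, where C = "1 + norm b / d"])
        fix m n
        have "norm ((f m - t m *\<^sub>R b) - (f n - t n *\<^sub>R b)) = norm ((f m - f n) - (t m - t n) *\<^sub>R b)"
          by (simp add: algebra_simps)
        also have "\<dots> \<le> norm (f m - f n) + \<bar>t m - t n\<bar> * norm b"
          using norm_triangle_ineq4[of "f m - f n" "(t m - t n) *\<^sub>R b"] by simp
        also have "\<dots> \<le> norm (f m - f n) + norm (f m - f n) / d * norm b"
          using tle by (intro add_left_mono mult_right_mono) auto
        finally show "norm ((f m - t m *\<^sub>R b) - (f n - t n *\<^sub>R b)) \<le> (1 + norm b / d) * norm (f m - f n)"
          by (simp add: distrib_right mult.commute)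
      qed (use d in \<open>simp add: add_pos_nonneg\<close>)
      from completeE[OF insert.IH _ this] t
      obtain s where s: "s \<in> span S" "(\<lambda>n. f n - t n *\<^sub>R b) \<longlonglongrightarrow> s" by metis
      have "(\<lambda>n. (f n - t n *\<^sub>R b) + t n *\<^sub>R b) \<longlonglongrightarrow> s + T *\<^sub>R b" by (intro tendsto_add s Tb)
      moreover have "s + T *\<^sub>R b \<in> span (insert b S)"
        using s(1) unfolding span_insert by (intro CollectI exI[of _ T]) simp
      ultimately show "\<exists>l\<in>span (insert b S). f \<longlonglongrightarrow> l" by auto
    qed
  qed
qed

text \<open>
  On a finite-dimensional space the coordinates with respect to a basis are bounded, because the
  span of the remaining basis vectors is complete, hence closed, and thus has positive distance
  from the basis vector in question. Everything below that depends on the equivalence of norms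
  goes through this lemma.
\<close>

lemma finite_dim_coordinates:
  assumes "finite_dim TYPE('a::real_normed_vector)"
  obtains S :: "'a::real_normed_vector set" and c :: "'a \<Rightarrow> 'a \<Rightarrow> real"
  where "finite S" "\<And>b. b \<in> S \<Longrightarrow> bounded_linear (c b)" "\<And>x. x = (\<Sum>b\<in>S. c b x *\<^sub>R b)"
proof -
  obtain S0 :: "'a set" where S0: "finite S0" "span S0 = UNIV"
    using assms by (auto simp: finite_dim_def)
  obtain S where S: "S \<subseteq> S0" "independent S" "S0 \<subseteq> span S"
    using maximal_independent_subset[of S0] by blast
  have fin: "finite S" using S(1) S0(1) finite_subset by blast
  have sp: "span S = UNIV" using S0(2) S(3) by (metis span_minimal subspace_span top.extremum_uniqueI)
  define c where "c b x = representation S x b" for b x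
  have eq: "x = (\<Sum>b\<in>S. c b x *\<^sub>R b)" for x
    unfolding c_def by (rule sum_representation_eq[OF S(2) _ fin subset_refl, symmetric]) (simp add: sp)
  have "bounded_linear (c b)" if b: "b \<in> S" for b
  proof -
    let ?V = "span (S - {b})"
    have d: "infdist b ?V > 0"
    proof (rule infdist_span_pos)
      show "complete ?V" using fin by (intro complete_span_finite) auto
      show "b \<notin> ?V" using S(2) b dependent_def by blast
    qed
    have "norm (c b x) \<le> norm x * (1 / infdist b ?V)" for x
    proof -
      have "x - c b x *\<^sub>R b = (\<Sum>a\<in>S - {b}. c a x *\<^sub>R a)"
        by (subst (1) eq[of x], subst sum.remove[OF fin b]) simp
      also have "\<dots> \<in> ?V" by (intro span_sum span_scale span_base)
      finally show ?thesis using infdist_scale_le_norm[OF subspace_span] d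
        by (simp add: field_simps)
    qed
    then show ?thesis
      by (intro bounded_linear_intro[where K = "1 / infdist b ?V"])
        (use S(2) sp in \<open>simp_all add: c_def representation_add representation_scale\<close>)
  qed
  then show ?thesis using that fin eq by blast
qed

lemma finite_dim_linear_bounded:
  fixes f :: "'a::real_normed_vector \<Rightarrow> 'b::real_normed_vector"
  assumes fd: "finite_dim TYPE('a)" and f: "linear f"
  shows "bounded_linear f"
proof -
  obtain S :: "'a set" and c where S: "finite S" "\<And>b. b \<in> S \<Longrightarrow> bounded_linear (c b)"
      "\<And>x. x = (\<Sum>b\<in>S. c b x *\<^sub>R b)"
    using finite_dim_coordinates[OF fd] by metis
  have "f x = (\<Sum>b\<in>S. c b x *\<^sub>R f b)" for x
    by (subst S(3)[of x]) (simp add: linear_sum[OF f] linear_scale[OF f])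
  then have "f = (\<lambda>x. \<Sum>b\<in>S. c b x *\<^sub>R f b)" by blast
  moreover have "bounded_linear (\<lambda>x. \<Sum>b\<in>S. c b x *\<^sub>R f b)"
    by (intro bounded_linear_sum bounded_linear_compose[OF bounded_linear_scaleR_left] S)
  ultimately show ?thesis by metis
qed

lemma finite_dim_prod:
  assumes "finite_dim TYPE('a::real_vector)" "finite_dim TYPE('b::real_vector)"
  shows "finite_dim TYPE('a \<times> 'b)"
proof -
  obtain S :: "'a set" and T :: "'b set" where ST: "finite S" "span S = UNIV" "finite T" "span T = UNIV"
    using assms by (auto simp: finite_dim_def)
  let ?B = "(\<lambda>x. (x, 0)) ` S \<union> (\<lambda>y. (0, y)) ` T"
  have l: "linear (\<lambda>x::'a. (x, 0::'b))" "linear (\<lambda>y::'b. (0::'a, y))" by (auto intro!: linearI)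
  have "(x, y) \<in> span ?B" for x y
  proof -
    have "(x, 0::'b) \<in> span ((\<lambda>x. (x, 0)) ` S)" by (simp add: linear_span_image[OF l(1)] ST(2))
    moreover have "(0::'a, y) \<in> span ((\<lambda>y. (0, y)) ` T)" by (simp add: linear_span_image[OF l(2)] ST(4))
    ultimately have "(x, 0) + (0, y) \<in> span ?B"
      by (meson span_add span_mono subsetD sup_ge1 sup_ge2)
    then show ?thesis by simp
  qed
  then show ?thesis unfolding finite_dim_def using ST by (intro exI[of _ ?B]) auto
qed

lemma finite_dim_real: "finite_dim TYPE(real)"
  unfolding finite_dim_def using span_Basis[where 'a = real]
  by (intro exI[of _ "Basis :: real set"] conjI finite_Basis)

text \<open>
  A finite-dimensional space is a retract of its bidual, which is a Banach space by construction.
  This gives access to integration and to the contraction principle.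
\<close>

lemma finite_dim_bidual_retraction:
  assumes "finite_dim TYPE('a::real_normed_vector)"
  obtains j :: "'a::real_normed_vector \<Rightarrow> (('a \<Rightarrow>\<^sub>L real) \<Rightarrow>\<^sub>L real)" and r
  where "bounded_linear j" "bounded_linear r" "\<And>x. r (j x) = x"
proof -
  obtain S :: "'a set" and c where S: "finite S" "\<And>b. b \<in> S \<Longrightarrow> bounded_linear (c b)"
      "\<And>x. x = (\<Sum>b\<in>S. c b x *\<^sub>R b)"
    using finite_dim_coordinates[OF assms] by metis
  define j where "j = (blinfun.prod_left :: 'a \<Rightarrow> (('a \<Rightarrow>\<^sub>L real) \<Rightarrow>\<^sub>L real))"
  define r where "r T = (\<Sum>b\<in>S. blinfun_apply T (Blinfun (c b)) *\<^sub>R b)" for T :: "('a \<Rightarrow>\<^sub>L real) \<Rightarrow>\<^sub>L real"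
  have "bounded_linear j" unfolding j_def by (rule blinfun.bounded_linear_prod_left)
  moreover have "bounded_linear r" unfolding r_def
    by (intro bounded_linear_sum bounded_linear_compose[OF bounded_linear_scaleR_left]
      blinfun.bounded_linear_left)
  moreover have "r (j x) = x" for x
    by (subst (2) S(3)[of x]) (simp add: r_def j_def S(2) bounded_linear_Blinfun_apply cong: sum.cong)
  ultimately show ?thesis using that by blast
qed

section \<open>Calculus of smooth maps\<close>

abbreviation \<D> :: "('a::real_normed_vector \<Rightarrow> 'b::real_normed_vector) \<Rightarrow> 'a \<Rightarrow> 'a \<Rightarrow> 'b" where
  "\<D> f x \<equiv> frechet_derivative f (at x)"

lemma has_derivative_frechet:
  "f differentiable (at x) \<Longrightarrow> (f has_derivative \<D> f x) (at x)"
  by (rule frechet_derivative_works[THEN iffD1])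

lemma Ck_on_subset: "Ck_on k f S \<Longrightarrow> T \<subseteq> S \<Longrightarrow> Ck_on k f T"
  by (induction k arbitrary: f) (auto intro: continuous_on_subset)

lemma Ck_on_cong:
  assumes "open S" "Ck_on k f S" "\<And>x. x \<in> S \<Longrightarrow> f x = g x"
  shows "Ck_on k g S"
  using assms(2,3)
proof (induction k arbitrary: f g)
  case 0
  then show ?case using continuous_on_cong by fastforce
next
  case (Suc k)
  have D: "(g has_derivative \<D> f x) (at x)" if "x \<in> S" for x
    using Suc.prems that assms(1)
    by (auto intro!: has_derivative_transform_within_open[OF has_derivative_frechet])
  then have E: "\<D> f x = \<D> g x" if "x \<in> S" for x
    using that frechet_derivative_at by blast
  show ?case
    unfolding Ck_on.simps
  proof (intro conjI ballI allI)
    show "g differentiable at x" if "x \<in> S" for x using D[OF that] differentiableI by blast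
    show "Ck_on k (\<lambda>x. \<D> g x v) S" for v
      by (rule Suc.IH[of "\<lambda>x. \<D> f x v"]) (use Suc.prems(1) E in auto)
  qed
qed

lemma Ck_on_SucI:
  assumes S: "open S" and D: "\<And>x. x \<in> S \<Longrightarrow> (f has_derivative f' x) (at x)"
    and C: "\<And>v. Ck_on k (\<lambda>x. f' x v) S"
  shows "Ck_on (Suc k) f S"
proof -
  have eq: "f' x = \<D> f x" if "x \<in> S" for x
    using D[OF that] frechet_derivative_at by blast
  have "Ck_on k (\<lambda>x. \<D> f x v) S" for v
    by (rule Ck_on_cong[OF S C[of v]]) (simp add: eq)
  then show ?thesis using D differentiableI by (metis Ck_on.simps(2))
qed

lemma Ck_on_Suc_imp: "Ck_on (Suc k) f S \<Longrightarrow> Ck_on k f S"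
proof (induction k arbitrary: f)
  case 0
  then show ?case
    by (auto intro!: continuous_at_imp_continuous_on differentiable_imp_continuous_within)
next
  case (Suc k)
  then show ?case by (metis Ck_on.simps(2))
qed

lemma Ck_on_const: "Ck_on k (\<lambda>x. c) S"
  by (induction k arbitrary: c) auto

lemma Ck_on_bounded_linear:
  assumes "open S" "bounded_linear l"
  shows "Ck_on k l S"
proof (cases k)
  case (Suc m)
  show ?thesis unfolding Suc
    by (rule Ck_on_SucI[OF assms(1) bounded_linear_imp_has_derivative[OF assms(2)]]) (rule Ck_on_const)
qed (use assms in \<open>auto intro: linear_continuous_on\<close>)

lemma Ck_on_bounded_linear_comp:
  assumes S: "open S" and l: "bounded_linear l" and f: "Ck_on k f S"
  shows "Ck_on k (\<lambda>x. l (f x)) S"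
  using f
proof (induction k arbitrary: f)
  case 0
  then show ?case using bounded_linear.continuous_on[OF l] by auto
next
  case (Suc k)
  show ?case
    by (rule Ck_on_SucI[OF S bounded_linear.has_derivative[OF l has_derivative_frechet]])
      (use Suc in auto)
qed

lemma Ck_on_add:
  assumes S: "open S" and "Ck_on k f S" "Ck_on k g S"
  shows "Ck_on k (\<lambda>x. f x + g x) S"
  using assms(2,3)
proof (induction k arbitrary: f g)
  case (Suc k)
  show ?case
    by (rule Ck_on_SucI[OF S has_derivative_add[OF has_derivative_frechet has_derivative_frechet]])
      (use Suc in auto)
qed (auto intro: continuous_on_add)

lemma Ck_on_sum:
  assumes S: "open S" and "\<And>i. i \<in> I \<Longrightarrow> Ck_on k (f i) S"
  shows "Ck_on k (\<lambda>x. \<Sum>i\<in>I. f i x) S"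
  using assms(2) by (induction I rule: infinite_finite_induct) (auto intro: Ck_on_add[OF S] Ck_on_const)

lemma Ck_on_bilinear:
  assumes S: "open S" and h: "bounded_bilinear h" and "Ck_on k f S" "Ck_on k g S"
  shows "Ck_on k (\<lambda>x. h (f x) (g x)) S"
  using assms(3,4)
proof (induction k arbitrary: f g)
  case 0
  then show ?case using bounded_bilinear.continuous_on[OF h] by auto
next
  case (Suc k)
  show ?case
    by (rule Ck_on_SucI[OF S bounded_bilinear.FDERIV[OF h has_derivative_frechet has_derivative_frechet]])
      (use Suc Ck_on_Suc_imp[OF Suc.prems(1)] Ck_on_Suc_imp[OF Suc.prems(2)]
        in \<open>auto intro!: Ck_on_add[OF S] Suc.IH\<close>)
qed

lemma Ck_on_Pair:
  assumes S: "open S" and f: "Ck_on k f S" and g: "Ck_on k g S"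
  shows "Ck_on k (\<lambda>x. (f x, g x)) S"
proof -
  have "bounded_linear (\<lambda>a::'b. (a, 0::'c))" "bounded_linear (\<lambda>b::'c. (0::'b, b))"
    by (auto intro: bounded_linear_Pair bounded_linear_ident bounded_linear_zero)
  then have "Ck_on k (\<lambda>x. (f x, 0) + (0, g x)) S"
    by (intro Ck_on_add[OF S] Ck_on_bounded_linear_comp[OF S _ f] Ck_on_bounded_linear_comp[OF S _ g])
  then show ?thesis by simp
qed

text \<open>
  Since \<^const>\<open>Ck_on\<close> speaks of directional derivatives along constant directions only, the chain rule
  needs the inner derivative to be expanded in a basis of the intermediate space.
\<close>

lemma Ck_on_compose:
  fixes f :: "'b::real_normed_vector \<Rightarrow> 'c::real_normed_vector"
    and g :: "'a::real_normed_vector \<Rightarrow> 'b"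
  assumes fd: "finite_dim TYPE('b)" and S: "open S" and T: "open T" and sub: "g ` S \<subseteq> T"
    and f: "Ck_on k f T" and g: "Ck_on k g S"
  shows "Ck_on k (\<lambda>x. f (g x)) S"
  using f g
proof (induction k arbitrary: f)
  case 0
  then show ?case using sub continuous_on_compose2 by auto
next
  case (Suc k)
  obtain B :: "'b set" and c where B: "finite B" "\<And>b. b \<in> B \<Longrightarrow> bounded_linear (c b)"
      "\<And>x. x = (\<Sum>b\<in>B. c b x *\<^sub>R b)"
    using finite_dim_coordinates[OF fd] by metis
  have diff: "f differentiable (at y)" if "y \<in> T" for y using Suc.prems that by auto
  have eq: "\<D> f y w = (\<Sum>b\<in>B. c b w *\<^sub>R \<D> f y b)"
    if "y \<in> T" for y w
  proof -
    have l: "linear (\<D> f y)" using linear_frechet_derivative diff[OF that] by blast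
    show ?thesis by (subst B(3)[of w]) (simp add: linear_sum[OF l] linear_scale[OF l])
  qed
  show ?case
  proof (rule Ck_on_SucI[OF S])
    fix x assume x: "x \<in> S"
    show "((\<lambda>x. f (g x)) has_derivative
        (\<lambda>v. \<Sum>b\<in>B. c b (\<D> g x v) *\<^sub>R \<D> f (g x) b)) (at x)"
      using diff_chain_at[OF has_derivative_frechet has_derivative_frechet, of g x f] x sub Suc.prems
      by (subst eq[symmetric]) (auto simp: o_def)
  next
    fix v
    show "Ck_on k (\<lambda>x. \<Sum>b\<in>B. c b (\<D> g x v) *\<^sub>R \<D> f (g x) b) S"
    proof (intro Ck_on_sum[OF S] Ck_on_bilinear[OF S bounded_bilinear_scaleR])
      fix b assume b: "b \<in> B"
      show "Ck_on k (\<lambda>x. c b (\<D> g x v)) S"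
        using Suc.prems by (intro Ck_on_bounded_linear_comp[OF S B(2)[OF b]]) auto
      show "Ck_on k (\<lambda>x. \<D> f (g x) b) S"
        using Suc.prems Ck_on_Suc_imp by (intro Suc.IH) auto
    qed
  qed
qed

lemma Cinf_on_subset: "Cinf_on f S \<Longrightarrow> T \<subseteq> S \<Longrightarrow> Cinf_on f T"
  unfolding Cinf_on_def using Ck_on_subset by blast

lemma Cinf_on_cong:
  "open S \<Longrightarrow> Cinf_on f S \<Longrightarrow> (\<And>x. x \<in> S \<Longrightarrow> f x = g x) \<Longrightarrow> Cinf_on g S"
  unfolding Cinf_on_def using Ck_on_cong by blast

lemma Cinf_on_const: "Cinf_on (\<lambda>x. c) S"
  unfolding Cinf_on_def by (simp add: Ck_on_const)

lemma Cinf_on_bounded_linear: "open S \<Longrightarrow> bounded_linear l \<Longrightarrow> Cinf_on l S"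
  unfolding Cinf_on_def by (simp add: Ck_on_bounded_linear)

lemma Cinf_on_bounded_linear_comp:
  "open S \<Longrightarrow> bounded_linear l \<Longrightarrow> Cinf_on f S \<Longrightarrow> Cinf_on (\<lambda>x. l (f x)) S"
  unfolding Cinf_on_def by (simp add: Ck_on_bounded_linear_comp)

lemma Cinf_on_ident: "open S \<Longrightarrow> Cinf_on (\<lambda>x. x) S"
  by (rule Cinf_on_bounded_linear) auto

lemma Cinf_on_add: "open S \<Longrightarrow> Cinf_on f S \<Longrightarrow> Cinf_on g S \<Longrightarrow> Cinf_on (\<lambda>x. f x + g x) S"
  unfolding Cinf_on_def by (simp add: Ck_on_add)

lemma Cinf_on_Pair: "open S \<Longrightarrow> Cinf_on f S \<Longrightarrow> Cinf_on g S \<Longrightarrow> Cinf_on (\<lambda>x. (f x, g x)) S"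
  unfolding Cinf_on_def by (simp add: Ck_on_Pair)

lemma Cinf_on_fst: "open S \<Longrightarrow> Cinf_on f S \<Longrightarrow> Cinf_on (\<lambda>x. fst (f x)) S"
  by (rule Cinf_on_bounded_linear_comp[OF _ bounded_linear_fst])

lemma Cinf_on_snd: "open S \<Longrightarrow> Cinf_on f S \<Longrightarrow> Cinf_on (\<lambda>x. snd (f x)) S"
  by (rule Cinf_on_bounded_linear_comp[OF _ bounded_linear_snd])

lemma Cinf_on_compose:
  fixes f :: "'b::real_normed_vector \<Rightarrow> 'c::real_normed_vector"
    and g :: "'a::real_normed_vector \<Rightarrow> 'b"
  assumes "finite_dim TYPE('b)" "open S" "open T" "\<And>x. x \<in> S \<Longrightarrow> g x \<in> T" "Cinf_on f T" "Cinf_on g S"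
  shows "Cinf_on (\<lambda>x. f (g x)) S"
  using assms unfolding Cinf_on_def by (blast intro: Ck_on_compose)

lemma Cinf_on_differentiable: "Cinf_on f S \<Longrightarrow> x \<in> S \<Longrightarrow> f differentiable (at x)"
  unfolding Cinf_on_def using Ck_on.simps(2) by blast

lemma Cinf_on_has_derivative:
  "Cinf_on f S \<Longrightarrow> x \<in> S \<Longrightarrow> (f has_derivative \<D> f x) (at x)"
  using Cinf_on_differentiable has_derivative_frechet by blast

lemma Cinf_on_linear_derivative: "Cinf_on f S \<Longrightarrow> x \<in> S \<Longrightarrow> linear (\<D> f x)"
  using Cinf_on_differentiable linear_frechet_derivative by blast

lemma Cinf_on_derivative: "Cinf_on f S \<Longrightarrow> Cinf_on (\<lambda>x. \<D> f x v) S"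
  unfolding Cinf_on_def using Ck_on.simps(2) by blast

lemma Cinf_on_continuous: "Cinf_on f S \<Longrightarrow> continuous_on S f"
  unfolding Cinf_on_def using Ck_on.simps(1) by blast

text \<open>
  Smooth families of linear maps occur below as functions of two arguments that are smooth in the
  first for each fixed second argument. Expanding the second argument in a basis gives smoothness
  in both arguments together.
\<close>

lemma Cinf_on_apply:
  fixes A :: "'k::real_normed_vector \<Rightarrow> 'n::real_normed_vector \<Rightarrow> 'm::real_normed_vector"
  assumes fdk: "finite_dim TYPE('k)" and fdn: "finite_dim TYPE('n)" and N: "open N" and S: "open S"
    and A: "\<And>w. Cinf_on (\<lambda>z. A z w) N" and lin: "\<And>z. z \<in> N \<Longrightarrow> linear (A z)"
    and X: "Cinf_on X S" "\<And>s. s \<in> S \<Longrightarrow> X s \<in> N" and W: "Cinf_on W S"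
  shows "Cinf_on (\<lambda>s. A (X s) (W s)) S"
proof -
  obtain B :: "'n set" and c where B: "finite B" "\<And>b. b \<in> B \<Longrightarrow> bounded_linear (c b)"
      "\<And>x. x = (\<Sum>b\<in>B. c b x *\<^sub>R b)"
    using finite_dim_coordinates[OF fdn] by metis
  have "Cinf_on (\<lambda>s. \<Sum>b\<in>B. c b (W s) *\<^sub>R A (X s) b) S"
    using W Cinf_on_compose[OF fdk S N X(2) A X(1)] unfolding Cinf_on_def
    by (intro allI Ck_on_sum[OF S] Ck_on_bilinear[OF S bounded_bilinear_scaleR]
        Ck_on_bounded_linear_comp[OF S B(2)]) auto
  moreover have "(\<Sum>b\<in>B. c b (W s) *\<^sub>R A (X s) b) = A (X s) (W s)" if "s \<in> S" for s
  proof -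
    have l: "linear (A (X s))" using lin X(2) that by blast
    have "A (X s) (W s) = A (X s) (\<Sum>b\<in>B. c b (W s) *\<^sub>R b)" by (rule arg_cong[OF B(3)])
    then show ?thesis by (simp add: linear_sum[OF l] linear_scale[OF l])
  qed
  ultimately show ?thesis by (rule Cinf_on_cong[OF S])
qed

lemma Cinf_on_frechet_apply:
  fixes f :: "'k::real_normed_vector \<Rightarrow> 'm::real_normed_vector"
  assumes fdk: "finite_dim TYPE('k)" and N: "open N" and S: "open S"
    and f: "Cinf_on f N" and X: "Cinf_on X S" "\<And>s. s \<in> S \<Longrightarrow> X s \<in> N" and W: "Cinf_on W S"
  shows "Cinf_on (\<lambda>s. \<D> f (X s) (W s)) S"
  using Cinf_on_linear_derivative[OF f]
  by (intro Cinf_on_apply[OF fdk fdk N S Cinf_on_derivative[OF f] _ X W])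

lemma frechet_derivative_apply_vector:
  assumes "f differentiable (at x)" "bounded_linear l"
  shows "\<D> (\<lambda>x. l (f x)) x v = l (\<D> f x v)"
  using bounded_linear.has_derivative[OF assms(2) has_derivative_frechet[OF assms(1)]]
    frechet_derivative_at by metis

lemma frechet_derivative_cong_open:
  assumes "open S" "x \<in> S" "\<And>y. y \<in> S \<Longrightarrow> f y = g y"
  shows "\<D> f x = \<D> g x"
proof -
  have "(f has_derivative D) (at x) \<longleftrightarrow> (g has_derivative D) (at x)" for D
    using has_derivative_transform_within_open[OF _ assms(1,2)] assms(3) by metis
  then show ?thesis unfolding frechet_derivative_def by simp
qed

text \<open>
  Products and actions in coordinates are curried functions \<open>f\<close> that are smooth jointly. Their derivative
  in the second argument is the joint derivative in the directions \<open>(0, Y)\<close>, and therefore depends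
  smoothly on the first argument.
\<close>

lemma partial_derivative:
  assumes f: "Cinf_on (\<lambda>s. f (fst s) (snd s)) D" and ab: "(a, b) \<in> D"
  shows "(f a has_derivative (\<lambda>Y. \<D> (\<lambda>s. f (fst s) (snd s)) (a, b) (0, Y))) (at b)"
proof -
  have "((\<lambda>b. (a, b)) has_derivative (\<lambda>Y. (0, Y))) (at b)" by (auto intro!: derivative_eq_intros)
  from has_derivative_compose[OF this Cinf_on_has_derivative[OF f ab]] show ?thesis by simp
qed

lemma partial_has_derivative:
  assumes "Cinf_on (\<lambda>s. f (fst s) (snd s)) D" "(a, b) \<in> D"
  shows "(f a has_derivative \<D> (f a) b) (at b)"
  using partial_derivative[OF assms] by (intro has_derivative_frechet differentiableI)

lemma partial_smooth:
  fixes f :: "'a::real_normed_vector \<Rightarrow> 'b::real_normed_vector \<Rightarrow> 'c::real_normed_vector"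
  assumes fda: "finite_dim TYPE('a)" and fdb: "finite_dim TYPE('b)"
    and f: "Cinf_on (\<lambda>s. f (fst s) (snd s)) D" and D: "open D" and S: "open S"
    and SD: "\<And>a. a \<in> S \<Longrightarrow> (a, b) \<in> D"
  shows "Cinf_on (\<lambda>a. \<D> (f a) b Y) S"
proof (rule Cinf_on_cong[OF S])
  show "Cinf_on (\<lambda>a. \<D> (\<lambda>s. f (fst s) (snd s)) (a, b) (0, Y)) S"
    using SD by (intro Cinf_on_frechet_apply[OF finite_dim_prod[OF fda fdb] D S f]
      Cinf_on_Pair Cinf_on_ident Cinf_on_const S)
  show "\<D> (\<lambda>s. f (fst s) (snd s)) (a, b) (0, Y) = \<D> (f a) b Y"
    if "a \<in> S" for a
    using fun_cong[OF frechet_derivative_at[OF partial_derivative[OF f SD[OF that]]]] .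
qed

text \<open>
  Symmetry of second derivatives: the mixed second difference of a real-valued function equals
  \<open>s\<^sup>2\<close> times either mixed derivative at points within distance \<open>O(s)\<close>, by applying the mean value
  theorem twice.
\<close>

lemma second_difference_mvt:
  fixes f :: "'a::real_normed_vector \<Rightarrow> real"
  assumes f: "Cinf_on f S" and s: "s > 0"
    and sub: "\<And>a b. 0 \<le> a \<Longrightarrow> a \<le> s \<Longrightarrow> 0 \<le> b \<Longrightarrow> b \<le> s \<Longrightarrow> x + a *\<^sub>R v + b *\<^sub>R w \<in> S"
  shows "\<exists>a b. 0 \<le> a \<and> a \<le> s \<and> 0 \<le> b \<and> b \<le> s \<and>
    f (x + s *\<^sub>R v + s *\<^sub>R w) - f (x + s *\<^sub>R v) - f (x + s *\<^sub>R w) + f x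
    = s\<^sup>2 * \<D> (\<lambda>y. \<D> f y v) (x + a *\<^sub>R v + b *\<^sub>R w) w"
proof -
  define Df where "Df y = \<D> f y" for y
  define D2 where "D2 y = \<D> (\<lambda>y. Df y v) y" for y
  have dd: "((\<lambda>t. f (x + t *\<^sub>R v + b *\<^sub>R w)) has_real_derivative Df (x + t *\<^sub>R v + b *\<^sub>R w) v) (at t)"
    if "0 \<le> t" "t \<le> s" "0 \<le> b" "b \<le> s" for t b
  proof -
    have "((\<lambda>t. x + t *\<^sub>R v + b *\<^sub>R w) has_derivative (\<lambda>h. h *\<^sub>R v)) (at t)"
      by (auto intro!: derivative_eq_intros)
    from diff_chain_at[OF this] Cinf_on_has_derivative[OF f sub[OF that]]
    have "((\<lambda>t. f (x + t *\<^sub>R v + b *\<^sub>R w)) has_derivative (\<lambda>h. Df (x + t *\<^sub>R v + b *\<^sub>R w) (h *\<^sub>R v))) (at t)"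
      by (auto simp: o_def Df_def)
    then show ?thesis
      using linear_scale[OF Cinf_on_linear_derivative[OF f sub[OF that]]]
      by (auto simp: has_field_derivative_def Df_def mult_commute_abs)
  qed
  have dd2: "((\<lambda>t. Df (x + a *\<^sub>R v + t *\<^sub>R w) v) has_real_derivative D2 (x + a *\<^sub>R v + t *\<^sub>R w) w) (at t)"
    if "0 \<le> t" "t \<le> s" "0 \<le> a" "a \<le> s" for t a
  proof -
    have C: "Cinf_on (\<lambda>y. Df y v) S" unfolding Df_def by (rule Cinf_on_derivative[OF f])
    have "((\<lambda>t. x + a *\<^sub>R v + t *\<^sub>R w) has_derivative (\<lambda>h. h *\<^sub>R w)) (at t)"
      by (auto intro!: derivative_eq_intros)
    from diff_chain_at[OF this] Cinf_on_has_derivative[OF C sub[OF that(3,4,1,2)]]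
    have "((\<lambda>t. Df (x + a *\<^sub>R v + t *\<^sub>R w) v) has_derivative (\<lambda>h. D2 (x + a *\<^sub>R v + t *\<^sub>R w) (h *\<^sub>R w))) (at t)"
      by (auto simp: o_def D2_def)
    then show ?thesis
      using linear_scale[OF Cinf_on_linear_derivative[OF C sub[OF that(3,4,1,2)]]]
      by (auto simp: has_field_derivative_def D2_def mult_commute_abs)
  qed
  define p where "p t = f (x + t *\<^sub>R v + s *\<^sub>R w) - f (x + t *\<^sub>R v + 0 *\<^sub>R w)" for t
  have "\<exists>a>0. a < s \<and> p s - p 0 = (s - 0) * (Df (x + a *\<^sub>R v + s *\<^sub>R w) v - Df (x + a *\<^sub>R v + 0 *\<^sub>R w) v)"
    unfolding p_def using s by (intro MVT2 DERIV_diff dd) auto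
  then obtain a where a: "0 < a" "a < s"
    "p s - p 0 = s * (Df (x + a *\<^sub>R v + s *\<^sub>R w) v - Df (x + a *\<^sub>R v + 0 *\<^sub>R w) v)" by auto
  have "\<exists>b>0. b < s \<and> Df (x + a *\<^sub>R v + s *\<^sub>R w) v - Df (x + a *\<^sub>R v + 0 *\<^sub>R w) v
      = (s - 0) * D2 (x + a *\<^sub>R v + b *\<^sub>R w) w"
    using s a by (intro MVT2 dd2) auto
  then obtain b where b: "0 < b" "b < s"
    "Df (x + a *\<^sub>R v + s *\<^sub>R w) v - Df (x + a *\<^sub>R v + 0 *\<^sub>R w) v = s * D2 (x + a *\<^sub>R v + b *\<^sub>R w) w" by auto
  have "p s - p 0 = s\<^sup>2 * D2 (x + a *\<^sub>R v + b *\<^sub>R w) w"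
    using a(3) b(3) by (simp add: power2_eq_square)
  moreover have "p s - p 0 = f (x + s *\<^sub>R v + s *\<^sub>R w) - f (x + s *\<^sub>R v) - f (x + s *\<^sub>R w) + f x"
    by (simp add: p_def)
  ultimately show ?thesis using a b
    by (intro exI[of _ a] exI[of _ b]) (auto simp: D2_def Df_def)
qed

lemma second_derivative_symmetric_real:
  fixes f :: "'a::real_normed_vector \<Rightarrow> real"
  assumes S: "open S" "x \<in> S" and f: "Cinf_on f S"
  shows "\<D> (\<lambda>y. \<D> f y v) x w
    = \<D> (\<lambda>y. \<D> f y w) x v"
proof -
  define F where "F v w y = \<D> (\<lambda>y. \<D> f y v) y w" for v w y
  have cont: "isCont (\<lambda>y. F v w y) x" for v w unfolding F_def
    using Cinf_on_continuous[OF Cinf_on_derivative[OF Cinf_on_derivative[OF f]]] S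
    by (simp add: continuous_on_eq_continuous_at)
  have close: "\<bar>F v w x - F w v x\<bar> < 2 * e" if e: "e > 0" for e
  proof -
    have "\<forall>\<^sub>F y in nhds x. dist (F v w y) (F v w x) < e \<and> dist (F w v y) (F w v x) < e \<and> y \<in> S"
      using cont[of v w] cont[of w v] S e
      by (intro eventually_conj) (auto simp: continuous_at tendsto_iff eventually_nhds_conv_at eventually_nhds
        intro: eventually_at_in_open')
    then obtain d where d: "d > 0" "\<And>y. dist y x < d \<Longrightarrow>
        dist (F v w y) (F v w x) < e \<and> dist (F w v y) (F w v x) < e \<and> y \<in> S"
      unfolding eventually_nhds_metric by blast
    define s where "s = d / (2 * (norm v + norm w + 1))"
    have s: "s > 0" using d(1) by (simp add: s_def add_nonneg_pos)
    have near: "dist (x + a *\<^sub>R v + b *\<^sub>R w) x < d" if "0 \<le> a" "a \<le> s" "0 \<le> b" "b \<le> s" for a b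
    proof -
      have "dist (x + a *\<^sub>R v + b *\<^sub>R w) x = norm (a *\<^sub>R v + b *\<^sub>R w)"
        by (simp add: dist_norm)
      also have "\<dots> \<le> a * norm v + b * norm w" using that norm_triangle_ineq[of "a *\<^sub>R v" "b *\<^sub>R w"] by simp
      also have "\<dots> \<le> s * norm v + s * norm w" using that by (intro add_mono mult_right_mono) auto
      also have "\<dots> < 2 * (s * (norm v + norm w + 1))" using s
        by (simp add: distrib_left add_nonneg_pos add_strict_increasing2)
      also have "\<dots> = d" unfolding s_def
        using norm_ge_zero[of v] norm_ge_zero[of w] by (simp add: field_simps add_nonneg_eq_0_iff)
      finally show ?thesis .
    qed
    obtain a b where ab: "0 \<le> a" "a \<le> s" "0 \<le> b" "b \<le> s"
      "f (x + s *\<^sub>R v + s *\<^sub>R w) - f (x + s *\<^sub>R v) - f (x + s *\<^sub>R w) + f x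
        = s\<^sup>2 * F v w (x + a *\<^sub>R v + b *\<^sub>R w)"
      using second_difference_mvt[OF f s, of x v w] near d(2) unfolding F_def by blast
    have near': "dist (x + b *\<^sub>R w + a *\<^sub>R v) x < d" if "0 \<le> a" "a \<le> s" "0 \<le> b" "b \<le> s" for a b
      using near[OF that] by (simp add: algebra_simps)
    obtain a' b' where ab': "0 \<le> a'" "a' \<le> s" "0 \<le> b'" "b' \<le> s"
      "f (x + s *\<^sub>R w + s *\<^sub>R v) - f (x + s *\<^sub>R w) - f (x + s *\<^sub>R v) + f x
        = s\<^sup>2 * F w v (x + a' *\<^sub>R w + b' *\<^sub>R v)"
      using second_difference_mvt[OF f s, of x w v] near' d(2) unfolding F_def by blast
    have "s\<^sup>2 * F v w (x + a *\<^sub>R v + b *\<^sub>R w) = s\<^sup>2 * F w v (x + a' *\<^sub>R w + b' *\<^sub>R v)"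
      using ab(5) ab'(5) by (simp add: algebra_simps)
    then have "F v w (x + a *\<^sub>R v + b *\<^sub>R w) = F w v (x + a' *\<^sub>R w + b' *\<^sub>R v)" using s by simp
    then show ?thesis using d(2)[OF near[OF ab(1-4)]] d(2)[OF near'[OF ab'(3,4,1,2)]]
      by (auto simp: dist_real_def)
  qed
  have "F v w x = F w v x"
  proof (rule ccontr)
    assume "F v w x \<noteq> F w v x"
    then show False using close[of "\<bar>F v w x - F w v x\<bar> / 2"] by simp
  qed
  then show ?thesis by (simp add: F_def)
qed

lemma second_derivative_symmetric:
  fixes f :: "'a::real_normed_vector \<Rightarrow> 'b::real_normed_vector"
  assumes fd: "finite_dim TYPE('b)" and S: "open S" "x \<in> S" and f: "Cinf_on f S"
  shows "\<D> (\<lambda>y. \<D> f y v) x w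
    = \<D> (\<lambda>y. \<D> f y w) x v"
proof -
  obtain B :: "'b set" and c where B: "finite B" "\<And>b. b \<in> B \<Longrightarrow> bounded_linear (c b)"
      "\<And>x. x = (\<Sum>b\<in>B. c b x *\<^sub>R b)"
    using finite_dim_coordinates[OF fd] by metis
  have comp: "c b (\<D> (\<lambda>y. \<D> f y v) x w)
    = \<D> (\<lambda>y. \<D> (\<lambda>y. c b (f y)) y v) x w" if b: "b \<in> B" for b v w
  proof -
    have "c b (\<D> (\<lambda>y. \<D> f y v) x w)
      = \<D> (\<lambda>y. c b (\<D> f y v)) x w"
      using Cinf_on_differentiable[OF Cinf_on_derivative[OF f] S(2)]
      by (subst frechet_derivative_apply_vector[OF _ B(2)[OF b]]) auto
    also have "\<dots> = \<D> (\<lambda>y. \<D> (\<lambda>y. c b (f y)) y v) x w"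
      using Cinf_on_differentiable[OF f]
      by (subst frechet_derivative_cong_open[OF S])
        (auto simp: frechet_derivative_apply_vector[OF _ B(2)[OF b]])
    finally show ?thesis .
  qed
  have sym: "c b (\<D> (\<lambda>y. \<D> f y v) x w)
    = c b (\<D> (\<lambda>y. \<D> f y w) x v)" if b: "b \<in> B" for b
    unfolding comp[OF b]
    by (rule second_derivative_symmetric_real[OF S Cinf_on_bounded_linear_comp[OF S(1) B(2)[OF b] f]])
  show ?thesis by (subst (1 2) B(3)) (use sym in simp)
qed

section \<open>Local bounds\<close>

lemma linear_bound_from_ball:
  assumes "linear f" "c > 0" and le: "\<And>w. norm w < c \<Longrightarrow> norm (f w) \<le> M"
  shows "norm (f w) \<le> (2 * M / c) * norm w"
proof (cases "w = 0")
  case True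
  then show ?thesis using linear_0[OF assms(1)] by simp
next
  case False
  define s where "s = c / (2 * norm w)"
  have s: "s > 0" using False assms(2) by (simp add: s_def)
  have "norm (s *\<^sub>R w) < c" using False assms(2) by (simp add: s_def)
  then have "norm (f (s *\<^sub>R w)) \<le> M" by (rule le)
  then have "s * norm (f w) \<le> M" using s linear_scale[OF assms(1)] by simp
  then show ?thesis using False assms(2) by (simp add: s_def field_simps)
qed

lemma Pair_mem_ball:
  fixes a e :: "'a::real_normed_vector" and b f :: "'b::real_normed_vector"
  shows "dist a e + dist b f < r \<Longrightarrow> (a, b) \<in> ball (e, f) r"
  using norm_Pair_le[of "e - a" "f - b"] by (simp add: dist_norm norm_minus_commute)

text \<open>
  Continuity at \<open>(e, 0)\<close> bounds \<open>A z w\<close> for small \<open>w\<close> and all \<open>z\<close> near \<open>e\<close>, and homogeneity in \<open>w\<close>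
  turns this into a uniform operator bound.
\<close>

lemma local_operator_bound:
  fixes A :: "'k::real_normed_vector \<Rightarrow> 'n::real_normed_vector \<Rightarrow> 'm::real_normed_vector"
  assumes N: "open N" "e \<in> N" and cont: "continuous_on (N \<times> UNIV) (\<lambda>(z, w). A z w)"
    and lin: "\<And>z. z \<in> N \<Longrightarrow> linear (A z)"
  shows "\<exists>r>0. \<exists>K\<ge>0. ball e r \<subseteq> N \<and> (\<forall>z\<in>ball e r. \<forall>w. norm (A z w) \<le> K * norm w)"
proof -
  have "isCont (\<lambda>(z, w). A z w) (e, 0)"
    using cont N by (simp add: continuous_on_eq_continuous_at open_Times)
  moreover have "A e 0 = 0" using lin[OF N(2)] by (rule linear_0)
  ultimately obtain d where d: "d > 0" "\<And>z w. dist (z, w) (e, 0) < d \<Longrightarrow> norm (A z w) < 1"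
    unfolding continuous_at_eps_delta by (force dest: spec[of _ 1])
  obtain d0 where d0: "d0 > 0" "ball e d0 \<subseteq> N" using N open_contains_ball by blast
  define r where "r = min d0 (d / 2)"
  have r: "r > 0" "ball e r \<subseteq> N" using d(1) d0 by (auto simp: r_def)
  have "norm (A z w) \<le> (2 * 1 / (d / 2)) * norm w" if z: "z \<in> ball e r" for z w
  proof (rule linear_bound_from_ball)
    show "linear (A z)" using z r lin by blast
    fix w' :: 'n assume "norm w' < d / 2"
    then have "(z, w') \<in> ball (e, 0) d"
      using z by (intro Pair_mem_ball) (auto simp: r_def dist_commute)
    then show "norm (A z w') \<le> 1" using d(2)[of z w'] by (simp add: dist_commute)
  qed (use d in simp)
  then show ?thesis using r d(1) by (intro exI[of _ r] conjI exI[of _ "2 * 1 / (d / 2)"]) auto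
qed

lemma Cinf_local_lipschitz:
  fixes f :: "'k::real_normed_vector \<Rightarrow> 'm::real_normed_vector"
  assumes fd: "finite_dim TYPE('k)" and N: "open N" "e \<in> N" and f: "Cinf_on f N"
  shows "\<exists>r>0. \<exists>K\<ge>0. ball e r \<subseteq> N \<and> (\<forall>z\<in>ball e r. \<forall>z'\<in>ball e r. norm (f z - f z') \<le> K * norm (z - z'))"
proof -
  have "Cinf_on (\<lambda>s. \<D> f (fst s) (snd s)) (N \<times> UNIV)"
    using N by (intro Cinf_on_frechet_apply[OF fd N(1) _ f] Cinf_on_fst Cinf_on_snd Cinf_on_ident) (auto simp: open_Times)
  then have "continuous_on (N \<times> UNIV) (\<lambda>(z, w). \<D> f z w)"
    using Cinf_on_continuous by (simp add: case_prod_unfold)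
  from local_operator_bound[OF N this Cinf_on_linear_derivative[OF f]]
  obtain r K where r: "r > 0" "K \<ge> 0" "ball e r \<subseteq> N"
    "\<And>z w. z \<in> ball e r \<Longrightarrow> norm (\<D> f z w) \<le> K * norm w" by blast
  have "norm (f z - f z') \<le> K * norm (z - z')" if "z \<in> ball e r" "z' \<in> ball e r" for z z'
  proof (rule differentiable_bound[OF convex_ball _ _ that])
    show "(f has_derivative \<D> f x) (at x within ball e r)" if "x \<in> ball e r" for x
      using Cinf_on_has_derivative[OF f] that r(3) has_derivative_at_withinI by blast
    show "onorm (\<D> f x) \<le> K" if "x \<in> ball e r" for x
      using r(2,4) that by (intro onorm_bound) auto
  qed
  then show ?thesis using r by blast
qed

lemma operator_family_lipschitz:
  fixes A :: "'k::real_normed_vector \<Rightarrow> 'n::real_normed_vector \<Rightarrow> 'm::real_normed_vector"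
  assumes fdk: "finite_dim TYPE('k)" and fdn: "finite_dim TYPE('n)" and N: "open N" "e \<in> N"
    and A: "\<And>w. Cinf_on (\<lambda>z. A z w) N" and lin: "\<And>z. z \<in> N \<Longrightarrow> linear (A z)"
  shows "\<exists>r>0. \<exists>K\<ge>0. ball e r \<subseteq> N \<and>
    (\<forall>z\<in>ball e r. \<forall>z'\<in>ball e r. \<forall>w. norm (A z w - A z' w) \<le> K * norm (z - z') * norm w)"
proof -
  have C: "Cinf_on (\<lambda>s. A (fst s) (snd s)) (N \<times> UNIV)"
    using N lin by (intro Cinf_on_apply[OF fdk fdn N(1) _ A] Cinf_on_fst Cinf_on_snd Cinf_on_ident) (auto simp: open_Times)
  have NU: "open (N \<times> (UNIV :: 'n set))" "(e, 0) \<in> N \<times> (UNIV :: 'n set)" using N by (auto simp: open_Times)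
  from Cinf_local_lipschitz[OF finite_dim_prod[OF fdk fdn] NU C]
  obtain r K where r: "r > 0" "K \<ge> 0" "ball (e, 0::'n) r \<subseteq> N \<times> UNIV"
    and r_lip: "\<forall>z\<in>ball (e, 0) r. \<forall>z'\<in>ball (e, 0) r.
      norm (A (fst z) (snd z) - A (fst z') (snd z')) \<le> K * norm (z - z')"
    by (elim exE conjE) (rule that)
  have sub: "ball e (r / 2) \<subseteq> N"
  proof
    fix z assume "z \<in> ball e (r / 2)"
    then have "(z, 0) \<in> ball (e, 0::'n) r" using r(1) by (intro Pair_mem_ball) (auto simp: dist_commute)
    then show "z \<in> N" using r(3) by auto
  qed
  have "norm (A z w - A z' w) \<le> (2 * (K * norm (z - z')) / (r / 2)) * norm w"
    if z: "z \<in> ball e (r / 2)" "z' \<in> ball e (r / 2)" for z z' w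
  proof (rule linear_bound_from_ball[where f = "\<lambda>w. A z w - A z' w"])
    show "linear (\<lambda>w. A z w - A z' w)" using z sub lin by (intro linear_compose_sub) auto
    fix w' :: 'n assume "norm w' < r / 2"
    then have "dist z e + dist w' 0 < r" "dist z' e + dist w' 0 < r" using z by (auto simp: dist_commute)
    then have "(z, w') \<in> ball (e, 0) r" "(z', w') \<in> ball (e, 0) r" by - (rule Pair_mem_ball, assumption)+
    from r_lip[rule_format, OF this] show "norm (A z w' - A z' w') \<le> K * norm (z - z')"
      by (simp add: norm_Pair)
  qed (use r in simp)
  then have "norm (A z w - A z' w) \<le> (4 * K / r) * norm (z - z') * norm w"
    if "z \<in> ball e (r / 2)" "z' \<in> ball e (r / 2)" for z z' w
    using that by (simp add: field_simps)
  then show ?thesis using r sub by (intro exI[of _ "r / 2"] conjI exI[of _ "4 * K / r"]) auto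
qed

text \<open>
  The first-order Taylor estimate: the derivative of \<open>f\<close> is itself a smooth family of linear maps, hence
  locally Lipschitz in operator norm.
\<close>

lemma Cinf_local_taylor:
  fixes f :: "'k::real_normed_vector \<Rightarrow> 'm::real_normed_vector"
  assumes fd: "finite_dim TYPE('k)" and N: "open N" "e \<in> N" and f: "Cinf_on f N"
  shows "\<exists>r>0. \<exists>K\<ge>0. ball e r \<subseteq> N \<and> (\<forall>z\<in>ball e r. \<forall>z'\<in>ball e r.
    norm (f z' - f z - \<D> f z (z' - z)) \<le> K * (norm (z' - z))\<^sup>2)"
proof -
  from operator_family_lipschitz[OF fd fd N Cinf_on_derivative[OF f] Cinf_on_linear_derivative[OF f]]
  obtain r K where r: "r > 0" "K \<ge> 0" "ball e r \<subseteq> N"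
    "\<And>z z' w. z \<in> ball e r \<Longrightarrow> z' \<in> ball e r \<Longrightarrow>
      norm (\<D> f z w - \<D> f z' w) \<le> K * norm (z - z') * norm w"
    by blast
  have "norm (f z' - f z - \<D> f z (z' - z)) \<le> K * (norm (z' - z))\<^sup>2"
    if z: "z \<in> ball e r" "z' \<in> ball e r" for z z'
  proof -
    have "norm (f z' - f z - \<D> f z (z' - z)) \<le> norm (z' - z) * (K * norm (z' - z))"
    proof (rule differentiable_bound_linearization)
      show zt: "z + t *\<^sub>R (z' - z) \<in> closed_segment z z'" if "t \<in> {0..1}" for t
        using that by (auto simp: closed_segment_def algebra_simps intro!: exI[of _ t])
      have seg: "x \<in> ball e r" if "x \<in> closed_segment z z'" for x
        using closed_segment_subset[OF z convex_ball] that by blast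
      show "(f has_derivative \<D> f x) (at x within closed_segment z z')"
        if "x \<in> closed_segment z z'" for x
        using Cinf_on_has_derivative[OF f] seg[OF that] r(3) has_derivative_at_withinI by blast
      show "onorm (\<D> f x - \<D> f z) \<le> K * norm (z' - z)"
        if x: "x \<in> closed_segment z z'" for x
      proof (rule onorm_bound)
        fix w
        have "norm ((\<D> f x - \<D> f z) w)
            \<le> K * norm (x - z) * norm w" using r(4)[OF seg[OF x] z(1)] by simp
        also have "\<dots> \<le> K * norm (z' - z) * norm w"
          using segment_bound(1)[OF x] r(2) by (intro mult_right_mono mult_left_mono) (auto simp: norm_minus_commute)
        finally show "norm ((\<D> f x - \<D> f z) w)
          \<le> K * norm (z' - z) * norm w" .
      qed (use r in simp)
      show "z \<in> closed_segment z z'" by simp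
    qed
    then show ?thesis by (simp add: power2_eq_square algebra_simps)
  qed
  then show ?thesis using r by blast
qed

text \<open>
  The second-order estimate for a family of operators follows from the one for the joint map
  \<open>(z, w) \<mapsto> A z w\<close> near \<open>(e, 0)\<close>, since both sides are homogeneous in \<open>w\<close>.
\<close>

lemma operator_family_bounds:
  fixes A :: "'k::real_normed_vector \<Rightarrow> 'n::real_normed_vector \<Rightarrow> 'm::real_normed_vector"
  assumes fdk: "finite_dim TYPE('k)" and fdn: "finite_dim TYPE('n)" and N: "open N" "e \<in> N"
    and A: "\<And>w. Cinf_on (\<lambda>z. A z w) N" and lin: "\<And>z. z \<in> N \<Longrightarrow> linear (A z)"
  obtains r K where "r > 0" "K > 0" "ball e r \<subseteq> N"
    "\<And>z w. z \<in> ball e r \<Longrightarrow> norm (A z w) \<le> K * norm w"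
    "\<And>z z' w. z \<in> ball e r \<Longrightarrow> z' \<in> ball e r \<Longrightarrow> norm (A z w - A z' w) \<le> K * norm (z - z') * norm w"
    "\<And>z w \<zeta>. z \<in> ball e r \<Longrightarrow> norm (\<D> (\<lambda>z. A z w) z \<zeta>) \<le> K * norm \<zeta> * norm w"
    "\<And>z z' w. z \<in> ball e r \<Longrightarrow> z' \<in> ball e r \<Longrightarrow>
      norm (A z' w - A z w - \<D> (\<lambda>z. A z w) z (z' - z)) \<le> K * (norm (z' - z))\<^sup>2 * norm w"
proof -
  have fdp: "finite_dim TYPE('k \<times> 'n)" by (rule finite_dim_prod[OF fdk fdn])
  define F where "F s = A (fst s) (snd s)" for s
  have NU: "open (N \<times> (UNIV :: 'n set))" "(e, 0) \<in> N \<times> (UNIV :: 'n set)" using N by (auto simp: open_Times)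
  have F: "Cinf_on F (N \<times> UNIV)" unfolding F_def
    using N lin by (intro Cinf_on_apply[OF fdk fdn N(1) _ A] Cinf_on_fst Cinf_on_snd Cinf_on_ident NU) auto
  have DF: "\<D> F (z, w) (\<zeta>, 0) = \<D> (\<lambda>z. A z w) z \<zeta>"
    if "z \<in> N" for z w \<zeta>
  proof -
    have 1: "((\<lambda>z. (z, w)) has_derivative (\<lambda>\<zeta>. (\<zeta>, 0))) (at z)" by (auto intro!: derivative_eq_intros)
    have "((\<lambda>z. F (z, w)) has_derivative (\<lambda>\<zeta>. \<D> F (z, w) (\<zeta>, 0))) (at z)"
      using diff_chain_at[OF 1 Cinf_on_has_derivative[OF F]] that by (auto simp: o_def)
    from fun_cong[OF frechet_derivative_at[OF this], of \<zeta>] show ?thesis by (simp add: F_def)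
  qed
  have linD: "linear (\<lambda>w. \<D> (\<lambda>z. A z w) z \<zeta>)" if z: "z \<in> N" for z \<zeta>
  proof (rule linearI)
    note d = Cinf_on_has_derivative[OF A z]
    have add: "((\<lambda>z. A z (w + w')) has_derivative (\<lambda>\<zeta>. \<D> (\<lambda>z. A z w) z \<zeta>
        + \<D> (\<lambda>z. A z w') z \<zeta>)) (at z)" for w w'
      by (rule has_derivative_transform_within_open[OF has_derivative_add[OF d d] N(1) z])
        (use lin linear_add in metis)
    show "\<D> (\<lambda>z. A z (w + w')) z \<zeta> = \<D> (\<lambda>z. A z w) z \<zeta>
        + \<D> (\<lambda>z. A z w') z \<zeta>" for w w'
      by (rule fun_cong[OF frechet_derivative_at[OF add], symmetric])
    have scale: "((\<lambda>z. A z (c *\<^sub>R w)) has_derivative (\<lambda>\<zeta>. c *\<^sub>R \<D> (\<lambda>z. A z w) z \<zeta>)) (at z)" for c w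
      by (rule has_derivative_transform_within_open[OF has_derivative_scaleR_right[OF d] N(1) z])
        (use lin linear_scale in metis)
    show "\<D> (\<lambda>z. A z (c *\<^sub>R w)) z \<zeta>
        = c *\<^sub>R \<D> (\<lambda>z. A z w) z \<zeta>" for c w
      by (rule fun_cong[OF frechet_derivative_at[OF scale], symmetric])
  qed
  have "continuous_on (N \<times> UNIV) (\<lambda>(z, w). A z w)"
    using Cinf_on_continuous[OF F] by (simp add: F_def case_prod_unfold)
  from local_operator_bound[OF N this lin]
  obtain r1 K1 where 1: "r1 > 0" "K1 \<ge> 0" "ball e r1 \<subseteq> N"
    "\<And>z w. z \<in> ball e r1 \<Longrightarrow> norm (A z w) \<le> K1 * norm w" by blast
  from operator_family_lipschitz[OF fdk fdn N A lin]
  obtain r2 K2 where 2: "r2 > 0" "K2 \<ge> 0" "ball e r2 \<subseteq> N"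
    "\<And>z z' w. z \<in> ball e r2 \<Longrightarrow> z' \<in> ball e r2 \<Longrightarrow> norm (A z w - A z' w) \<le> K2 * norm (z - z') * norm w"
    by blast
  have "continuous_on ((N \<times> UNIV) \<times> UNIV) (\<lambda>s. \<D> F (fst s) (snd s))"
    using N(1) by (intro Cinf_on_continuous Cinf_on_frechet_apply[OF fdp NU(1) _ F] Cinf_on_fst Cinf_on_snd
      Cinf_on_ident open_Times) auto
  then have "continuous_on ((N \<times> UNIV) \<times> UNIV) (\<lambda>(s, \<zeta>). \<D> F s \<zeta>)"
    by (simp add: case_prod_unfold)
  then have "\<exists>r>0. \<exists>K\<ge>0. ball (e, 0::'n) r \<subseteq> N \<times> UNIV \<and>
      (\<forall>s\<in>ball (e, 0) r. \<forall>\<zeta>. norm (\<D> F s \<zeta>) \<le> K * norm \<zeta>)"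
    by (rule local_operator_bound[OF NU]) (rule Cinf_on_linear_derivative[OF F])
  then obtain r3 K3 where 3: "r3 > 0" "K3 \<ge> 0"
    "\<forall>s\<in>ball (e, 0) r3. \<forall>\<zeta>. norm (\<D> F s \<zeta>) \<le> K3 * norm \<zeta>"
    by (elim exE conjE) (rule that)
  from Cinf_local_taylor[OF fdp NU F]
  obtain r4 K4 where 4: "r4 > 0" "K4 \<ge> 0"
    "\<forall>z\<in>ball (e, 0) r4. \<forall>z'\<in>ball (e, 0) r4.
      norm (F z' - F z - \<D> F z (z' - z)) \<le> K4 * (norm (z' - z))\<^sup>2"
    by (elim exE conjE) (rule that)
  define r where "r = min (min r1 r2) (min (r3 / 2) (r4 / 2))"
  define K where "K = K1 + K2 + 4 * K3 / r3 + 4 * K4 / r4 + 1"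
  have r: "r > 0" "r \<le> r1" "r \<le> r2" "r \<le> r3 / 2" "r \<le> r4 / 2"
    using 1 2 3 4 by (auto simp: r_def)
  have p: "4 * K3 / r3 \<ge> 0" "4 * K4 / r4 \<ge> 0" using 3 4 by auto
  have K: "K > 0" "K1 \<le> K" "K2 \<le> K" "4 * K3 / r3 \<le> K" "4 * K4 / r4 \<le> K"
    using 1(2) 2(2) p unfolding K_def by linarith+
  have sub: "z \<in> ball e r \<Longrightarrow> z \<in> ball e r1 \<and> z \<in> ball e r2 \<and> z \<in> N" for z
    using r 1(3) by auto
  show thesis
  proof (rule that[OF r(1) K(1)])
    show "ball e r \<subseteq> N" using sub by blast
    show "norm (A z w) \<le> K * norm w" if "z \<in> ball e r" for z w
      using 1(4)[of z w] sub[OF that] mult_right_mono[OF K(2) norm_ge_zero[of w]] by linarith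
    show "norm (A z w - A z' w) \<le> K * norm (z - z') * norm w" if "z \<in> ball e r" "z' \<in> ball e r" for z z' w
    proof -
      have "norm (A z w - A z' w) \<le> K2 * norm (z - z') * norm w" using 2(4) sub that by blast
      also have "\<dots> \<le> K * norm (z - z') * norm w" using K(3) by (intro mult_right_mono) auto
      finally show ?thesis .
    qed
    show "norm (\<D> (\<lambda>z. A z w) z \<zeta>) \<le> K * norm \<zeta> * norm w" if z: "z \<in> ball e r" for z w \<zeta>
    proof -
      have "norm (\<D> (\<lambda>z. A z w) z \<zeta>) \<le> (2 * (K3 * norm \<zeta>) / (r3 / 2)) * norm w"
      proof (rule linear_bound_from_ball[where f = "\<lambda>w. \<D> (\<lambda>z. A z w) z \<zeta>"])
        fix w' :: 'n assume "norm w' < r3 / 2"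
        then have "(z, w') \<in> ball (e, 0) r3" using z r(4) by (intro Pair_mem_ball) (auto simp: dist_commute)
        from 3(3)[rule_format, OF this, of "(\<zeta>, 0)"] show "norm (\<D> (\<lambda>z. A z w') z \<zeta>) \<le> K3 * norm \<zeta>"
          using DF sub z by (simp add: norm_Pair)
      qed (use linD sub z 3 in auto)
      also have "\<dots> = (4 * K3 / r3) * norm \<zeta> * norm w" by simp
      also have "\<dots> \<le> K * norm \<zeta> * norm w" using K(4) by (intro mult_right_mono) auto
      finally show ?thesis .
    qed
    show "norm (A z' w - A z w - \<D> (\<lambda>z. A z w) z (z' - z)) \<le> K * (norm (z' - z))\<^sup>2 * norm w"
      if z: "z \<in> ball e r" "z' \<in> ball e r" for z z' w
    proof -
      have "norm (A z' w - A z w - \<D> (\<lambda>z. A z w) z (z' - z))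
          \<le> (2 * (K4 * (norm (z' - z))\<^sup>2) / (r4 / 2)) * norm w"
      proof (rule linear_bound_from_ball[where
          f = "\<lambda>w. A z' w - A z w - \<D> (\<lambda>z. A z w) z (z' - z)"])
        show "linear (\<lambda>w. A z' w - A z w - \<D> (\<lambda>z. A z w) z (z' - z))"
          using z sub lin linD by (intro linear_compose_sub) auto
        fix w' :: 'n assume "norm w' < r4 / 2"
        then have "dist z e + dist w' 0 < r4" "dist z' e + dist w' 0 < r4"
          using z r(5) by (auto simp: dist_commute)
        then have "(z, w') \<in> ball (e, 0) r4" "(z', w') \<in> ball (e, 0) r4" by - (rule Pair_mem_ball, assumption)+
        from 4(3)[rule_format, OF this]
        show "norm (A z' w' - A z w' - \<D> (\<lambda>z. A z w') z (z' - z)) \<le> K4 * (norm (z' - z))\<^sup>2"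
          using DF sub z by (simp add: norm_Pair F_def)
      qed (use 4 in auto)
      also have "\<dots> = (4 * K4 / r4) * (norm (z' - z))\<^sup>2 * norm w" by simp
      also have "\<dots> \<le> K * (norm (z' - z))\<^sup>2 * norm w" using K(5) by (intro mult_right_mono) auto
      finally show ?thesis .
    qed
  qed
qed


section \<open>Ordinary differential equations\<close>

text \<open>
  A Gronwall estimate for a growth rate at most \<open>1 / 2\<close>, by comparing \<open>\<delta>\<close> with the maximum of its norm.
  Small rates can always be arranged below, as all curves run inside small balls.
\<close>

lemma small_gronwall:
  fixes \<delta> :: "real \<Rightarrow> 'v::real_normed_vector"
  assumes D: "\<And>t. t \<in> {0..1} \<Longrightarrow> (\<delta> has_vector_derivative \<delta>' t) (at t within {0..1})"
    and le: "\<And>t. t \<in> {0..1} \<Longrightarrow> norm (\<delta>' t) \<le> norm (\<delta> t) / 2 + \<epsilon>"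
    and 0: "\<delta> 0 = 0" and t: "t \<in> {0..1}"
  shows "norm (\<delta> t) \<le> 2 * \<epsilon>"
proof -
  have "continuous_on {0..1} \<delta>"
    unfolding continuous_on_eq_continuous_within using has_vector_derivative_continuous[OF D] by blast
  then have "continuous_on {0..1} (\<lambda>t. norm (\<delta> t))" by (intro continuous_intros)
  then obtain s where s: "s \<in> {0..1}" "\<And>t. t \<in> {0..1} \<Longrightarrow> norm (\<delta> t) \<le> norm (\<delta> s)"
    using continuous_attains_sup[of "{0..1::real}" "\<lambda>t. norm (\<delta> t)"] by auto
  define M where "M = norm (\<delta> s) / 2 + \<epsilon>"
  have M: "norm (\<delta>' t) \<le> M" if "t \<in> {0..1}" for t
    using le[OF that] s(2)[OF that] by (simp add: M_def)
  have M0: "M \<ge> 0" using M[OF s(1)] norm_ge_zero order_trans by blast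
  have "norm (\<delta> s - \<delta> 0) \<le> M * norm (s - 0)"
  proof (rule differentiable_bound[of "{0..1}"])
    show "(\<delta> has_derivative (\<lambda>h. h *\<^sub>R \<delta>' x)) (at x within {0..1})" if "x \<in> {0..1}" for x
      using D[OF that] by (simp add: has_vector_derivative_def)
    show "onorm (\<lambda>h. h *\<^sub>R \<delta>' x) \<le> M" if "x \<in> {0..1}" for x
      using M[OF that] M0 by (intro onorm_bound) (auto simp: mult.commute[of M] intro: mult_left_mono)
  qed (use s in auto)
  also have "\<dots> \<le> M" using s(1) M0 by (auto intro: mult_left_le)
  finally have "norm (\<delta> s) \<le> M" using 0 by simp
  then show ?thesis using s(2)[OF t] by (simp add: M_def)
qed

text \<open>
  The integral operator is a contraction on bounded continuous functions. These are functions on the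
  whole line; \<open>cl\<close> clamps the time to the unit interval, so that a curve on \<open>[0, 1]\<close> becomes such a
  function.
\<close>

lemma picard_banach:
  fixes f :: "real \<Rightarrow> 'e::banach \<Rightarrow> 'e"
  assumes cont: "continuous_on ({0..1} \<times> cball p R) (\<lambda>(t, y). f t y)"
    and bound: "\<And>t y. t \<in> {0..1} \<Longrightarrow> y \<in> cball p R \<Longrightarrow> norm (f t y) \<le> R"
    and lip: "\<And>t y y'. t \<in> {0..1} \<Longrightarrow> y \<in> cball p R \<Longrightarrow> y' \<in> cball p R \<Longrightarrow>
      norm (f t y - f t y') \<le> norm (y - y') / 2"
    and R: "R \<ge> 0"
  shows "\<exists>y. y 0 = p \<and> (\<forall>t\<in>{0..1}. y t \<in> cball p R \<and>
    (y has_vector_derivative f t (y t)) (at t within {0..1}))"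
proof -
  define X :: "(real \<Rightarrow>\<^sub>C 'e) set" where "X = PiC UNIV (\<lambda>_. cball p R)"
  define cl :: "real \<Rightarrow> real" where "cl t = max 0 (min 1 t)" for t
  have cl: "cl t \<in> {0..1}" "t \<in> {0..1} \<Longrightarrow> cl t = t" for t by (auto simp: cl_def)
  have ccl: "continuous_on UNIV cl" unfolding cl_def by (intro continuous_intros)
  have inX: "apply_bcontfun y t \<in> cball p R" if "y \<in> X" for y t
    using that by (auto simp: X_def mem_PiC_iff)
  have contf: "continuous_on {0..1} (\<lambda>s. f s (apply_bcontfun y s))" if "y \<in> X" for y
  proof -
    have "continuous_on {0..1} (\<lambda>s. (\<lambda>(t, y). f t y) (s, apply_bcontfun y s))"
      using inX[OF that] by (intro continuous_on_compose2[OF cont] continuous_intros) auto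
    then show ?thesis by simp
  qed
  have contf': "continuous_on {0..u} (\<lambda>s. f s (apply_bcontfun y s))" if "y \<in> X" "u \<in> {0..1}" for y u
    using continuous_on_subset[OF contf[OF that(1)]] that by auto
  define T0 where "T0 y t = p + integral {0..cl t} (\<lambda>s. f s (apply_bcontfun y s))" for y t
  have T0in: "T0 y t \<in> cball p R" if y: "y \<in> X" for y t
  proof -
    have "norm (integral {0..cl t} (\<lambda>s. f s (apply_bcontfun y s))) \<le> R * (cl t - 0)"
      using cl(1)[of t] inX[OF y] by (intro integral_bound contf'[OF y] bound) auto
    also have "\<dots> \<le> R" using cl(1)[of t] R by (auto intro: mult_left_le)
    finally show ?thesis by (simp add: T0_def dist_norm)
  qed
  have T0b: "T0 y \<in> bcontfun" if y: "y \<in> X" for y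
  proof (rule bcontfun_normI)
    have C: "continuous_on {0..1} (\<lambda>u. integral {0..u} (\<lambda>s. f s (apply_bcontfun y s)))"
      by (intro indefinite_integral_continuous_1 integrable_continuous_real contf[OF y])
    show "continuous_on UNIV (T0 y)" unfolding T0_def
      by (intro continuous_on_add continuous_on_const continuous_on_compose2[OF C ccl]) (use cl(1) in blast)
    show "norm (T0 y t) \<le> norm p + R" for t
      using T0in[OF y, of t] norm_triangle_sub[of "T0 y t" p] by (simp add: dist_norm norm_minus_commute)
  qed
  define T where "T y = Bcontfun (T0 y)" for y
  have T: "apply_bcontfun (T y) = T0 y" if "y \<in> X" for y
    unfolding T_def by (rule Bcontfun_inverse[OF T0b[OF that]])
  have "\<exists>!y. y \<in> X \<and> T y = y"
  proof (rule Banach_fix[of _ "1/2"])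
    show "complete X" unfolding X_def by (intro closed_PiC[THEN complete_eq_closed[THEN iffD2]]) auto
    have "const_bcontfun p \<in> X" using R by (auto simp: X_def mem_PiC_iff const_bcontfun.rep_eq)
    then show "X \<noteq> {}" by blast
    show "T ` X \<subseteq> X" using T T0in by (auto simp: X_def mem_PiC_iff)
    show "dist (T y) (T y') \<le> 1 / 2 * dist y y'" if y: "y \<in> X" "y' \<in> X" for y y'
    proof (rule dist_bound)
      fix t
      have "T0 y t - T0 y' t = integral {0..cl t} (\<lambda>s. f s (apply_bcontfun y s) - f s (apply_bcontfun y' s))"
        unfolding T0_def using cl(1) y
        by (subst Henstock_Kurzweil_Integration.integral_diff) (auto intro!: integrable_continuous_real contf')
      also have "norm \<dots> \<le> (dist y y' / 2) * (cl t - 0)"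
      proof (rule integral_bound)
        show "continuous_on {0..cl t} (\<lambda>s. f s (apply_bcontfun y s) - f s (apply_bcontfun y' s))"
          using cl(1) y by (intro continuous_intros contf') auto
        fix s assume "s \<in> {0..cl t}"
        then have "norm (f s (apply_bcontfun y s) - f s (apply_bcontfun y' s))
            \<le> norm (apply_bcontfun y s - apply_bcontfun y' s) / 2"
          using cl(1)[of t] inX y by (intro lip) auto
        also have "\<dots> \<le> dist y y' / 2" using dist_bounded[of y s y'] by (simp add: dist_norm)
        finally show "norm (f s (apply_bcontfun y s) - f s (apply_bcontfun y' s)) \<le> dist y y' / 2" .
      qed (use cl in auto)
      also have "\<dots> \<le> dist y y' / 2" using cl(1)[of t] by (intro mult_left_le) auto
      finally show "dist (apply_bcontfun (T y) t) (apply_bcontfun (T y') t) \<le> 1 / 2 * dist y y'"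
        using T y by (simp add: dist_norm)
    qed
  qed auto
  then obtain y where y: "y \<in> X" "T y = y" by blast
  have yT: "apply_bcontfun y t = T0 y t" for t using T[OF y(1)] y(2) by simp
  show ?thesis
  proof (intro exI[of _ "T0 y"] conjI ballI)
    show "T0 y 0 = p" by (simp add: T0_def cl_def)
    fix t :: real assume t: "t \<in> {0..1}"
    show "T0 y t \<in> cball p R" by (rule T0in[OF y(1)])
    have "((\<lambda>u. p + integral {0..u} (\<lambda>s. f s (apply_bcontfun y s))) has_vector_derivative
        0 + f t (apply_bcontfun y t)) (at t within {0..1})"
      by (intro has_vector_derivative_add has_vector_derivative_const integral_has_vector_derivative contf y t)
    then have *: "((\<lambda>u. p + integral {0..u} (\<lambda>s. f s (apply_bcontfun y s))) has_vector_derivative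
        f t (T0 y t)) (at t within {0..1})" by (simp add: yT)
    show "(T0 y has_vector_derivative f t (T0 y t)) (at t within {0..1})"
      by (rule has_vector_derivative_transform[OF t _ *]) (use cl(2) in \<open>auto simp: T0_def\<close>)
  qed
qed

text \<open>
  Existence of solutions of a differential equation on the unit interval for a small right-hand
  side. The smallness constant depends on the space only: it absorbs the norms of the two maps of
  the retraction from the bidual, in which the equation is solved.
\<close>

lemma picard_finite_dim:
  assumes fd: "finite_dim TYPE('m::real_normed_vector)"
  obtains c where "c > 0"
    "\<And>(f :: real \<Rightarrow> 'm::real_normed_vector \<Rightarrow> 'm) p R. \<lbrakk>R > 0; continuous_on ({0..1} \<times> cball p R) (\<lambda>(t, y). f t y);
      \<And>t y. t \<in> {0..1} \<Longrightarrow> y \<in> cball p R \<Longrightarrow> norm (f t y) \<le> c * R;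
      \<And>t y y'. t \<in> {0..1} \<Longrightarrow> y \<in> cball p R \<Longrightarrow> y' \<in> cball p R \<Longrightarrow>
        norm (f t y - f t y') \<le> c * norm (y - y')\<rbrakk> \<Longrightarrow>
      \<exists>y. y 0 = p \<and> (\<forall>t\<in>{0..1}. y t \<in> cball p R \<and>
        (y has_vector_derivative f t (y t)) (at t within {0..1}))"
proof -
  obtain j :: "'m \<Rightarrow> (('m \<Rightarrow>\<^sub>L real) \<Rightarrow>\<^sub>L real)" and r
    where j: "bounded_linear j" and r: "bounded_linear r" and rj: "\<And>x. r (j x) = x"
    using finite_dim_bidual_retraction[OF fd] by metis
  obtain Kj where Kj: "Kj > 0" "\<And>x. norm (j x) \<le> norm x * Kj"
    using bounded_linear.pos_bounded[OF j] by blast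
  obtain Kr where Kr: "Kr > 0" "\<And>x. norm (r x) \<le> norm x * Kr"
    using bounded_linear.pos_bounded[OF r] by blast
  define c where "c = 1 / (2 * Kj * Kr)"
  have c: "c > 0" using Kj Kr by (simp add: c_def)
  have "\<exists>y. y 0 = p \<and> (\<forall>t\<in>{0..1}. y t \<in> cball p R \<and>
        (y has_vector_derivative f t (y t)) (at t within {0..1}))"
    if R: "R > 0" and cont: "continuous_on ({0..1} \<times> cball p R) (\<lambda>(t, y). f t y)"
      and bound: "\<And>t y. t \<in> {0..1} \<Longrightarrow> y \<in> cball p R \<Longrightarrow> norm (f t y) \<le> c * R"
      and lip: "\<And>t y y'. t \<in> {0..1} \<Longrightarrow> y \<in> cball p R \<Longrightarrow> y' \<in> cball p R \<Longrightarrow>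
        norm (f t y - f t y') \<le> c * norm (y - y')"
    for f :: "real \<Rightarrow> 'm \<Rightarrow> 'm" and p R
  proof -
    have rin: "r x \<in> cball p R" if "x \<in> cball (j p) (R / Kr)" for x
    proof -
      have "norm (r (j p - x)) \<le> norm (j p - x) * Kr" by (rule Kr)
      also have "\<dots> \<le> R / Kr * Kr" using that Kr(1) by (intro mult_right_mono) (auto simp: dist_norm)
      finally show ?thesis using Kr(1) by (simp add: dist_norm linear_diff[OF bounded_linear.linear[OF r]] rj)
    qed
    have "\<exists>y. y 0 = j p \<and> (\<forall>t\<in>{0..1}. y t \<in> cball (j p) (R / Kr) \<and>
      (y has_vector_derivative j (f t (r (y t)))) (at t within {0..1}))"
    proof (rule picard_banach)
      have "continuous_on ({0..1} \<times> cball (j p) (R / Kr)) (\<lambda>s. j ((\<lambda>(t, y). f t y) (fst s, r (snd s))))"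
        using rin by (intro bounded_linear.continuous_on[OF j] continuous_on_compose2[OF cont]
          continuous_intros bounded_linear.continuous_on[OF r]) auto
      then show "continuous_on ({0..1} \<times> cball (j p) (R / Kr)) (\<lambda>(t, y). j (f t (r y)))"
        by (simp add: case_prod_unfold)
    next
      fix t x assume "t \<in> {0..1::real}" and x: "x \<in> cball (j p) (R / Kr)"
      then have "norm (f t (r x)) \<le> c * R" using bound rin by blast
      then have "norm (j (f t (r x))) \<le> c * R * Kj"
        using Kj mult_right_mono[of "norm (f t (r x))" "c * R" Kj] by (smt (verit))
      also have "\<dots> \<le> R / Kr" using Kj Kr R by (simp add: c_def field_simps)
      finally show "norm (j (f t (r x))) \<le> R / Kr" .
    next
      fix t x x' assume t: "t \<in> {0..1::real}" and x: "x \<in> cball (j p) (R / Kr)" "x' \<in> cball (j p) (R / Kr)"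
      have "norm (j (f t (r x)) - j (f t (r x'))) \<le> norm (f t (r x) - f t (r x')) * Kj"
        using Kj(2)[of "f t (r x) - f t (r x')"] by (simp add: linear_diff[OF bounded_linear.linear[OF j]])
      also have "\<dots> \<le> (c * norm (r x - r x')) * Kj"
        using lip[OF t rin[OF x(1)] rin[OF x(2)]] Kj(1) by (intro mult_right_mono) auto
      also have "\<dots> \<le> (c * (norm (x - x') * Kr)) * Kj"
        using Kr(2)[of "x - x'"] Kj(1) c
        by (intro mult_right_mono mult_left_mono) (auto simp: linear_diff[OF bounded_linear.linear[OF r]])
      also have "\<dots> = norm (x - x') / 2" using Kj Kr by (simp add: c_def field_simps)
      finally show "norm (j (f t (r x)) - j (f t (r x'))) \<le> norm (x - x') / 2" .
    qed (use R Kr in auto)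
    then obtain y where y: "y 0 = j p" "\<And>t. t \<in> {0..1} \<Longrightarrow> y t \<in> cball (j p) (R / Kr)"
      "\<And>t. t \<in> {0..1} \<Longrightarrow> (y has_vector_derivative j (f t (r (y t)))) (at t within {0..1})" by blast
    show ?thesis
    proof (intro exI[of _ "\<lambda>t. r (y t)"] conjI ballI)
      show "r (y 0) = p" by (simp add: y rj)
      fix t :: real assume t: "t \<in> {0..1}"
      show "r (y t) \<in> cball p R" using rin y t by blast
      show "((\<lambda>t. r (y t)) has_vector_derivative f t (r (y t))) (at t within {0..1})"
        using bounded_linear.has_vector_derivative[OF r y(3)[OF t]] by (simp add: rj)
    qed
  qed
  then show thesis using that[OF c] by blast
qed

section \<open>Total differential equations\<close>

text \<open>
  The local form of the Frobenius theorem used here. The equation \<open>\<D> Y a = A (a, Y a)\<close> is solved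
  along every ray from the base point; \<open>Y\<close> is the value at time \<open>1\<close>. For two neighbouring rays
  in directions \<open>h\<close> and \<open>h + w\<close> the quantity \<open>\<delta> t = y\<^bsub>h+w\<^esub> t - y\<^bsub>h\<^esub> t - A (z t) (t w)\<close>
  satisfies \<open>norm (\<delta>' t) \<le> norm (\<delta> t) / 2 + O(norm w ^ 2)\<close>, the first-order terms cancelling exactly
  by the integrability condition, so that it is \<open>O(norm w ^ 2)\<close>; at time \<open>1\<close> this says that
  \<open>A (a, Y a)\<close> is the derivative of \<open>Y\<close>.
\<close>

theorem total_equation_solution:
  fixes A :: "'n::real_normed_vector \<times> 'm::real_normed_vector \<Rightarrow> 'n \<Rightarrow> 'm"
  assumes fdn: "finite_dim TYPE('n)" and fdm: "finite_dim TYPE('m)"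
    and N: "open N" "(q, p) \<in> N"
    and A: "\<And>w. Cinf_on (\<lambda>z. A z w) N" and lin: "\<And>z. z \<in> N \<Longrightarrow> linear (A z)"
    and int: "\<And>z v w. z \<in> N \<Longrightarrow> \<D> (\<lambda>z. A z w) z (v, A z v)
      = \<D> (\<lambda>z. A z v) z (w, A z w)"
  shows "\<exists>r>0. \<exists>Y. Y q = p \<and> (\<forall>a\<in>ball q r. (a, Y a) \<in> N \<and> (Y has_derivative A (a, Y a)) (at a))"
proof -
  obtain r0 K where r0: "r0 > 0" and K: "K > 0" and sub: "ball (q, p) r0 \<subseteq> N"
    and b1: "\<And>z w. z \<in> ball (q, p) r0 \<Longrightarrow> norm (A z w) \<le> K * norm w"
    and b2: "\<And>z z' w. z \<in> ball (q, p) r0 \<Longrightarrow> z' \<in> ball (q, p) r0 \<Longrightarrow>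
      norm (A z w - A z' w) \<le> K * norm (z - z') * norm w"
    and b3: "\<And>z w \<zeta>. z \<in> ball (q, p) r0 \<Longrightarrow>
      norm (\<D> (\<lambda>z. A z w) z \<zeta>) \<le> K * norm \<zeta> * norm w"
    and b4: "\<And>z z' w. z \<in> ball (q, p) r0 \<Longrightarrow> z' \<in> ball (q, p) r0 \<Longrightarrow>
      norm (A z' w - A z w - \<D> (\<lambda>z. A z w) z (z' - z)) \<le> K * (norm (z' - z))\<^sup>2 * norm w"
  proof (rule operator_family_bounds[OF finite_dim_prod[OF fdn fdm] fdn N A lin], goal_cases)
    case (2 r K)
    show ?case by (rule 2(1)) (rule 2(2-); assumption)+
  qed
  obtain c where c: "c > 0" and picard:
    "\<And>(f :: real \<Rightarrow> 'm \<Rightarrow> 'm) p R. \<lbrakk>R > 0; continuous_on ({0..1} \<times> cball p R) (\<lambda>(t, y). f t y);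
      \<And>t y. t \<in> {0..1} \<Longrightarrow> y \<in> cball p R \<Longrightarrow> norm (f t y) \<le> c * R;
      \<And>t y y'. t \<in> {0..1} \<Longrightarrow> y \<in> cball p R \<Longrightarrow> y' \<in> cball p R \<Longrightarrow>
        norm (f t y - f t y') \<le> c * norm (y - y')\<rbrakk> \<Longrightarrow>
      \<exists>y. y 0 = p \<and> (\<forall>t\<in>{0..1}. y t \<in> cball p R \<and>
        (y has_vector_derivative f t (y t)) (at t within {0..1}))"
    using picard_finite_dim[OF fdm] by metis
  define R where "R = r0 / 2"
  have R: "R > 0" using r0 by (simp add: R_def)
  \<comment> \<open>The first two bounds by \<open>c\<close> are the hypotheses of the existence theorem for one ray, the last one
    is the growth rate \<open>1 / 2\<close> in the Gronwall estimate.\<close>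
  define r where "r = min R (min (c * R / K) (min (c / K) (1 / (2 * K))))"
  have r: "r > 0" "r \<le> R" "K * r \<le> c * R" "K * r \<le> c" "K * r \<le> 1 / 2"
  proof -
    show "r > 0" using R c K by (simp add: r_def)
    have "r \<le> c * R / K" "r \<le> c / K" "r \<le> 1 / (2 * K)" "r \<le> R" by (auto simp: r_def)
    then show "r \<le> R" "K * r \<le> c * R" "K * r \<le> c" "K * r \<le> 1 / 2" using K by (auto simp: field_simps)
  qed
  have zin: "(q + t *\<^sub>R h, y) \<in> ball (q, p) r0" if "t \<in> {0..1}" "norm h < r" "y \<in> cball p R" for t h y
  proof (rule Pair_mem_ball)
    have "\<bar>t\<bar> * norm h \<le> norm h" using that(1) by (intro mult_left_le_one_le) auto
    then have "dist (q + t *\<^sub>R h) q < R" using that r by (simp add: dist_norm)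
    moreover have "dist y p \<le> R" using that by (simp add: dist_commute)
    ultimately show "dist (q + t *\<^sub>R h) q + dist y p < r0" by (simp add: R_def)
  qed
  have ray: "\<exists>y. y 0 = p \<and> (\<forall>t\<in>{0..1}. y t \<in> cball p R \<and>
        (y has_vector_derivative A (q + t *\<^sub>R h, y t) h) (at t within {0..1}))" if h: "norm h < r" for h
  proof (rule picard[OF R])
    have Kh: "K * norm h \<le> K * r" using h K by simp
    have "continuous_on ({0..1} \<times> cball p R) (\<lambda>s. A (q + fst s *\<^sub>R h, snd s) h)"
      using zin[OF _ h] sub
      by (intro continuous_on_compose2[OF Cinf_on_continuous[OF A[of h]]] continuous_intros) auto
    then show "continuous_on ({0..1} \<times> cball p R) (\<lambda>(t, y). A (q + t *\<^sub>R h, y) h)"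
      by (simp add: case_prod_unfold)
    show "norm (A (q + t *\<^sub>R h, y) h) \<le> c * R" if "t \<in> {0..1}" "y \<in> cball p R" for t y
      using b1[OF zin[OF that(1) h that(2)], of h] Kh r(3) by linarith
    fix t y y' assume t: "t \<in> {0..1::real}" and y: "y \<in> cball p R" "y' \<in> cball p R"
    have "norm (A (q + t *\<^sub>R h, y) h - A (q + t *\<^sub>R h, y') h) \<le> K * norm (y - y') * norm h"
      using b2[OF zin[OF t h y(1)] zin[OF t h y(2)], of h] by (simp add: norm_Pair)
    also have "\<dots> = (K * norm h) * norm (y - y')" by simp
    also have "\<dots> \<le> c * norm (y - y')" using Kh r(4) by (intro mult_right_mono) auto
    finally show "norm (A (q + t *\<^sub>R h, y) h - A (q + t *\<^sub>R h, y') h) \<le> c * norm (y - y')" .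
  qed
  define y where "y h = (SOME y. y 0 = p \<and> (\<forall>t\<in>{0..1}. y t \<in> cball p R \<and>
        (y has_vector_derivative A (q + t *\<^sub>R h, y t) h) (at t within {0..1})))" for h
  have y: "y h 0 = p" "t \<in> {0..1} \<Longrightarrow> y h t \<in> cball p R"
    "t \<in> {0..1} \<Longrightarrow> (y h has_vector_derivative A (q + t *\<^sub>R h, y h t) h) (at t within {0..1})"
    if "norm h < r" for h t
    using someI_ex[OF ray[OF that]] unfolding y_def[of h, symmetric] by blast+
  define Y where "Y a = y (a - q) 1" for a
  define z where "z h t = (q + t *\<^sub>R h, y h t)" for h t
  have z: "z h t \<in> ball (q, p) r0" "z h t \<in> N" if "norm h < r" "t \<in> {0..1}" for h t
    using zin[OF that(2,1) y(2)[OF that]] sub unfolding z_def by blast+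
  have yd: "(y h has_vector_derivative A (z h t) h) (at t within {0..1})" if "norm h < r" "t \<in> {0..1}" for h t
    using y(3)[OF that] by (simp add: z_def)
  have Yq: "Y q = p"
  proof -
    have 0: "norm (0::'n) < r" using r by simp
    have "norm (y 0 1 - p) \<le> 2 * 0"
    proof (rule small_gronwall)
      fix t :: real assume t: "t \<in> {0..1}"
      have "A (z 0 t) 0 = 0" using lin[OF z(2)[OF 0 t]] by (rule linear_0)
      then show "((\<lambda>t. y 0 t - p) has_vector_derivative 0) (at t within {0..1})"
        using has_vector_derivative_diff[OF yd[OF 0 t] has_vector_derivative_const[of p]] by simp
    qed (use y(1)[OF 0] in auto)
    then show ?thesis by (simp add: Y_def)
  qed
  \<comment> \<open>Bounds, relative to \<open>norm w\<close> and its square, for the distance of the two solutions in the state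
    space, for their distance including the position on the ray, and for \<open>\<delta>\<close>.\<close>
  define C1 where "C1 = 2 * (K * (2 + r))"
  define C2 where "C2 = 1 + C1"
  define C3 where "C3 = 2 * (K * C2\<^sup>2 * r + K * C2)"
  have C: "C1 \<ge> 0" "C2 \<ge> 0" "C3 \<ge> 0" using K r(1) by (auto simp: C1_def C2_def C3_def)
  have key: "norm (y (h + w) 1 - y h 1 - A (z h 1) w) \<le> C3 * (norm w)\<^sup>2"
    if h: "norm h < r" and hw: "norm (h + w) < r" for h w
  proof -
    define D where "D t = y (h + w) t - y h t" for t
    have zz: "z (h + w) t - z h t = (t *\<^sub>R w, D t)" for t
      by (simp add: z_def D_def algebra_simps)
    have Kr: "K * norm h \<le> K * r" using h K by simp
    have Kh: "K * norm h \<le> 1 / 2" "K * norm h \<le> K * r" using Kr r(5) by linarith+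
    have Dd: "(D has_vector_derivative (A (z (h + w) t) (h + w) - A (z h t) h)) (at t within {0..1})"
      if "t \<in> {0..1}" for t
      unfolding D_def using yd[OF hw that] yd[OF h that] by (rule has_vector_derivative_diff)
    have tw: "norm (t *\<^sub>R w) \<le> norm w" if "t \<in> {0..1}" for t
      using that by (auto intro: mult_left_le_one_le)
    have zn: "norm (z (h + w) t - z h t) \<le> norm w + norm (D t)" if "t \<in> {0..1}" for t
      using norm_Pair_le[of "t *\<^sub>R w" "D t"] tw[OF that] unfolding zz by linarith
    have expand: "A (z (h + w) t) (h + w) = A (z (h + w) t) h + A (z (h + w) t) w" if "t \<in> {0..1}" for t
      using lin[OF z(2)[OF hw that]] by (rule linear_add)
    have D1: "norm (D t) \<le> 2 * (K * (2 + r) * norm w)" if "t \<in> {0..1}" for t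
    proof (rule small_gronwall[OF Dd _ _ that])
      fix t :: real assume t: "t \<in> {0..1}"
      have "norm (A (z (h + w) t) (h + w) - A (z h t) h)
          \<le> norm (A (z (h + w) t) h - A (z h t) h) + norm (A (z (h + w) t) w)"
        unfolding expand[OF t] by (metis add_diff_eq add.commute norm_triangle_ineq)
      also have "\<dots> \<le> K * norm (z (h + w) t - z h t) * norm h + K * norm w"
        by (intro add_mono b1 b2 z h hw t)
      also have "\<dots> \<le> K * (norm w + norm (D t)) * norm h + K * norm w"
        using zn[OF t] K by (intro add_right_mono mult_right_mono mult_left_mono) auto
      also have "\<dots> = (K * norm h) * norm w + (K * norm h) * norm (D t) + K * norm w"
        by (simp add: algebra_simps)
      also have "\<dots> \<le> (K * r) * norm w + 1 / 2 * norm (D t) + K * norm w"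
        using Kh by (intro add_mono mult_right_mono) auto
      also have "\<dots> \<le> norm (D t) / 2 + K * (2 + r) * norm w"
        using K by (simp add: algebra_simps)
      finally show "norm (A (z (h + w) t) (h + w) - A (z h t) h) \<le> norm (D t) / 2 + K * (2 + r) * norm w" .
    qed (auto simp: D_def y(1)[OF h] y(1)[OF hw])
    then have D1': "norm (D t) \<le> C1 * norm w" if "t \<in> {0..1}" for t
      using that by (simp add: C1_def algebra_simps)
    have zn2: "norm (z (h + w) t - z h t) \<le> C2 * norm w" if "t \<in> {0..1}" for t
      using zn[OF that] D1'[OF that] by (simp add: C2_def algebra_simps)
    define \<delta> where "\<delta> t = D t - t *\<^sub>R A (z h t) w" for t
    define A1 where "A1 v t = \<D> (\<lambda>z. A z v) (z h t)" for v t
    have linA1: "linear (A1 v t)" if "t \<in> {0..1}" for v t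
      unfolding A1_def using Cinf_on_linear_derivative[OF A z(2)[OF h that]] .
    define \<delta>' where "\<delta>' t = A (z (h + w) t) (h + w) - A (z h t) h
        - (t *\<^sub>R A1 w t (h, A (z h t) h) + A (z h t) w)" for t
    have "norm (\<delta> 1) \<le> 2 * ((K * C2\<^sup>2 * r + K * C2) * (norm w)\<^sup>2)"
    proof (rule small_gronwall)
      fix t :: real assume t: "t \<in> {0..1}"
      have zd: "(z h has_vector_derivative (h, A (z h t) h)) (at t within {0..1})"
        using yd[OF h t] unfolding z_def has_vector_derivative_def
        by (auto intro!: derivative_eq_intros)
      have "((\<lambda>t. A (z h t) w) has_vector_derivative A1 w t (h, A (z h t) h)) (at t within {0..1})"
        using vector_derivative_diff_chain_within[OF zd
          has_derivative_at_withinI[OF Cinf_on_has_derivative[OF A[of w] z(2)[OF h t]]]]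
        by (simp add: o_def A1_def)
      then have "((\<lambda>t. t *\<^sub>R A (z h t) w) has_vector_derivative (t *\<^sub>R A1 w t (h, A (z h t) h) + 1 *\<^sub>R A (z h t) w))
          (at t within {0..1})"
        by (intro has_vector_derivative_scaleR) (auto intro!: derivative_eq_intros)
      then show "(\<delta> has_vector_derivative \<delta>' t) (at t within {0..1})"
        unfolding \<delta>_def \<delta>'_def using has_vector_derivative_diff[OF Dd[OF t]] by simp
      \<comment> \<open>Integrability exchanges the directions \<open>h\<close> and \<open>w\<close>; what remains is a Taylor remainder, a
        Lipschitz difference and a term linear in \<open>\<delta>\<close>.\<close>
      have "t *\<^sub>R A1 w t (h, A (z h t) h) = t *\<^sub>R A1 h t (w, A (z h t) w)"
        unfolding A1_def using int[OF z(2)[OF h t]] by simp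
      also have "\<dots> = A1 h t (t *\<^sub>R w, t *\<^sub>R A (z h t) w)"
        using linear_scale[OF linA1[OF t], of h t "(w, A (z h t) w)"] by simp
      also have "\<dots> = A1 h t ((t *\<^sub>R w, D t) - (0, \<delta> t))" by (simp add: \<delta>_def)
      also have "\<dots> = A1 h t (z (h + w) t - z h t) - A1 h t (0, \<delta> t)"
        unfolding zz by (rule linear_diff[OF linA1[OF t]])
      finally have "\<delta>' t = (A (z (h + w) t) h - A (z h t) h - A1 h t (z (h + w) t - z h t))
          + (A (z (h + w) t) w - A (z h t) w) + A1 h t (0, \<delta> t)"
        by (simp add: \<delta>'_def expand[OF t])
      then have "norm (\<delta>' t) \<le> norm (A (z (h + w) t) h - A (z h t) h - A1 h t (z (h + w) t - z h t))
          + norm (A (z (h + w) t) w - A (z h t) w) + norm (A1 h t (0, \<delta> t))"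
        by (metis norm_triangle_mono norm_triangle_ineq order_refl)
      also have "\<dots> \<le> K * (norm (z (h + w) t - z h t))\<^sup>2 * norm h + K * norm (z (h + w) t - z h t) * norm w
          + K * norm (0::'n, \<delta> t) * norm h"
        unfolding A1_def by (intro add_mono b2 b3 b4 z h hw t)
      also have "\<dots> \<le> K * (C2 * norm w)\<^sup>2 * r + K * (C2 * norm w) * norm w + (K * norm h) * norm (\<delta> t)"
      proof (intro add_mono)
        show "K * (norm (z (h + w) t - z h t))\<^sup>2 * norm h \<le> K * (C2 * norm w)\<^sup>2 * r"
          using zn2[OF t] K h C by (intro mult_mono mult_left_mono power_mono) auto
        show "K * norm (z (h + w) t - z h t) * norm w \<le> K * (C2 * norm w) * norm w"
          using zn2[OF t] K by (intro mult_right_mono mult_left_mono) auto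
        show "K * norm (0::'n, \<delta> t) * norm h \<le> (K * norm h) * norm (\<delta> t)"
          by (simp add: norm_Pair)
      qed
      also have "\<dots> \<le> K * (C2 * norm w)\<^sup>2 * r + K * (C2 * norm w) * norm w + 1 / 2 * norm (\<delta> t)"
        using Kh(1) by (intro add_left_mono mult_right_mono) auto
      also have "\<dots> = norm (\<delta> t) / 2 + (K * C2\<^sup>2 * r + K * C2) * (norm w)\<^sup>2"
        by (simp add: power2_eq_square algebra_simps)
      finally show "norm (\<delta>' t) \<le> norm (\<delta> t) / 2 + (K * C2\<^sup>2 * r + K * C2) * (norm w)\<^sup>2" .
    qed (auto simp: \<delta>_def D_def y(1)[OF h] y(1)[OF hw])
    then show ?thesis by (simp add: \<delta>_def D_def C3_def algebra_simps)
  qed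
  show ?thesis
  proof (intro exI[of _ r] conjI exI[of _ Y] ballI r(1) Yq)
    fix a assume a: "a \<in> ball q r"
    define h where "h = a - q"
    have h: "norm h < r" using a by (simp add: h_def dist_norm norm_minus_commute)
    have zY: "z h 1 = (a, Y a)" by (simp add: z_def Y_def h_def)
    then show N1: "(a, Y a) \<in> N" using z(2)[OF h, of 1] by simp
    show "(Y has_derivative A (a, Y a)) (at a)"
      unfolding has_derivative_at_alt
    proof (intro conjI allI impI)
      show "bounded_linear (A (a, Y a))" by (rule finite_dim_linear_bounded[OF fdn lin[OF N1]])
      fix e :: real assume e: "e > 0"
      define d where "d = min (r - norm h) (e / (C3 + 1))"
      have d: "d > 0" using h e C by (simp add: d_def)
      have "norm (Y b - Y a - A (a, Y a) (b - a)) \<le> e * norm (b - a)" if b: "norm (b - a) < d" for b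
      proof -
        have hb: "h + (b - a) = b - q" by (simp add: h_def)
        have "norm (h + (b - a)) < r" using b norm_triangle_ineq[of h "b - a"] by (simp add: d_def)
        from key[OF h this] have "norm (Y b - Y a - A (a, Y a) (b - a)) \<le> C3 * (norm (b - a))\<^sup>2"
          unfolding hb zY by (simp add: Y_def h_def)
        also have "\<dots> = (C3 * norm (b - a)) * norm (b - a)" by (simp add: power2_eq_square)
        also have "\<dots> \<le> e * norm (b - a)"
        proof (rule mult_right_mono)
          have "C3 * norm (b - a) \<le> (C3 + 1) * (e / (C3 + 1))"
            using b C by (intro mult_mono) (auto simp: d_def)
          then show "C3 * norm (b - a) \<le> e" using C by simp
        qed simp
        finally show ?thesis .
      qed
      then show "\<exists>d>0. \<forall>b. norm (b - a) < d \<longrightarrow> norm (Y b - Y a - A (a, Y a) (b - a)) \<le> e * norm (b - a)"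
        using d by blast
    qed
  qed
qed

text \<open>
  The equation expresses the derivative of \<open>Y\<close> through \<open>Y\<close>, so each order of differentiability gives
  the next one.
\<close>

lemma total_equation_smooth:
  fixes A :: "'n::real_normed_vector \<times> 'm::real_normed_vector \<Rightarrow> 'n \<Rightarrow> 'm"
  assumes fdn: "finite_dim TYPE('n)" and fdm: "finite_dim TYPE('m)" and N: "open N" and S: "open S"
    and A: "\<And>w. Cinf_on (\<lambda>z. A z w) N"
    and Y: "\<And>a. a \<in> S \<Longrightarrow> (a, Y a) \<in> N" "\<And>a. a \<in> S \<Longrightarrow> (Y has_derivative A (a, Y a)) (at a)"
  shows "Cinf_on Y S"
proof -
  have "Ck_on k Y S" for k
  proof (induction k)
    case 0
    have "isCont Y a" if "a \<in> S" for a using Y(2)[OF that] has_derivative_continuous by blast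
    then show ?case by (simp add: continuous_at_imp_continuous_on)
  next
    case (Suc k)
    show ?case
    proof (rule Ck_on_SucI[OF S Y(2)])
      fix w
      have "Ck_on k (\<lambda>z. A z w) N" using A by (simp add: Cinf_on_def)
      moreover have "Ck_on k (\<lambda>a. (a, Y a)) S"
        by (intro Ck_on_Pair[OF S _ Suc] Ck_on_bounded_linear[OF S bounded_linear_ident])
      moreover have "(\<lambda>a. (a, Y a)) ` S \<subseteq> N" using Y(1) by blast
      ultimately show "Ck_on k (\<lambda>a. A (a, Y a) w) S"
        using Ck_on_compose[OF finite_dim_prod[OF fdn fdm] S N, where f = "\<lambda>z. A z w" and g = "\<lambda>a. (a, Y a)"]
        by blast
    qed
  qed
  then show ?thesis by (simp add: Cinf_on_def)
qed


text \<open>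
  Uniqueness for the equation pulled back along a curve \<open>c\<close> in the base, as long as everything stays in
  \<open>T\<close>. The bound \<open>\<kappa>\<close> on the speed of \<open>c\<close> serves to keep the growth rate of differences small.
\<close>

definition unique_along_curves ::
  "('n::real_normed_vector \<times> 'm::real_normed_vector \<Rightarrow> 'n \<Rightarrow> 'm) \<Rightarrow> ('n \<times> 'm) set \<Rightarrow> real \<Rightarrow> bool" where
  "unique_along_curves A T \<kappa> \<longleftrightarrow> (\<forall>c c' x1 x2. (\<forall>t\<in>{0..1::real}.
      (c t, x1 t) \<in> T \<and> (c t, x2 t) \<in> T \<and> norm (c' t) \<le> \<kappa> \<and>
      (x1 has_vector_derivative A (c t, x1 t) (c' t)) (at t within {0..1}) \<and>
      (x2 has_vector_derivative A (c t, x2 t) (c' t)) (at t within {0..1})) \<longrightarrow>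
    x1 0 = x2 0 \<longrightarrow> x1 1 = x2 1)"

lemma unique_along_curvesD:
  assumes "unique_along_curves A T \<kappa>"
    and "\<And>t. t \<in> {0..1::real} \<Longrightarrow> (c t, x1 t) \<in> T \<and> (c t, x2 t) \<in> T \<and> norm (c' t) \<le> \<kappa>"
    and "\<And>t. t \<in> {0..1} \<Longrightarrow> (x1 has_vector_derivative A (c t, x1 t) (c' t)) (at t within {0..1})"
    and "\<And>t. t \<in> {0..1} \<Longrightarrow> (x2 has_vector_derivative A (c t, x2 t) (c' t)) (at t within {0..1})"
    and "x1 0 = x2 0"
  shows "x1 1 = x2 1"
  using assms(1)[unfolded unique_along_curves_def, rule_format, of c x1 x2 c'] assms(2-5) by blast

lemma total_equation_unique:
  fixes A :: "'n::real_normed_vector \<times> 'm::real_normed_vector \<Rightarrow> 'n \<Rightarrow> 'm"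
  assumes fdn: "finite_dim TYPE('n)" and fdm: "finite_dim TYPE('m)"
    and N: "open N" "e \<in> N"
    and A: "\<And>w. Cinf_on (\<lambda>z. A z w) N" and lin: "\<And>z. z \<in> N \<Longrightarrow> linear (A z)"
  obtains \<rho> \<kappa> where "\<rho> > 0" "\<kappa> > 0" "ball e \<rho> \<subseteq> N" "unique_along_curves A (ball e \<rho>) \<kappa>"
proof -
  obtain r K where r: "r > 0" and K: "K > 0" and sub: "ball e r \<subseteq> N"
    and b2: "\<And>z z' w. z \<in> ball e r \<Longrightarrow> z' \<in> ball e r \<Longrightarrow> norm (A z w - A z' w) \<le> K * norm (z - z') * norm w"
  proof (rule operator_family_bounds[OF finite_dim_prod[OF fdn fdm] fdn N A lin], goal_cases)
    case (2 r K)
    show ?case by (rule 2(1)) (rule 2(2-); assumption)+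
  qed
  have "unique_along_curves A (ball e r) (1 / (2 * K))"
    unfolding unique_along_curves_def
  proof (intro allI impI)
    fix c c' and x1 x2 :: "real \<Rightarrow> 'm"
    assume *: "\<forall>t\<in>{0..1::real}. (c t, x1 t) \<in> ball e r \<and> (c t, x2 t) \<in> ball e r \<and> norm (c' t) \<le> 1 / (2 * K) \<and>
      (x1 has_vector_derivative A (c t, x1 t) (c' t)) (at t within {0..1}) \<and>
      (x2 has_vector_derivative A (c t, x2 t) (c' t)) (at t within {0..1})"
      and 0: "x1 0 = x2 0"
    have "norm (x1 1 - x2 1) \<le> 2 * 0"
    proof (rule small_gronwall)
      fix t :: real assume t: "t \<in> {0..1}"
      note c = bspec[OF * t]
      show "((\<lambda>t. x1 t - x2 t) has_vector_derivative A (c t, x1 t) (c' t) - A (c t, x2 t) (c' t)) (at t within {0..1})"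
        using c by (intro has_vector_derivative_diff) auto
      have "norm (A (c t, x1 t) (c' t) - A (c t, x2 t) (c' t)) \<le> K * norm (x1 t - x2 t) * norm (c' t)"
        using b2[of "(c t, x1 t)" "(c t, x2 t)" "c' t"] c by (simp add: norm_Pair)
      also have "\<dots> \<le> K * norm (x1 t - x2 t) * (1 / (2 * K))"
        using c K by (intro mult_left_mono) auto
      finally show "norm (A (c t, x1 t) (c' t) - A (c t, x2 t) (c' t)) \<le> norm (x1 t - x2 t) / 2 + 0"
        using K by simp
    qed (use 0 in auto)
    then show "x1 1 = x2 1" by simp
  qed
  from that[OF r _ sub this] K show thesis by simp
qed

section \<open>Group laws in coordinates\<close>

text \<open>
  The product rule for the evaluation of a smooth family of linear maps, read off from the joint
  derivative of \<open>(z, w) \<mapsto> A z w\<close> by additivity.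
\<close>

lemma has_derivative_operator_apply:
  fixes A :: "'k::real_normed_vector \<Rightarrow> 'n::real_normed_vector \<Rightarrow> 'm::real_normed_vector"
  assumes fdk: "finite_dim TYPE('k)" and fdn: "finite_dim TYPE('n)" and N: "open N" "z \<in> N"
    and A: "\<And>w. Cinf_on (\<lambda>z. A z w) N" and lin: "\<And>z. z \<in> N \<Longrightarrow> linear (A z)"
    and W: "(W has_derivative W') (at z)"
  shows "((\<lambda>y. A y (W y)) has_derivative
    (\<lambda>\<zeta>. \<D> (\<lambda>y. A y (W z)) z \<zeta> + A z (W' \<zeta>))) (at z)"
proof -
  define F where "F s = A (fst s) (snd s)" for s
  have F: "Cinf_on F (N \<times> UNIV)" unfolding F_def
    using N lin by (intro Cinf_on_apply[OF fdk fdn N(1) _ A] Cinf_on_fst Cinf_on_snd Cinf_on_ident open_Times) auto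
  define D where "D = \<D> F (z, W z)"
  have D: "(F has_derivative D) (at (z, W z))"
    unfolding D_def using Cinf_on_has_derivative[OF F] N by simp
  have "((\<lambda>y. (y, W z)) has_derivative (\<lambda>\<zeta>. (\<zeta>, 0))) (at z)" by (auto intro!: derivative_eq_intros)
  from has_derivative_compose[OF this D]
  have "((\<lambda>y. F (y, W z)) has_derivative (\<lambda>\<zeta>. D (\<zeta>, 0))) (at z)" by simp
  from fun_cong[OF frechet_derivative_at[OF this]]
  have D1: "D (\<zeta>, 0) = \<D> (\<lambda>y. A y (W z)) z \<zeta>" for \<zeta> by (simp add: F_def)
  have "((\<lambda>w. (z, w)) has_derivative (\<lambda>\<omega>. (0, \<omega>))) (at (W z))" by (auto intro!: derivative_eq_intros)
  from has_derivative_compose[OF this D]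
  have "((\<lambda>w. A z w) has_derivative (\<lambda>\<omega>. D (0, \<omega>))) (at (W z))" by (simp add: F_def)
  moreover have "((\<lambda>w. A z w) has_derivative A z) (at (W z))"
    using bounded_linear_imp_has_derivative[OF finite_dim_linear_bounded[OF fdn lin[OF N(2)]]] .
  ultimately have D2: "D (0, \<omega>) = A z \<omega>" for \<omega> using has_derivative_unique by metis
  have "((\<lambda>y. (y, W y)) has_derivative (\<lambda>\<zeta>. (\<zeta>, W' \<zeta>))) (at z)"
    using W by (auto intro!: derivative_eq_intros)
  from has_derivative_compose[OF this D]
  have "((\<lambda>y. A y (W y)) has_derivative (\<lambda>\<zeta>. D (\<zeta>, W' \<zeta>))) (at z)" by (simp add: F_def)
  moreover have "D (\<zeta>, W' \<zeta>) = D (\<zeta>, 0) + D (0, W' \<zeta>)" for \<zeta>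
    using linear_add[OF has_derivative_linear[OF D], of "(\<zeta>, 0)" "(0, W' \<zeta>)"] by simp
  ultimately show ?thesis by (simp add: D1 D2)
qed

text \<open>
  A group law on a neighbourhood of the unit in coordinates. Values of \<open>M\<close> on \<open>N \<times> N\<close> may leave \<open>N\<close>,
  where nothing is known about \<open>M\<close>; hence the conditions on intermediate products in the associative
  law. \<open>N\<close> itself is closed under inversion, which can always be achieved by shrinking.
\<close>

locale local_group =
  fixes M :: "'k::real_normed_vector \<Rightarrow> 'k \<Rightarrow> 'k" and I :: "'k \<Rightarrow> 'k" and e :: 'k and N :: "'k set"
  assumes fd: "finite_dim TYPE('k)"
    and N_open: "open N" and e_in: "e \<in> N"
    and M_smooth: "Cinf_on (\<lambda>s. M (fst s) (snd s)) (N \<times> N)"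
    and I_in: "a \<in> N \<Longrightarrow> I a \<in> N" and I_smooth: "Cinf_on I N"
    and unit_left: "a \<in> N \<Longrightarrow> M e a = a" and unit_right: "a \<in> N \<Longrightarrow> M a e = a"
    and assoc: "\<lbrakk>a \<in> N; b \<in> N; c \<in> N; M a b \<in> N; M b c \<in> N\<rbrakk> \<Longrightarrow> M (M a b) c = M a (M b c)"
    and inv_left: "a \<in> N \<Longrightarrow> M (I a) a = e" and inv_right: "a \<in> N \<Longrightarrow> M a (I a) = e"
begin

definition transl :: "'k \<Rightarrow> 'k \<Rightarrow> 'k \<Rightarrow> 'k" where
  "transl z b = \<D> (M z) b"

text \<open>The left-invariant vector field with value \<open>X\<close> at the unit.\<close>

definition left_field :: "'k \<Rightarrow> 'k \<Rightarrow> 'k" where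
  "left_field X z = transl z e X"

definition bracket :: "'k \<Rightarrow> 'k \<Rightarrow> 'k" where
  "bracket X Y = \<D> (left_field Y) e X - \<D> (left_field X) e Y"

lemma NN_open: "open (N \<times> N)"
  using N_open by (simp add: open_Times)

lemma fdNN: "finite_dim TYPE('k \<times> 'k)"
  by (rule finite_dim_prod[OF fd fd])

lemma M_smooth_comp:
  assumes "open S" "Cinf_on f S" "Cinf_on g S" "\<And>x. x \<in> S \<Longrightarrow> f x \<in> N" "\<And>x. x \<in> S \<Longrightarrow> g x \<in> N"
  shows "Cinf_on (\<lambda>x. M (f x) (g x)) S"
  using Cinf_on_compose[OF fdNN assms(1) NN_open _ M_smooth Cinf_on_Pair[OF assms(1-3)]] assms(4,5)
  by simp

lemma M_smooth_right: "z \<in> N \<Longrightarrow> Cinf_on (M z) N"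
  using M_smooth_comp[OF N_open Cinf_on_const Cinf_on_ident[OF N_open]] by simp

lemma M_has_derivative: "z \<in> N \<Longrightarrow> b \<in> N \<Longrightarrow> (M z has_derivative transl z b) (at b)"
  unfolding transl_def by (rule Cinf_on_has_derivative[OF M_smooth_right])

lemma transl_linear: "z \<in> N \<Longrightarrow> b \<in> N \<Longrightarrow> linear (transl z b)"
  using M_has_derivative has_derivative_linear by blast

lemma transl_joint:
  assumes "z \<in> N" "b \<in> N"
  shows "transl z b X = \<D> (\<lambda>s. M (fst s) (snd s)) (z, b) (0, X)"
  using fun_cong[OF frechet_derivative_at[OF partial_derivative[OF M_smooth]], of z b X] assms
  by (simp add: transl_def)

lemma transl_smooth:
  assumes S: "open S" and "Cinf_on f S" "Cinf_on g S" "Cinf_on X S"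
    and "\<And>x. x \<in> S \<Longrightarrow> f x \<in> N" "\<And>x. x \<in> S \<Longrightarrow> g x \<in> N"
  shows "Cinf_on (\<lambda>x. transl (f x) (g x) (X x)) S"
proof (rule Cinf_on_cong[OF S])
  show "Cinf_on (\<lambda>x. \<D> (\<lambda>s. M (fst s) (snd s)) (f x, g x) (0, X x)) S"
    using assms(5,6)
    by (intro Cinf_on_frechet_apply[OF fdNN NN_open S M_smooth] Cinf_on_Pair[OF S] Cinf_on_const assms(2-4)) auto
qed (simp add: transl_joint assms)

lemma left_field_smooth: "Cinf_on (left_field X) N"
  using transl_smooth[OF N_open Cinf_on_ident[OF N_open] Cinf_on_const Cinf_on_const] e_in
  by (simp add: left_field_def[abs_def])

lemma left_field_linear: "z \<in> N \<Longrightarrow> linear (\<lambda>X. left_field X z)"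
  unfolding left_field_def by (rule transl_linear[OF _ e_in])

lemma M_right_open: "z \<in> N \<Longrightarrow> open T \<Longrightarrow> open {b \<in> N. M z b \<in> T}"
proof -
  assume z: "z \<in> N" and T: "open T"
  have "open (N \<inter> M z -` T)"
    by (rule continuous_open_preimage[OF Cinf_on_continuous[OF M_smooth_right[OF z]] N_open T])
  moreover have "N \<inter> M z -` T = {b \<in> N. M z b \<in> T}" by auto
  ultimately show ?thesis by simp
qed

text \<open>
  The derivative of the associative law in its last argument. Left invariance of the fields
  \<open>left_field X\<close> and the invertibility of \<open>transl z e\<close> are special cases.
\<close>

lemma transl_comp:
  assumes z: "z \<in> N" and b: "b \<in> N" and c: "c \<in> N" and zb: "M z b \<in> N" and bc: "M b c \<in> N"
  shows "transl z (M b c) (transl b c X) = transl (M z b) c X"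
proof -
  have "((\<lambda>c. M z (M b c)) has_derivative (\<lambda>X. transl z (M b c) (transl b c X))) (at c)"
    using has_derivative_compose[OF M_has_derivative[OF b c] M_has_derivative[OF z bc]] .
  then have "(M (M z b) has_derivative (\<lambda>X. transl z (M b c) (transl b c X))) (at c)"
  proof (rule has_derivative_transform_within_open[OF _ M_right_open[OF b N_open]])
    show "c \<in> {c \<in> N. M b c \<in> N}" using c bc by simp
    show "M z (M b x) = M (M z b) x" if "x \<in> {c \<in> N. M b c \<in> N}" for x
      using assoc[of z b x] z b zb that by simp
  qed
  from fun_cong[OF frechet_derivative_at[OF this]] show ?thesis by (simp add: transl_def)
qed

lemma left_field_invariant:
  assumes "z \<in> N" "b \<in> N" "M z b \<in> N"
  shows "transl z b (left_field X b) = left_field X (M z b)"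
  using transl_comp[OF assms(1,2) e_in assms(3)] assms(2) by (simp add: unit_right left_field_def)

lemma left_field_at_unit: "left_field X e = X"
proof -
  have "(M e has_derivative (\<lambda>X. X)) (at e)"
    by (rule has_derivative_transform_within_open[OF has_derivative_ident N_open e_in]) (simp add: unit_left)
  from fun_cong[OF frechet_derivative_at[OF this]] show ?thesis by (simp add: left_field_def transl_def)
qed

lemma transl_inverse_left:
  assumes z: "z \<in> N" shows "transl (I z) z (left_field X z) = X"
  using left_field_invariant[OF I_in[OF z] z] inv_left[OF z] e_in by (simp add: left_field_at_unit)

lemma transl_inverse_right:
  assumes z: "z \<in> N" shows "left_field (transl (I z) z X) z = X"
proof -
  have "left_field (transl (I z) z X) z = transl (M z (I z)) z X"
    unfolding left_field_def
    using transl_comp[OF z I_in[OF z] z] inv_left[OF z] inv_right[OF z] e_in by simp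
  also have "\<dots> = X"
  proof -
    have "(M e has_derivative (\<lambda>X. X)) (at z)"
      by (rule has_derivative_transform_within_open[OF has_derivative_ident N_open z]) (simp add: unit_left)
    from fun_cong[OF frechet_derivative_at[OF this]] show ?thesis using inv_right[OF z] by (simp add: transl_def)
  qed
  finally show ?thesis .
qed

text \<open>
  Left-invariant fields are closed under the commutator: differentiating
  \<open>left_field Y (M z b) = transl z b (left_field Y b)\<close> in \<open>b\<close> at the unit along \<open>X\<close> produces a second
  derivative of \<open>M z\<close>, which is symmetric and cancels in the commutator.
\<close>

lemma left_field_commutator:
  assumes z: "z \<in> N"
  shows "\<D> (left_field Y) z (left_field X z)
    - \<D> (left_field X) z (left_field Y z) = left_field (bracket X Y) z"
proof -
  have *: "\<D> (left_field Y) z (left_field X z)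
      = \<D> (\<lambda>b. transl z b Y) e X + transl z e (\<D> (left_field Y) e X)"
    for X Y
  proof -
    have "((\<lambda>b. left_field Y (M z b)) has_derivative
        (\<lambda>X. \<D> (left_field Y) z (transl z e X))) (at e)"
      using has_derivative_compose[OF M_has_derivative[OF z e_in], of "left_field Y"
          "\<D> (left_field Y) z"] Cinf_on_has_derivative[OF left_field_smooth z]
      by (simp add: unit_right[OF z])
    then have "((\<lambda>b. transl z b (left_field Y b)) has_derivative
        (\<lambda>X. \<D> (left_field Y) z (transl z e X))) (at e)"
      by (rule has_derivative_transform_within_open[OF _ M_right_open[OF z N_open]])
        (auto simp: e_in unit_right z left_field_invariant)
    moreover have "((\<lambda>b. transl z b (left_field Y b)) has_derivative
        (\<lambda>X. \<D> (\<lambda>b. transl z b (left_field Y e)) e X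
          + transl z e (\<D> (left_field Y) e X))) (at e)"
    proof (rule has_derivative_operator_apply[OF fd fd N_open e_in])
      show "Cinf_on (\<lambda>b. transl z b w) N" for w
        using z by (intro transl_smooth N_open Cinf_on_const Cinf_on_ident) auto
    qed (use z transl_linear Cinf_on_has_derivative[OF left_field_smooth e_in] in auto)
    ultimately have "(\<lambda>X. \<D> (left_field Y) z (transl z e X))
        = (\<lambda>X. \<D> (\<lambda>b. transl z b (left_field Y e)) e X
          + transl z e (\<D> (left_field Y) e X))" by (rule has_derivative_unique)
    from fun_cong[OF this, of X] show ?thesis by (simp add: left_field_at_unit left_field_def[of X z])
  qed
  have "\<D> (\<lambda>b. transl z b Y) e X = \<D> (\<lambda>b. transl z b X) e Y"
    unfolding transl_def by (rule second_derivative_symmetric[OF fd N_open e_in M_smooth_right[OF z]])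
  then show ?thesis
    unfolding * bracket_def using linear_diff[OF left_field_linear[OF z]] by (simp add: left_field_def)
qed

end


section \<open>Local subgroups that are graphs\<close>

text \<open>
  The model space is split as \<open>'n \<times> 'm\<close> so that the first component of a product does not depend
  on the second component of the right factor, as is the case for a semidirect product. The graph
  of \<open>\<beta>\<close> is assumed to be a subalgebra.
\<close>

locale graph_subalgebra = local_group M I "(q, p)" N
  for M :: "'n::real_normed_vector \<times> 'm::real_normed_vector \<Rightarrow> 'n \<times> 'm \<Rightarrow> 'n \<times> 'm" and I q p N +
  fixes \<beta> :: "'n \<Rightarrow> 'm"
  assumes fdn: "finite_dim TYPE('n)" and fdm: "finite_dim TYPE('m)"
    and \<beta>_linear: "linear \<beta>"
    and fst_M: "\<lbrakk>z \<in> N; (b, y) \<in> N; (b, y') \<in> N\<rbrakk> \<Longrightarrow> fst (M z (b, y)) = fst (M z (b, y'))"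
    and subalgebra: "snd (bracket (u, \<beta> u) (v, \<beta> v)) = \<beta> (fst (bracket (u, \<beta> u) (v, \<beta> v)))"
begin

definition P where "P z u = fst (left_field (u, \<beta> u) z)"
definition Q where "Q z u = snd (left_field (u, \<beta> u) z)"
definition P' where "P' z w = fst (transl (I z) z (w, 0))"

text \<open>
  The left-invariant distribution spanned by the graph of \<open>\<beta>\<close> consists, at each point \<open>z\<close>, of the
  graph of \<open>A z\<close>. The inverse of \<open>P z\<close> is expressed through the inverse of the group, which makes
  the smoothness of \<open>A\<close> evident.
\<close>

definition A where "A z w = Q z (P' z w)"

lemma fst_transl_snd:
  assumes z: "z \<in> N" and b: "b \<in> N"
  shows "fst (transl z b (0, y)) = 0"
proof -
  \<comment> \<open>On this line in the second factor the first component of the product is constant.\<close>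
  define g where "g t = b + t *\<^sub>R (0, y)" for t :: real
  have g0: "g 0 = b" by (simp add: g_def prod_eq_iff)
  have g: "(g has_derivative (\<lambda>t. t *\<^sub>R (0, y))) (at 0)"
    unfolding g_def by (auto intro!: derivative_eq_intros)
  have "((\<lambda>t. M z (g t)) has_derivative (\<lambda>t. transl z b (t *\<^sub>R (0, y)))) (at 0)"
    using has_derivative_compose[OF g, of "M z" "transl z b"] M_has_derivative[OF z b] g0 by simp
  from has_derivative_fst[OF this]
  have 1: "((\<lambda>t. fst (M z (g t))) has_derivative (\<lambda>t. fst (transl z b (t *\<^sub>R (0, y))))) (at 0)" .
  have "open (g -` N)" unfolding g_def
    by (intro open_vimage N_open continuous_intros)
  then have "((\<lambda>t. fst (M z b)) has_derivative (\<lambda>t. fst (transl z b (t *\<^sub>R (0, y))))) (at 0)"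
  proof (rule has_derivative_transform_within_open[OF 1])
    show "0 \<in> g -` N" using b g0 by simp
    show "fst (M z (g t)) = fst (M z b)" if "t \<in> g -` N" for t
    proof -
      have "g t = (fst b, snd b + t *\<^sub>R y)" by (simp add: g_def prod_eq_iff)
      then show ?thesis using fst_M[OF z, of "fst b" "snd b + t *\<^sub>R y" "snd b"] that b by simp
    qed
  qed
  then have "(\<lambda>t. fst (transl z b (t *\<^sub>R (0, y)))) = (\<lambda>t. 0)"
    using has_derivative_unique has_derivative_const by blast
  from fun_cong[OF this, of 1] show ?thesis by simp
qed

lemma fst_transl:
  assumes "z \<in> N" "b \<in> N"
  shows "fst (transl z b (u, y)) = fst (transl z b (u, y'))"
proof -
  have "transl z b (u, y) = transl z b (u, y') + transl z b (0, y - y')"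
    using linear_add[OF transl_linear[OF assms], of "(u, y')" "(0, y - y')"] by simp
  then show ?thesis by (simp add: fst_transl_snd[OF assms])
qed

lemma P'_P: assumes z: "z \<in> N" shows "P' z (P z u) = u"
proof -
  have "P' z (P z u) = fst (transl (I z) z (left_field (u, \<beta> u) z))"
    unfolding P'_def P_def using fst_transl[OF I_in[OF z] z] by (metis prod.collapse)
  then show ?thesis by (simp add: transl_inverse_left[OF z])
qed

lemma P_P': assumes z: "z \<in> N" shows "P z (P' z w) = w"
proof -
  have "P z (P' z w) = fst (left_field (transl (I z) z (w, 0)) z)"
    unfolding P'_def P_def left_field_def using fst_transl[OF z e_in] by (metis prod.collapse)
  then show ?thesis by (simp add: transl_inverse_right[OF z])
qed

lemma A_P: "z \<in> N \<Longrightarrow> A z (P z u) = Q z u"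
  by (simp add: A_def P'_P)

lemma left_field_graph: "z \<in> N \<Longrightarrow> left_field (u, \<beta> u) z = (P z u, A z (P z u))"
  by (simp add: A_P) (simp add: P_def Q_def)

lemma graph_left_field: "z \<in> N \<Longrightarrow> (w, A z w) = left_field (P' z w, \<beta> (P' z w)) z"
  by (simp add: left_field_graph P_P')

lemma graph_linear: "linear (\<lambda>u. (u, \<beta> u))"
  by (intro linearI) (simp_all add: linear_add[OF \<beta>_linear] linear_scale[OF \<beta>_linear])

lemma Q_linear: "z \<in> N \<Longrightarrow> linear (Q z)"
  using linear_compose[OF linear_compose[OF graph_linear left_field_linear] linear_snd]
  by (simp add: Q_def[abs_def] o_def)

lemma P'_linear: assumes z: "z \<in> N" shows "linear (P' z)"
proof -
  have l: "linear (\<lambda>w::'n. (w, 0::'m))" by (auto intro!: linearI)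
  show ?thesis
    using linear_compose[OF linear_compose[OF l transl_linear[OF I_in[OF z] z]] linear_fst]
    by (simp add: P'_def[abs_def] o_def)
qed

lemma A_linear: "z \<in> N \<Longrightarrow> linear (A z)"
  using linear_compose[OF P'_linear Q_linear] by (simp add: A_def[abs_def] o_def)

lemma A_smooth: "Cinf_on (\<lambda>z. A z w) N"
proof -
  have P': "Cinf_on (\<lambda>z. P' z w) N"
    unfolding P'_def
    by (intro Cinf_on_fst transl_smooth I_smooth N_open Cinf_on_const Cinf_on_ident I_in)
  have "Cinf_on (\<lambda>z. \<beta> (P' z w)) N"
    by (rule Cinf_on_bounded_linear_comp[OF N_open finite_dim_linear_bounded[OF fdn \<beta>_linear] P'])
  then show ?thesis
    unfolding A_def Q_def left_field_def
    by (intro Cinf_on_snd transl_smooth N_open Cinf_on_ident Cinf_on_const Cinf_on_Pair P' e_in)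
qed

text \<open>
  Involutivity of the distribution is the integrability condition of the total differential
  equation: differentiate \<open>A z (P z u) = Q z u\<close> along the left-invariant field of \<open>(v, \<beta> v)\<close> and
  antisymmetrize.
\<close>

lemma A_integrable:
  assumes z: "z \<in> N"
  shows "\<D> (\<lambda>z. A z w) z (v, A z v) = \<D> (\<lambda>z. A z v) z (w, A z w)"
proof -
  define V where "V u = left_field (u, \<beta> u)" for u
  define DV where "DV u = \<D> (V u) z" for u
  have DV: "(V u has_derivative DV u) (at z)" for u
    unfolding V_def DV_def by (rule Cinf_on_has_derivative[OF left_field_smooth z])
  have diff: "\<D> (\<lambda>y. A y (P z u)) z \<zeta> = snd (DV u \<zeta>) - A z (fst (DV u \<zeta>))" for u \<zeta>
  proof -
    have "((\<lambda>y. A y (P y u)) has_derivative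
      (\<lambda>\<zeta>. \<D> (\<lambda>y. A y (P z u)) z \<zeta> + A z (fst (DV u \<zeta>)))) (at z)"
    proof (rule has_derivative_operator_apply[OF fd fdn N_open z A_smooth A_linear])
      show "((\<lambda>y. P y u) has_derivative (\<lambda>\<zeta>. fst (DV u \<zeta>))) (at z)"
        using has_derivative_fst[OF DV] by (simp add: P_def V_def)
    qed
    then have "((\<lambda>y. Q y u) has_derivative
      (\<lambda>\<zeta>. \<D> (\<lambda>y. A y (P z u)) z \<zeta> + A z (fst (DV u \<zeta>)))) (at z)"
      by (rule has_derivative_transform_within_open[OF _ N_open z]) (simp add: A_P)
    moreover have "((\<lambda>y. Q y u) has_derivative (\<lambda>\<zeta>. snd (DV u \<zeta>))) (at z)"
      using has_derivative_snd[OF DV] by (simp add: Q_def V_def)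
    ultimately have "(\<lambda>\<zeta>. \<D> (\<lambda>y. A y (P z u)) z \<zeta> + A z (fst (DV u \<zeta>)))
        = (\<lambda>\<zeta>. snd (DV u \<zeta>))" by (rule has_derivative_unique)
    from fun_cong[OF this, of \<zeta>] show ?thesis by (simp add: algebra_simps)
  qed
  define u u' where "u = P' z v" and "u' = P' z w"
  have V: "V u z = (v, A z v)" "V u' z = (w, A z w)"
    unfolding V_def u_def u'_def using graph_left_field[OF z] by simp_all
  define C where "C = bracket (u, \<beta> u) (u', \<beta> u')"
  have "C = (fst C, \<beta> (fst C))" using subalgebra[of u u'] by (simp add: C_def prod_eq_iff)
  then have "left_field C z = (P z (fst C), A z (P z (fst C)))" using left_field_graph[OF z] by metis
  then have "DV u' (V u z) - DV u (V u' z) = (P z (fst C), A z (P z (fst C)))"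
    using left_field_commutator[OF z, of "(u', \<beta> u')" "(u, \<beta> u)"] by (simp add: DV_def V_def C_def)
  then have "snd (DV u' (V u z)) - snd (DV u (V u' z)) = A z (fst (DV u' (V u z)) - fst (DV u (V u' z)))"
    by (metis fst_conv fst_diff snd_conv snd_diff)
  then have "snd (DV u' (V u z)) - A z (fst (DV u' (V u z))) = snd (DV u (V u' z)) - A z (fst (DV u (V u' z)))"
    unfolding linear_diff[OF A_linear[OF z]] by (simp add: algebra_simps)
  then show ?thesis
    unfolding diff[symmetric] V by (simp add: u_def u'_def P_P'[OF z])
qed

lemma A_at_unit: "A (q, p) w = \<beta> w"
proof -
  have "P (q, p) w = w" "Q (q, p) w = \<beta> w" by (simp_all add: P_def Q_def left_field_at_unit)
  then show ?thesis using A_P[OF e_in, of w] by simp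
qed

lemma near_unit:
  assumes "isCont b q" "b q = p" "open T" "(q, p) \<in> T"
  shows "\<exists>s>0. \<forall>a\<in>ball q s. (a, b a) \<in> T"
proof -
  have "isCont (\<lambda>a. (a, b a)) q" using assms(1) by (intro continuous_intros)
  then have "\<forall>\<^sub>F a in nhds q. (a, b a) \<in> T"
    using assms(2-4) by (simp add: continuous_at_open eventually_nhds)
  then show ?thesis by (auto simp: eventually_nhds_metric dist_commute)
qed

text \<open>
  A graph that is closed under the group law is an integral manifold of the distribution: in the
  closedness condition, the right factor moves through the unit.
\<close>

lemma closed_graph_total_equation:
  assumes S: "open S" "q \<in> S" and b: "b q = p" "(b has_derivative \<beta>) (at q)"
    and a: "a \<in> S" "(a, b a) \<in> N" and ba: "(b has_derivative b') (at a)"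
    and closed: "\<And>c. c \<in> S \<Longrightarrow> (c, b c) \<in> N \<Longrightarrow> fst (M (a, b a) (c, b c)) \<in> S \<Longrightarrow>
      snd (M (a, b a) (c, b c)) = b (fst (M (a, b a) (c, b c)))"
  shows "b' w = A (a, b a) w"
proof -
  define z where "z = (a, b a)"
  have z: "z \<in> N" using a(2) by (simp add: z_def)
  define g where "g c = M z (c, b c)" for c
  have g: "(g has_derivative (\<lambda>u. left_field (u, \<beta> u) z)) (at q)"
    unfolding g_def left_field_def
    using has_derivative_compose[of "\<lambda>c. (c, b c)" "\<lambda>u. (u, \<beta> u)" q UNIV "M z" "transl z (q, p)"]
      has_derivative_Pair[OF has_derivative_ident b(2)] M_has_derivative[OF z e_in] b(1) by simp
  have gq: "g q = z" by (simp add: g_def b(1) unit_right[OF z])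
  have P: "((\<lambda>c. fst (g c)) has_derivative P z) (at q)"
    using has_derivative_fst[OF g] by (simp add: P_def[abs_def])
  have Q: "((\<lambda>c. snd (g c)) has_derivative Q z) (at q)"
    using has_derivative_snd[OF g] by (simp add: Q_def[abs_def])
  obtain s1 where s1: "s1 > 0" "\<And>c. c \<in> ball q s1 \<Longrightarrow> (c, b c) \<in> N"
    using near_unit[OF has_derivative_continuous[OF b(2)] b(1) N_open e_in] by blast
  have "isCont (\<lambda>c. fst (g c)) q" by (rule has_derivative_continuous[OF P])
  then obtain T where T: "open T" "q \<in> T" "\<And>c. c \<in> T \<Longrightarrow> fst (g c) \<in> S"
    unfolding continuous_at_open using S(1) a(1) gq by (auto simp: z_def)
  have "((\<lambda>c. b (fst (g c))) has_derivative (\<lambda>u. b' (P z u))) (at q)"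
    using has_derivative_compose[OF P, of b b'] ba by (simp add: gq z_def)
  then have "((\<lambda>c. snd (g c)) has_derivative (\<lambda>u. b' (P z u))) (at q)"
  proof (rule has_derivative_transform_within_open)
    show "open (ball q s1 \<inter> T \<inter> S)" "q \<in> ball q s1 \<inter> T \<inter> S" using s1 T S by auto
    show "b (fst (g c)) = snd (g c)" if "c \<in> ball q s1 \<inter> T \<inter> S" for c
      using closed[of c] s1(2)[of c] T(3)[of c] that by (simp add: g_def z_def)
  qed
  from fun_cong[OF has_derivative_unique[OF this Q], of "P' z w"] show ?thesis
    by (simp add: P_P'[OF z] A_def flip: z_def)
qed


text \<open>
  Closedness is only required where the product lies over \<open>S\<close> again, in accordance with the definition
  of local relative Rota--Baxter operators.
\<close>

definition closed_graph :: "'n set \<Rightarrow> ('n \<Rightarrow> 'm) \<Rightarrow> bool" where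
  "closed_graph S b \<longleftrightarrow> open S \<and> q \<in> S \<and> b q = p \<and> (b has_derivative \<beta>) (at q) \<and>
     (\<forall>a\<in>S. b differentiable (at a)) \<and>
     (\<forall>a\<in>S. \<forall>c\<in>S. (a, b a) \<in> N \<longrightarrow> (c, b c) \<in> N \<longrightarrow> fst (M (a, b a) (c, b c)) \<in> S \<longrightarrow>
        snd (M (a, b a) (c, b c)) = b (fst (M (a, b a) (c, b c))))"

lemma segment_in_ball:
  assumes "a \<in> ball q s" "t \<in> {0..1::real}"
  shows "q + t *\<^sub>R (a - q) \<in> ball q s"
proof -
  have "\<bar>t\<bar> * norm (a - q) \<le> norm (a - q)" using assms(2) by (intro mult_left_le_one_le) auto
  then show ?thesis using assms(1) by (simp add: dist_norm norm_minus_commute)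
qed

lemma segment_derivative:
  "((\<lambda>t. q + t *\<^sub>R w) has_vector_derivative w) (at t within T)"
  unfolding has_vector_derivative_def by (auto intro!: derivative_eq_intros)

theorem closed_graph_unique:
  assumes 1: "closed_graph S1 b1" and 2: "closed_graph S2 b2"
  shows "\<exists>s>0. ball q s \<subseteq> S1 \<inter> S2 \<and> (\<forall>a\<in>ball q s. b1 a = b2 a)"
proof -
  obtain \<rho> \<kappa> where \<rho>: "\<rho> > 0" "\<kappa> > 0" "ball (q, p) \<rho> \<subseteq> N" 
    and unique: "unique_along_curves A (ball (q, p) \<rho>) \<kappa>"
    using total_equation_unique[OF fdn fdm N_open e_in A_smooth A_linear] by metis
  have near: "\<exists>s>0. \<forall>a\<in>ball q s. a \<in> S \<and> (a, b a) \<in> ball (q, p) \<rho> \<and> (b has_derivative A (a, b a)) (at a)"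
    if b: "closed_graph S b" for S b
  proof -
    have S: "open S" "q \<in> S" and bq: "b q = p" "(b has_derivative \<beta>) (at q)"
      and bd: "\<And>a. a \<in> S \<Longrightarrow> b differentiable (at a)" using b by (auto simp: closed_graph_def)
    have "open (S \<times> (UNIV :: 'm set) \<inter> ball (q, p) \<rho>)" using S(1) by (intro open_Int open_Times) auto
    then obtain s where s: "s > 0" "\<forall>a\<in>ball q s. (a, b a) \<in> S \<times> UNIV \<inter> ball (q, p) \<rho>"
      using near_unit[OF has_derivative_continuous[OF bq(2)] bq(1), of "S \<times> UNIV \<inter> ball (q, p) \<rho>"] S \<rho>(1)
      by auto
    have "(b has_derivative A (a, b a)) (at a)" if "a \<in> ball q s" for a
    proof -
      have a: "a \<in> S" "(a, b a) \<in> N" using s(2) that \<rho>(3) by blast+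
      have d: "(b has_derivative \<D> b a) (at a)"
        using bd[OF a(1)] by (rule has_derivative_frechet)
      have "\<D> b a w = A (a, b a) w" for w
        by (rule closed_graph_total_equation[OF S bq a d]) (use b a in \<open>auto simp: closed_graph_def\<close>)
      then have "\<D> b a = A (a, b a)" by blast
      then show ?thesis using d by simp
    qed
    then show ?thesis using s by blast
  qed
  obtain s1 where s1: "s1 > 0" "\<And>a. a \<in> ball q s1 \<Longrightarrow>
      a \<in> S1 \<and> (a, b1 a) \<in> ball (q, p) \<rho> \<and> (b1 has_derivative A (a, b1 a)) (at a)"
    using near[OF 1] by blast
  obtain s2 where s2: "s2 > 0" "\<And>a. a \<in> ball q s2 \<Longrightarrow>
      a \<in> S2 \<and> (a, b2 a) \<in> ball (q, p) \<rho> \<and> (b2 has_derivative A (a, b2 a)) (at a)"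
    using near[OF 2] by blast
  define s where "s = min \<kappa> (min s1 s2)"
  have s: "s > 0" "\<And>a. a \<in> ball q s \<Longrightarrow> a \<in> ball q s1 \<and> a \<in> ball q s2"
    using \<rho>(2) s1(1) s2(1) by (auto simp: s_def)
  have "b1 a = b2 a" if a: "a \<in> ball q s" for a
  proof -
    define c where "c t = q + t *\<^sub>R (a - q)" for t
    have c: "c t \<in> ball q s1" "c t \<in> ball q s2" if "t \<in> {0..1}" for t
      using segment_in_ball[OF a that] s(2) by (auto simp: c_def)
    have cd: "(c has_vector_derivative (a - q)) (at t within {0..1})" for t
      unfolding c_def by (rule segment_derivative)
    have "b1 (c 1) = b2 (c 1)"
    proof (rule unique_along_curvesD[OF unique, of c "\<lambda>t. b1 (c t)" "\<lambda>t. b2 (c t)" "\<lambda>_. a - q"])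
      fix t :: real assume t: "t \<in> {0..1}"
      show "(c t, b1 (c t)) \<in> ball (q, p) \<rho> \<and> (c t, b2 (c t)) \<in> ball (q, p) \<rho> \<and> norm (a - q) \<le> \<kappa>"
        using s1(2) s2(2) c[OF t] a by (simp add: s_def dist_norm norm_minus_commute)
      show "((\<lambda>t. b1 (c t)) has_vector_derivative A (c t, b1 (c t)) (a - q)) (at t within {0..1})"
        using vector_derivative_diff_chain_within[OF cd has_derivative_at_withinI] s1(2)[OF c(1)[OF t]]
        by (auto simp: o_def)
      show "((\<lambda>t. b2 (c t)) has_vector_derivative A (c t, b2 (c t)) (a - q)) (at t within {0..1})"
        using vector_derivative_diff_chain_within[OF cd has_derivative_at_withinI] s2(2)[OF c(2)[OF t]]
        by (auto simp: o_def)
    next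
      show "b1 (c 0) = b2 (c 0)" using 1 2 by (simp add: c_def closed_graph_def)
    qed
    then show ?thesis by (simp add: c_def)
  qed
  then show ?thesis using s s1(2) s2(2) by (intro exI[of _ s]) auto
qed

text \<open>
  The solution of the total differential equation has a graph closed under the group law: for fixed
  \<open>a\<close>, as \<open>c\<close> runs along a ray, the product of the points over \<open>a\<close> and \<open>c\<close> and the point of the graph over
  the first component of this product both solve the equation, the former by left invariance of
  the distribution, and both start at the point over \<open>a\<close>.
\<close>

theorem closed_graph_exists:
  "\<exists>r>0. \<exists>Y. Y q = p \<and> (Y has_derivative \<beta>) (at q) \<and> Cinf_on Y (ball q r) \<and>
    (\<forall>a\<in>ball q r. (a, Y a) \<in> N) \<and>
    (\<forall>a\<in>ball q r. \<forall>c\<in>ball q r. snd (M (a, Y a) (c, Y c)) = Y (fst (M (a, Y a) (c, Y c))))"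
proof -
  obtain r0 Y where r0: "r0 > 0" and Yq: "Y q = p" and YN: "\<And>a. a \<in> ball q r0 \<Longrightarrow> (a, Y a) \<in> N"
    and Yd: "\<And>a. a \<in> ball q r0 \<Longrightarrow> (Y has_derivative A (a, Y a)) (at a)"
    using total_equation_solution[OF fdn fdm N_open e_in A_smooth A_linear A_integrable] by blast
  have Y_smooth: "Cinf_on Y (ball q r0)"
    by (rule total_equation_smooth[OF fdn fdm N_open open_ball A_smooth YN Yd])
  have "A (q, p) = \<beta>" using A_at_unit by blast
  then have Y\<beta>: "(Y has_derivative \<beta>) (at q)" using Yd[of q] r0 Yq by simp
  have Yc: "isCont Y q" by (rule has_derivative_continuous[OF Y\<beta>])
  obtain \<rho> \<kappa> where \<rho>: "\<rho> > 0" "\<kappa> > 0" "ball (q, p) \<rho> \<subseteq> N" 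
    and unique: "unique_along_curves A (ball (q, p) \<rho>) \<kappa>"
    using total_equation_unique[OF fdn fdm N_open e_in A_smooth A_linear] by metis
  obtain r1 K1 where K1: "r1 > 0" "K1 > 0" "\<And>z w. z \<in> ball (q, p) r1 \<Longrightarrow> norm (A z w) \<le> K1 * norm w"
  proof (rule operator_family_bounds[OF fd fdn N_open e_in A_smooth A_linear], goal_cases)
    case (2 r K)
    show ?case by (rule 2(1)) (rule 2(2-); assumption)+
  qed
  have eNN: "((q, p), (q, p)) \<in> N \<times> N" using e_in by simp
  obtain r2 K2 where K2: "r2 > 0" "K2 > 0"
    "\<And>s w. s \<in> ball ((q, p), (q, p)) r2 \<Longrightarrow> norm (transl (fst s) (snd s) w) \<le> K2 * norm w"
  proof (rule operator_family_bounds[OF fdNN fd NN_open eNN, where A = "\<lambda>s. transl (fst s) (snd s)"], goal_cases)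
    case (1 w)
    show ?case
      by (intro transl_smooth NN_open Cinf_on_const Cinf_on_fst Cinf_on_snd Cinf_on_ident) auto
  next
    case (2 s)
    then show ?case using transl_linear by auto
  next
    case (3 r K)
    show ?case by (rule 3(1)) (rule 3(2-); assumption)+
  qed
  obtain s0 where s0: "s0 > 0" "\<And>a. a \<in> ball q s0 \<Longrightarrow> (a, Y a) \<in> ball (q, p) \<rho>"
    using near_unit[OF Yc Yq open_ball, of "(q, p)" \<rho>] \<rho>(1) by auto
  define r' where "r' = min s0 r0"
  have r': "r' > 0" "\<And>a. a \<in> ball q r' \<Longrightarrow> a \<in> ball q s0 \<and> a \<in> ball q r0"
    using s0 r0 by (auto simp: r'_def)
  \<comment> \<open>Products of points of the graph near the unit have to stay in \<open>T\<close>: over \<open>T\<close> the solution exists and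
    both curves compared below lie in the region of uniqueness.\<close>
  define T where "T = ball q r' \<times> (UNIV :: 'm set) \<inter> ball (q, p) \<rho>"
  have T: "open T" "(q, p) \<in> T" unfolding T_def using r' \<rho> by (auto intro!: open_Int open_Times)
  define O' where "O' = (N \<times> N) \<inter> (\<lambda>s. M (fst s) (snd s)) -` T \<inter> ball ((q, p), (q, p)) r2"
  have O': "open O'" "((q, p), (q, p)) \<in> O'"
    unfolding O'_def using continuous_open_preimage[OF Cinf_on_continuous[OF M_smooth] NN_open T(1)]
      e_in T(2) K2(1) by (auto simp: unit_left)
  obtain W1 W2 where W: "open W1" "open W2" "(q, p) \<in> W1" "(q, p) \<in> W2" "W1 \<times> W2 \<subseteq> O'"
    using open_prod_elim[OF O'] by (metis mem_Sigma_iff)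
  obtain s1 where s1: "s1 > 0" "\<And>a. a \<in> ball q s1 \<Longrightarrow> (a, Y a) \<in> W1 \<inter> W2 \<inter> ball (q, p) r1"
    using near_unit[OF Yc Yq, of "W1 \<inter> W2 \<inter> ball (q, p) r1"] W K1(1) by (auto simp: open_Int)
  \<comment> \<open>The last bound makes the base curve \<open>fst (X t)\<close> slow enough: its velocity \<open>d t\<close> is at most
    \<open>K2 * (1 + K1)\<close> times the velocity of the ray.\<close>
  define s where "s = min s1 (min r' (\<kappa> / (K2 * (1 + K1))))"
  have s: "s > 0" "\<And>a. a \<in> ball q s \<Longrightarrow> a \<in> ball q s1 \<and> a \<in> ball q r'" "K2 * ((1 + K1) * s) \<le> \<kappa>"
  proof -
    have p: "K2 * (1 + K1) > 0" using K1 K2 by simp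
    then show "s > 0" using s1 r' \<rho> by (simp add: s_def)
    show "\<And>a. a \<in> ball q s \<Longrightarrow> a \<in> ball q s1 \<and> a \<in> ball q r'" by (auto simp: s_def)
    have "s \<le> \<kappa> / (K2 * (1 + K1))" by (simp add: s_def)
    then show "K2 * ((1 + K1) * s) \<le> \<kappa>" using p by (simp add: field_simps)
  qed
  have closed: "snd (M (a, Y a) (c, Y c)) = Y (fst (M (a, Y a) (c, Y c)))"
    if a: "a \<in> ball q s" and c: "c \<in> ball q s" for a c
  proof -
    define z1 where "z1 = (a, Y a)"
    define w where "w = c - q"
    define \<gamma> where "\<gamma> t = q + t *\<^sub>R w" for t
    define \<zeta> where "\<zeta> t = (\<gamma> t, Y (\<gamma> t))" for t
    define X where "X t = M z1 (\<zeta> t)" for t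
    define d where "d t = P (X t) (P' (\<zeta> t) w)" for t
    have w: "norm w < s" using c by (simp add: w_def dist_norm norm_minus_commute)
    have z1: "z1 \<in> W1" "z1 \<in> N"
      using s1(2)[of a] s(2)[OF a] YN[of a] r'(2)[of a] by (auto simp: z1_def)
    have \<gamma>: "\<gamma> t \<in> ball q s" if "t \<in> {0..1}" for t
      using segment_in_ball[OF c that] by (simp add: \<gamma>_def w_def)
    have \<zeta>: "\<zeta> t \<in> W2" "\<zeta> t \<in> N" "\<zeta> t \<in> ball (q, p) r1" if "t \<in> {0..1}" for t
      using s1(2)[of "\<gamma> t"] s(2)[OF \<gamma>[OF that]] YN[of "\<gamma> t"] r'(2)[of "\<gamma> t"] unfolding \<zeta>_def by blast+
    have X: "X t \<in> T" "X t \<in> N" "(z1, \<zeta> t) \<in> ball ((q, p), (q, p)) r2" if "t \<in> {0..1}" for t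
    proof -
      have "(z1, \<zeta> t) \<in> O'" using W(5) z1(1) \<zeta>(1)[OF that] by blast
      then show "X t \<in> T" "(z1, \<zeta> t) \<in> ball ((q, p), (q, p)) r2" by (auto simp: O'_def X_def)
      then show "X t \<in> N" using \<rho>(3) by (auto simp: T_def)
    qed
    have \<zeta>d: "(\<zeta> has_vector_derivative (w, A (\<zeta> t) w)) (at t within {0..1})" if t: "t \<in> {0..1}" for t
    proof -
      have g: "(\<gamma> has_vector_derivative w) (at t within {0..1})"
        unfolding \<gamma>_def by (rule segment_derivative)
      have "\<gamma> t \<in> ball q r0" using s(2)[OF \<gamma>[OF t]] r'(2) by blast
      from vector_derivative_diff_chain_within[OF g has_derivative_at_withinI[OF Yd[OF this]]]
      have "((\<lambda>t. Y (\<gamma> t)) has_vector_derivative A (\<zeta> t) w) (at t within {0..1})"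
        by (simp add: o_def \<zeta>_def)
      then show ?thesis
        using g unfolding \<zeta>_def has_vector_derivative_def by (auto intro!: derivative_eq_intros)
    qed
    \<comment> \<open>Left translation maps the graph of \<open>A (\<zeta> t)\<close> to the graph of \<open>A (X t)\<close>.\<close>
    have tr: "transl z1 (\<zeta> t) (w, A (\<zeta> t) w) = (d t, A (X t) (d t))" if t: "t \<in> {0..1}" for t
      unfolding graph_left_field[OF \<zeta>(2)[OF t]] X_def d_def
      using left_field_invariant[OF z1(2) \<zeta>(2)[OF t]] X(2)[OF t] left_field_graph[OF X(2)[OF t]]
      by (simp add: X_def)
    have Xd: "(X has_vector_derivative (d t, A (X t) (d t))) (at t within {0..1})" if t: "t \<in> {0..1}" for t
      using vector_derivative_diff_chain_within[OF \<zeta>d[OF t]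
          has_derivative_at_withinI[OF M_has_derivative[OF z1(2) \<zeta>(2)[OF t]]]]
      by (simp add: o_def X_def[abs_def] tr[OF t, unfolded X_def])
    have dn: "norm (d t) \<le> \<kappa>" if t: "t \<in> {0..1}" for t
    proof -
      have "norm (d t) \<le> norm (transl z1 (\<zeta> t) (w, A (\<zeta> t) w))"
        unfolding tr[OF t] by (rule norm_fst_le)
      also have "\<dots> \<le> K2 * norm (w, A (\<zeta> t) w)" using K2(3)[OF X(3)[OF t]] by simp
      also have "\<dots> \<le> K2 * ((1 + K1) * s)"
      proof (rule mult_left_mono)
        have "norm (w, A (\<zeta> t) w) \<le> norm w + K1 * norm w"
          using norm_Pair_le[of w "A (\<zeta> t) w"] K1(3)[OF \<zeta>(3)[OF t], of w] by linarith
        also have "\<dots> = (1 + K1) * norm w" by (simp add: algebra_simps)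
        also have "\<dots> \<le> (1 + K1) * s" using w K1(2) by (intro mult_left_mono) auto
        finally show "norm (w, A (\<zeta> t) w) \<le> (1 + K1) * s" .
      qed (use K2 in simp)
      finally show ?thesis using s(3) by linarith
    qed
    have "Y (fst (X 1)) = snd (X 1)"
    proof (rule unique_along_curvesD[OF unique, of "\<lambda>t. fst (X t)" "\<lambda>t. Y (fst (X t))" "\<lambda>t. snd (X t)" d])
      fix t :: real assume t: "t \<in> {0..1}"
      have fX: "fst (X t) \<in> ball q s0" "fst (X t) \<in> ball q r0" "X t \<in> ball (q, p) \<rho>"
        using X(1)[OF t] r'(2) by (auto simp: T_def)
      show "(fst (X t), Y (fst (X t))) \<in> ball (q, p) \<rho> \<and> (fst (X t), snd (X t)) \<in> ball (q, p) \<rho> \<and> norm (d t) \<le> \<kappa>"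
        using s0(2)[OF fX(1)] fX(3) dn[OF t] by simp
      have fd: "((\<lambda>t. fst (X t)) has_vector_derivative d t) (at t within {0..1})"
        using has_derivative_fst[OF Xd[OF t, unfolded has_vector_derivative_def]]
        by (simp add: has_vector_derivative_def)
      show "((\<lambda>t. Y (fst (X t))) has_vector_derivative A (fst (X t), Y (fst (X t))) (d t)) (at t within {0..1})"
        using vector_derivative_diff_chain_within[OF fd has_derivative_at_withinI[OF Yd[OF fX(2)]]]
        by (simp add: o_def)
      show "((\<lambda>t. snd (X t)) has_vector_derivative A (fst (X t), snd (X t)) (d t)) (at t within {0..1})"
        using has_derivative_snd[OF Xd[OF t, unfolded has_vector_derivative_def]]
        by (simp add: has_vector_derivative_def)
    next
      have "X 0 = z1" by (simp add: X_def \<zeta>_def \<gamma>_def Yq unit_right[OF z1(2)])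
      then show "Y (fst (X 0)) = snd (X 0)" by (simp add: z1_def)
    qed
    then show ?thesis by (simp add: X_def \<zeta>_def \<gamma>_def w_def z1_def)
  qed
  have sub: "ball q s \<subseteq> ball q r0" using s(2) r'(2) by blast
  show ?thesis
  proof (intro exI[of _ s] exI[of _ Y] conjI ballI)
    show "Cinf_on Y (ball q s)" by (rule Cinf_on_subset[OF Y_smooth sub])
  qed (use s(1) Yq Y\<beta> YN sub closed in auto)
qed

end

section \<open>Charts and tangent vectors\<close>

lemma smooth_atlas_model: "smooth_atlas (model_atlas :: ('e, 'e::real_normed_vector) chart set)"
proof -
  have "inv_into UNIV (id :: 'e \<Rightarrow> 'e) = id" by (auto simp: inv_into_f_f fun_eq_iff intro: inv_f_eq)
  then show ?thesis
    by (auto simp: smooth_atlas_def model_atlas_def homeomorphism_def id_def o_def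
        intro: Cinf_on_ident continuous_on_id)
qed

lemma inv_into_UNIV_id: "inv_into UNIV id = id"
  by (auto simp: fun_eq_iff intro: inv_f_eq)

lemma model_chart: "(UNIV, id) \<in> model_atlas"
  by (simp add: model_atlas_def)

locale smooth_chart =
  fixes A :: "('x::topological_space, 'e::real_normed_vector) chart set" and U \<xi>
  assumes atlas: "smooth_atlas A" and chart: "(U, \<xi>) \<in> A" and fd: "finite_dim TYPE('e)"
begin

abbreviation \<psi> where "\<psi> \<equiv> inv_into U \<xi>"

lemma homeo: "homeomorphism U (\<xi> ` U) \<xi> \<psi>"
  using atlas chart by (fastforce simp: smooth_atlas_def)

lemma U_open: "open U" and image_open: "open (\<xi> ` U)"
  using atlas chart by (fastforce simp: smooth_atlas_def)+

lemma inv_chart: "x \<in> U \<Longrightarrow> \<psi> (\<xi> x) = x"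
  using homeo by (simp add: homeomorphism_def)

lemma chart_inv: "a \<in> \<xi> ` U \<Longrightarrow> \<xi> (\<psi> a) = a" and inv_in: "a \<in> \<xi> ` U \<Longrightarrow> \<psi> a \<in> U"
  by (auto simp: f_inv_into_f inv_into_into)

lemma chart_eq: "x \<in> U \<Longrightarrow> y \<in> U \<Longrightarrow> \<xi> x = \<xi> y \<Longrightarrow> x = y"
  using inv_chart by metis

lemma chart_cont: "continuous_on U \<xi>" and inv_cont: "continuous_on (\<xi> ` U) \<psi>"
  using homeo by (auto simp: homeomorphism_def)

lemma image_eq: "\<xi> ` (U \<inter> W) = {a \<in> \<xi> ` U. \<psi> a \<in> W}"
  by (auto simp: inv_chart)

lemma preimage_open: "open W \<Longrightarrow> open {a \<in> \<xi> ` U. \<psi> a \<in> W}"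
  using continuous_open_preimage[OF inv_cont image_open, of W] by (simp add: vimage_def Int_def)

lemma open_image: "open W \<Longrightarrow> open (\<xi> ` (U \<inter> W))"
  unfolding image_eq by (rule preimage_open)

lemma transition_smooth: "(V, \<eta>) \<in> A \<Longrightarrow> Cinf_on (\<eta> \<circ> \<psi>) (\<xi> ` (U \<inter> V))"
  using atlas chart unfolding smooth_atlas_def by fastforce

end

text \<open>
  One pair of charts suffices to check smoothness when it covers both the domain and the image: the
  transition maps to all other charts are smooth.
\<close>

lemma smooth_map_in_charts:
  fixes A :: "('x::topological_space, 'e::real_normed_vector) chart set"
    and A' :: "('y::topological_space, 'f::real_normed_vector) chart set"
  assumes "smooth_chart A U \<xi>" and "smooth_chart A' V \<eta>"
    and W: "open W" "W \<subseteq> U" and FV: "\<And>x. x \<in> W \<Longrightarrow> F x \<in> V"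
    and F: "Cinf_on (\<eta> \<circ> F \<circ> inv_into U \<xi>) (\<xi> ` W)"
  shows "smooth_map A A' W F"
proof -
  interpret X: smooth_chart A U \<xi> by fact
  interpret Y: smooth_chart A' V \<eta> by fact
  have UW: "U \<inter> W = W" using W by auto
  have cont: "continuous_on W F"
  proof -
    have "continuous_on W (\<lambda>x. Y.\<psi> ((\<eta> \<circ> F \<circ> X.\<psi>) (\<xi> x)))"
    proof (rule continuous_on_compose2[OF Y.inv_cont])
      show "continuous_on W (\<lambda>x. (\<eta> \<circ> F \<circ> X.\<psi>) (\<xi> x))"
        by (rule continuous_on_compose2[OF Cinf_on_continuous[OF F] continuous_on_subset[OF X.chart_cont W(2)]]) auto
      show "(\<lambda>x. (\<eta> \<circ> F \<circ> X.\<psi>) (\<xi> x)) ` W \<subseteq> \<eta> ` V"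
        using W(2) FV X.inv_chart by auto
    qed
    then show ?thesis
      by (rule continuous_on_eq) (use W(2) FV X.inv_chart Y.inv_chart in auto)
  qed
  show ?thesis unfolding smooth_map_def
  proof (intro conjI W(1) cont ballI, clarify)
    fix U' \<xi>' V' \<eta>' assume 1: "(U', \<xi>') \<in> A" and 2: "(V', \<eta>') \<in> A'"
    interpret X': smooth_chart A U' \<xi>' by unfold_locales (use X.atlas X.fd 1 in auto)
    interpret Y': smooth_chart A' V' \<eta>' by unfold_locales (use Y.atlas Y.fd 2 in auto)
    have opW: "open (W \<inter> F -` V')" by (rule continuous_open_preimage[OF cont W(1) Y'.U_open])
    define S where "S = \<xi>' ` (U' \<inter> (W \<inter> F -` V'))"
    have S: "open S" unfolding S_def by (rule X'.open_image[OF opW])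
    have inS: "X'.\<psi> a \<in> U'" "X'.\<psi> a \<in> W" "F (X'.\<psi> a) \<in> V'" "F (X'.\<psi> a) \<in> V" "X'.\<psi> a \<in> U"
      if "a \<in> S" for a
    proof -
      have "a \<in> {a \<in> \<xi>' ` U'. X'.\<psi> a \<in> W \<inter> F -` V'}" using that unfolding S_def X'.image_eq .
      then show "X'.\<psi> a \<in> U'" "X'.\<psi> a \<in> W" "F (X'.\<psi> a) \<in> V'" "F (X'.\<psi> a) \<in> V" "X'.\<psi> a \<in> U"
        using FV W(2) X'.inv_in by auto
    qed
    have oW: "open (\<xi> ` W)" using X.open_image[OF W(1)] by (simp add: UW)
    have C1: "Cinf_on (\<xi> \<circ> X'.\<psi>) S"
      by (rule Cinf_on_subset[OF X'.transition_smooth[OF X.chart]]) (use W(2) in \<open>auto simp: S_def\<close>)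
    have C2: "Cinf_on (\<lambda>a. (\<eta> \<circ> F \<circ> X.\<psi>) ((\<xi> \<circ> X'.\<psi>) a)) S"
      by (rule Cinf_on_compose[OF X.fd S oW _ F C1]) (use inS in auto)
    have C2e: "(\<eta> \<circ> F \<circ> X.\<psi>) ((\<xi> \<circ> X'.\<psi>) a) = \<eta> (F (X'.\<psi> a))" if "a \<in> S" for a
      using inS[OF that] X.inv_chart by simp
    have "Cinf_on (\<lambda>a. (\<eta>' \<circ> Y.\<psi>) ((\<eta> \<circ> F \<circ> X.\<psi>) ((\<xi> \<circ> X'.\<psi>) a))) S"
    proof (rule Cinf_on_compose[OF Y.fd S Y.open_image[OF Y'.U_open] _ Y.transition_smooth[OF 2] C2])
      fix a assume a: "a \<in> S"
      show "(\<eta> \<circ> F \<circ> X.\<psi>) ((\<xi> \<circ> X'.\<psi>) a) \<in> \<eta> ` (V \<inter> V')"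
        unfolding C2e[OF a] using inS[OF a] by auto
    qed
    then have "Cinf_on (\<eta>' \<circ> F \<circ> X'.\<psi>) S"
      by (rule Cinf_on_cong[OF S]) (use C2e inS Y.inv_chart in auto)
    then show "Cinf_on (\<eta>' \<circ> F \<circ> X'.\<psi>) (\<xi>' ` (U' \<inter> W \<inter> F -` V'))"
      by (simp add: S_def Int_assoc)
  qed
qed

lemma smooth_map_chart:
  assumes "smooth_map A A' W F" "(U, \<xi>) \<in> A" "(V, \<eta>) \<in> A'"
  shows "Cinf_on (\<eta> \<circ> F \<circ> inv_into U \<xi>) (\<xi> ` (U \<inter> W \<inter> F -` V))"
  using assms unfolding smooth_map_def by fast

lemma smooth_chart_model: "finite_dim TYPE('e::real_normed_vector) \<Longrightarrow> smooth_chart (model_atlas :: ('e, 'e) chart set) UNIV id"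
  by unfold_locales (auto simp: smooth_atlas_model model_chart)

locale pointed_chart = smooth_chart A U \<xi>
  for A :: "('x::topological_space, 'e::real_normed_vector) chart set" and U \<xi> +
  fixes x0
  assumes x0: "x0 \<in> U"
begin

text \<open>
  The tangent vector at the base point with coordinates \<open>w\<close>.
\<close>

definition tv :: "'e \<Rightarrow> 'x tangent_vector" where
  "tv w = (\<lambda>f. if smooth_near A x0 f then \<D> (f \<circ> \<psi>) (\<xi> x0) w else 0)"

lemma base_in: "\<xi> x0 \<in> \<xi> ` U" using x0 by blast

lemma smooth_nearD:
  assumes "smooth_near A x0 f"
  obtains W where "open W" "x0 \<in> W" "W \<subseteq> U" "Cinf_on (f \<circ> \<psi>) (\<xi> ` W)"
proof -
  obtain W where W: "x0 \<in> W" "smooth_map A model_atlas W f" using assms by (auto simp: smooth_near_def)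
  have "Cinf_on (id \<circ> f \<circ> \<psi>) (\<xi> ` (U \<inter> W \<inter> f -` UNIV))"
    by (rule smooth_map_chart[OF W(2) chart model_chart])
  moreover have "open (U \<inter> W)" using W(2) U_open by (auto simp: smooth_map_def)
  ultimately show thesis using that[of "U \<inter> W"] W(1) x0 by simp
qed

lemma smooth_nearI:
  assumes "open W" "x0 \<in> W" "W \<subseteq> U" "Cinf_on (f \<circ> \<psi>) (\<xi> ` W)"
  shows "smooth_near A x0 f"
proof -
  have "smooth_map A model_atlas W f"
    by (rule smooth_map_in_charts[OF smooth_chart_axioms smooth_chart_model[OF finite_dim_real]])
      (use assms in \<open>auto simp: comp_assoc\<close>)
  then show ?thesis using assms(2) by (auto simp: smooth_near_def)
qed

lemma smooth_near_differentiable: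
  assumes "smooth_near A x0 f"
  shows "(f \<circ> \<psi>) differentiable (at (\<xi> x0))"
  using assms by (elim smooth_nearD) (auto intro: Cinf_on_differentiable)

lemma smooth_near_functional:
  assumes l: "bounded_linear l"
  shows "smooth_near A x0 (\<lambda>x. l (\<xi> x))"
proof (rule smooth_nearI[OF U_open x0 subset_refl])
  show "Cinf_on ((\<lambda>x. l (\<xi> x)) \<circ> \<psi>) (\<xi> ` U)"
    by (rule Cinf_on_cong[OF image_open Cinf_on_bounded_linear[OF image_open l]]) (simp add: chart_inv)
qed

lemma tv_functional:
  assumes l: "bounded_linear l"
  shows "tv w (\<lambda>x. l (\<xi> x)) = l w"
proof -
  have "\<D> ((\<lambda>x. l (\<xi> x)) \<circ> \<psi>) (\<xi> x0) = \<D> l (\<xi> x0)"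
    by (rule frechet_derivative_cong_open[OF image_open base_in]) (simp add: chart_inv)
  also have "\<dots> = l" using frechet_derivative_at[OF bounded_linear_imp_has_derivative[OF l]] by simp
  finally show ?thesis using smooth_near_functional[OF l] by (simp add: tv_def)
qed

lemma functionals_separate:
  assumes "\<And>l. bounded_linear l \<Longrightarrow> l w = (l w' :: real)"
  shows "w = (w' :: 'e)"
proof -
  obtain S :: "'e set" and c where S: "finite S" "\<And>b. b \<in> S \<Longrightarrow> bounded_linear (c b)"
      "\<And>x. x = (\<Sum>b\<in>S. c b x *\<^sub>R b)"
    using finite_dim_coordinates[OF fd] by metis
  have "w = (\<Sum>b\<in>S. c b w *\<^sub>R b)" by (rule S(3))
  also have "\<dots> = (\<Sum>b\<in>S. c b w' *\<^sub>R b)" using assms S(2) by (intro sum.cong) auto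
  also have "\<dots> = w'" by (rule S(3)[symmetric])
  finally show ?thesis .
qed

lemma tv_inj: "tv w = tv w' \<Longrightarrow> w = w'"
  by (rule functionals_separate) (metis tv_functional)

lemma tv_linear: "linear (\<lambda>w. tv w f)"
proof (cases "smooth_near A x0 f")
  case True
  then show ?thesis using linear_frechet_derivative[OF smooth_near_differentiable[OF True]] by (simp add: tv_def)
next
  case False
  then show ?thesis by (simp add: tv_def linear_iff)
qed

lemma smooth_curve_coordinates:
  assumes "smooth_curve_at A x0 \<gamma>"
  obtains w where "((\<lambda>t. \<xi> (\<gamma> t)) has_vector_derivative w) (at 0)" "velocity A \<gamma> = tv w"
proof -
  obtain \<epsilon> where \<epsilon>: "\<gamma> 0 = x0" "\<epsilon> > 0" "smooth_map model_atlas A {-\<epsilon><..<\<epsilon>} \<gamma>"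
    using assms by (auto simp: smooth_curve_at_def)
  define S where "S = {-\<epsilon><..<\<epsilon>} \<inter> \<gamma> -` U"
  have S: "open S" unfolding S_def
    using \<epsilon>(3) by (intro continuous_open_preimage) (auto simp: smooth_map_def U_open)
  have S0: "0 \<in> S" using \<epsilon> x0 by (simp add: S_def)
  have "Cinf_on (\<xi> \<circ> \<gamma> \<circ> inv_into UNIV id) (id ` (UNIV \<inter> {-\<epsilon><..<\<epsilon>} \<inter> \<gamma> -` U))"
    by (rule smooth_map_chart[OF \<epsilon>(3) model_chart chart])
  then have C: "Cinf_on (\<lambda>t. \<xi> (\<gamma> t)) S" by (simp add: inv_into_UNIV_id S_def o_def)
  define w where "w = vector_derivative (\<lambda>t. \<xi> (\<gamma> t)) (at 0)"
  have w: "((\<lambda>t. \<xi> (\<gamma> t)) has_vector_derivative w) (at 0)"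
    unfolding w_def using Cinf_on_differentiable[OF C S0] vector_derivative_works by blast
  have "velocity A \<gamma> f = tv w f" for f
  proof (cases "smooth_near A x0 f")
    case True
    from smooth_near_differentiable[OF True] has_derivative_frechet
    have d: "((f \<circ> \<psi>) has_derivative \<D> (f \<circ> \<psi>) (\<xi> x0)) (at (\<xi> (\<gamma> 0)))"
      by (simp add: \<epsilon>(1))
    have "((\<lambda>t. (f \<circ> \<psi>) (\<xi> (\<gamma> t))) has_vector_derivative \<D> (f \<circ> \<psi>) (\<xi> x0) w) (at 0)"
      using vector_derivative_diff_chain_within[OF w has_derivative_at_withinI[OF d]] by (simp add: o_def)
    then have "((\<lambda>t. f (\<gamma> t)) has_vector_derivative \<D> (f \<circ> \<psi>) (\<xi> x0) w) (at 0)"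
      by (rule has_vector_derivative_transform_within_open[OF _ S S0]) (simp add: S_def inv_chart)
    then have "deriv (\<lambda>t. f (\<gamma> t)) 0 = \<D> (f \<circ> \<psi>) (\<xi> x0) w"
      by (intro DERIV_imp_deriv) (simp add: has_real_derivative_iff_has_vector_derivative)
    then show ?thesis using True \<epsilon>(1) by (simp add: velocity_def tv_def)
  qed (simp add: velocity_def tv_def \<epsilon>(1))
  then show thesis using that[OF w] by blast
qed

definition line :: "'e \<Rightarrow> real \<Rightarrow> 'x" where
  "line w t = \<psi> (\<xi> x0 + t *\<^sub>R w)"

lemma line_near: "\<exists>\<epsilon>>0. \<forall>t\<in>{-\<epsilon><..<\<epsilon>}. \<xi> x0 + t *\<^sub>R w \<in> \<xi> ` U"
proof -
  have "open ((\<lambda>t::real. \<xi> x0 + t *\<^sub>R w) -` (\<xi> ` U))" by (intro open_vimage image_open continuous_intros)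
  moreover have "0 \<in> (\<lambda>t::real. \<xi> x0 + t *\<^sub>R w) -` (\<xi> ` U)" using base_in by simp
  ultimately obtain \<epsilon> where "\<epsilon> > 0" "ball 0 \<epsilon> \<subseteq> (\<lambda>t::real. \<xi> x0 + t *\<^sub>R w) -` (\<xi> ` U)"
    using openE by blast
  then show ?thesis by (intro exI[of _ \<epsilon>]) (auto simp: subset_iff dist_real_def)
qed

lemma smooth_curve_line: "smooth_curve_at A x0 (line w)"
proof -
  obtain \<epsilon> where \<epsilon>: "\<epsilon> > 0" "\<And>t. t \<in> {-\<epsilon><..<\<epsilon>} \<Longrightarrow> \<xi> x0 + t *\<^sub>R w \<in> \<xi> ` U" using line_near by blast
  have "smooth_map model_atlas A {-\<epsilon><..<\<epsilon>} (line w)"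
  proof (rule smooth_map_in_charts[OF smooth_chart_model[OF finite_dim_real] smooth_chart_axioms])
    have C: "Cinf_on (\<lambda>t::real. \<xi> x0 + t *\<^sub>R w) {-\<epsilon><..<\<epsilon>}"
      by (intro Cinf_on_add Cinf_on_const Cinf_on_bounded_linear bounded_linear_scaleR_left) auto
    show "Cinf_on (\<xi> \<circ> line w \<circ> inv_into UNIV id) (id ` {-\<epsilon><..<\<epsilon>})"
      unfolding inv_into_UNIV_id image_id id_apply
      by (rule Cinf_on_cong[OF _ C]) (use \<epsilon> in \<open>auto simp: line_def chart_inv\<close>)
  qed (use \<epsilon> in \<open>auto simp: line_def inv_in\<close>)
  then show ?thesis using \<epsilon>(1) by (auto simp: smooth_curve_at_def line_def inv_chart x0)
qed

lemma velocity_line: "velocity A (line w) = tv w"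
proof -
  obtain w' where w': "((\<lambda>t. \<xi> (line w t)) has_vector_derivative w') (at 0)" "velocity A (line w) = tv w'"
    using smooth_curve_coordinates[OF smooth_curve_line] by blast
  obtain \<epsilon> where \<epsilon>: "\<epsilon> > 0" "\<And>t. t \<in> {-\<epsilon><..<\<epsilon>} \<Longrightarrow> \<xi> x0 + t *\<^sub>R w \<in> \<xi> ` U" using line_near by blast
  have "((\<lambda>t. \<xi> x0 + t *\<^sub>R w) has_vector_derivative w) (at 0)"
    unfolding has_vector_derivative_def by (auto intro!: derivative_eq_intros)
  then have "((\<lambda>t. \<xi> (line w t)) has_vector_derivative w) (at 0)"
    by (rule has_vector_derivative_transform_within_open[where S = "{-\<epsilon><..<\<epsilon>}"])
      (use \<epsilon> in \<open>auto simp: line_def chart_inv\<close>)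
  then have "w = w'" using w'(1) vector_derivative_at by metis
  then show ?thesis using w'(2) by simp
qed

lemma tangent_space_eq: "tangent_space A x0 = range tv"
proof
  show "tangent_space A x0 \<subseteq> range tv"
  proof
    fix X assume "X \<in> tangent_space A x0"
    then obtain \<gamma> where \<gamma>: "X = velocity A \<gamma>" "smooth_curve_at A x0 \<gamma>" by (auto simp: tangent_space_def)
    then show "X \<in> range tv" by (elim smooth_curve_coordinates) auto
  qed
  show "range tv \<subseteq> tangent_space A x0"
  proof
    fix X assume "X \<in> range tv"
    then obtain w where "X = tv w" by blast
    then show "X \<in> tangent_space A x0"
      unfolding tangent_space_def using smooth_curve_line[of w] velocity_line[of w] by (metis (mono_tags) mem_Collect_eq)
  qed
qed

end

text \<open>
  The chain rule identifies the tangent map with the derivative in coordinates. The function to which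
  a tangent vector is applied has to be shown smooth near the base point each time, since tangent
  vectors vanish on all other functions.
\<close>

lemma tangent_map_coordinates:
  fixes A :: "('x::topological_space, 'e::real_normed_vector) chart set"
    and A' :: "('y::topological_space, 'f::real_normed_vector) chart set"
  assumes "pointed_chart A U \<xi> x0" "pointed_chart A' V \<eta> (F x0)"
    and F: "smooth_map A A' W F" and x0W: "x0 \<in> W"
  shows "tangent_map A' F x0 (pointed_chart.tv A U \<xi> x0 w)
    = pointed_chart.tv A' V \<eta> (F x0) (\<D> (\<eta> \<circ> F \<circ> inv_into U \<xi>) (\<xi> x0) w)"
proof
  interpret X: pointed_chart A U \<xi> x0 by fact
  interpret Y: pointed_chart A' V \<eta> "F x0" by fact
  fix f :: "'y \<Rightarrow> real"
  show "tangent_map A' F x0 (X.tv w) f = Y.tv (\<D> (\<eta> \<circ> F \<circ> X.\<psi>) (\<xi> x0) w) f"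
  proof (cases "smooth_near A' (F x0) f")
    case True
    obtain W' where W': "open W'" "F x0 \<in> W'" "W' \<subseteq> V" "Cinf_on (f \<circ> Y.\<psi>) (\<eta> ` W')"
      using Y.smooth_nearD[OF True] by blast
    define T where "T = U \<inter> (W \<inter> F -` W')"
    have oW: "open W" "continuous_on W F" using F by (auto simp: smooth_map_def)
    have T: "open T" "x0 \<in> T" "T \<subseteq> U"
      unfolding T_def using continuous_open_preimage[OF oW(2,1) W'(1)] X.U_open x0W W'(2) X.x0 by auto
    have oT: "open (\<xi> ` T)"
      unfolding T_def using continuous_open_preimage[OF oW(2,1) W'(1)] by (rule X.open_image)
    have C1: "Cinf_on (\<eta> \<circ> F \<circ> X.\<psi>) (\<xi> ` T)"
      by (rule Cinf_on_subset[OF smooth_map_chart[OF F X.chart Y.chart]]) (use W'(3) in \<open>auto simp: T_def\<close>)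
    have oW': "open (\<eta> ` W')" using Y.open_image[OF W'(1)] W'(3) by (simp add: Int_absorb1)
    have inT: "F (X.\<psi> a) \<in> W'" if "a \<in> \<xi> ` T" for a
      using that T(3) by (auto simp: T_def X.inv_chart)
    have inTe: "Y.\<psi> (\<eta> (F (X.\<psi> a))) = F (X.\<psi> a)" if "a \<in> \<xi> ` T" for a
      using inT[OF that] W'(3) by (intro Y.inv_chart) blast
    have "Cinf_on (\<lambda>a. (f \<circ> Y.\<psi>) ((\<eta> \<circ> F \<circ> X.\<psi>) a)) (\<xi> ` T)"
      by (rule Cinf_on_compose[OF Y.fd oT oW' _ W'(4) C1]) (use inT in auto)
    then have "Cinf_on ((f \<circ> F) \<circ> X.\<psi>) (\<xi> ` T)"
      by (rule Cinf_on_cong[OF oT]) (simp add: inTe)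
    then have near: "smooth_near A x0 (f \<circ> F)" by (rule X.smooth_nearI[OF T])
    have b: "\<xi> x0 \<in> \<xi> ` T" using T(2) by blast
    have "\<D> ((f \<circ> F) \<circ> X.\<psi>) (\<xi> x0)
      = \<D> (\<lambda>a. (f \<circ> Y.\<psi>) ((\<eta> \<circ> F \<circ> X.\<psi>) a)) (\<xi> x0)"
      by (rule frechet_derivative_cong_open[OF oT b]) (simp add: inTe)
    also have "\<dots> = (\<lambda>w. \<D> (f \<circ> Y.\<psi>) (\<eta> (F x0))
        (\<D> (\<eta> \<circ> F \<circ> X.\<psi>) (\<xi> x0) w))"
    proof -
      have 1: "((\<eta> \<circ> F \<circ> X.\<psi>) has_derivative \<D> (\<eta> \<circ> F \<circ> X.\<psi>) (\<xi> x0)) (at (\<xi> x0))"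
        by (rule Cinf_on_has_derivative[OF C1 b])
      have "(\<eta> \<circ> F \<circ> X.\<psi>) (\<xi> x0) = \<eta> (F x0)" by (simp add: X.inv_chart X.x0)
      then have 2: "((f \<circ> Y.\<psi>) has_derivative \<D> (f \<circ> Y.\<psi>) (\<eta> (F x0)))
          (at ((\<eta> \<circ> F \<circ> X.\<psi>) (\<xi> x0)))"
        using Cinf_on_has_derivative[OF W'(4)] W'(2) by auto
      show ?thesis by (rule frechet_derivative_at[OF has_derivative_compose[OF 1 2], symmetric])
    qed
    finally show ?thesis using near True by (simp add: tangent_map_def X.tv_def Y.tv_def comp_assoc)
  qed (simp add: tangent_map_def Y.tv_def)
qed

section \<open>Lie groups in a chart at the unit\<close>

lemma inv_into_map_prod:
  assumes "inj_on f U" "inj_on g V" "a \<in> f ` U" "b \<in> g ` V"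
  shows "inv_into (U \<times> V) (map_prod f g) (a, b) = (inv_into U f a, inv_into V g b)"
  by (rule inv_into_f_eq) (use assms in \<open>auto simp: f_inv_into_f inv_into_into intro!: map_prod_inj_on\<close>)

lemma smooth_map_prod_coordinates:
  fixes A1 :: "('x::topological_space, 'a::real_normed_vector) chart set"
    and A2 :: "('y::topological_space, 'b::real_normed_vector) chart set"
    and A3 :: "('z::topological_space, 'c::real_normed_vector) chart set"
  assumes F: "smooth_map (prod_atlas A1 A2) A3 UNIV (\<lambda>(x, y). F x y)"
    and "smooth_chart A1 U1 \<xi>1" and "smooth_chart A2 U2 \<xi>2" and "smooth_chart A3 U3 \<xi>3"
  defines "D \<equiv> {s \<in> \<xi>1 ` U1 \<times> \<xi>2 ` U2. F (inv_into U1 \<xi>1 (fst s)) (inv_into U2 \<xi>2 (snd s)) \<in> U3}"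
  shows "open D"
    and "Cinf_on (\<lambda>s. \<xi>3 (F (inv_into U1 \<xi>1 (fst s)) (inv_into U2 \<xi>2 (snd s)))) D"
proof -
  interpret X: smooth_chart A1 U1 \<xi>1 by fact
  interpret Y: smooth_chart A2 U2 \<xi>2 by fact
  interpret Z: smooth_chart A3 U3 \<xi>3 by fact
  have cF: "continuous_on UNIV (\<lambda>(x, y). F x y)" using F by (simp add: smooth_map_def)
  have "continuous_on (\<xi>1 ` U1 \<times> \<xi>2 ` U2) (\<lambda>s. (\<lambda>(x, y). F x y) (X.\<psi> (fst s), Y.\<psi> (snd s)))"
    by (intro continuous_on_compose2[OF cF] continuous_on_Pair continuous_on_compose2[OF X.inv_cont]
        continuous_on_compose2[OF Y.inv_cont] continuous_intros) auto
  then have "continuous_on (\<xi>1 ` U1 \<times> \<xi>2 ` U2) (\<lambda>s. F (X.\<psi> (fst s)) (Y.\<psi> (snd s)))" by simp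
  from continuous_open_preimage[OF this open_Times[OF X.image_open Y.image_open] Z.U_open]
  show D: "open D" by (simp add: D_def vimage_def Int_def)
  have inj: "inj_on \<xi>1 U1" "inj_on \<xi>2 U2" using X.chart_eq Y.chart_eq by (auto simp: inj_on_def)
  have "(U1 \<times> U2, map_prod \<xi>1 \<xi>2) \<in> prod_atlas A1 A2"
    using X.chart Y.chart by (auto simp: prod_atlas_def)
  from smooth_map_chart[OF F this Z.chart]
  have "Cinf_on (\<xi>3 \<circ> (\<lambda>(x, y). F x y) \<circ> inv_into (U1 \<times> U2) (map_prod \<xi>1 \<xi>2))
      (map_prod \<xi>1 \<xi>2 ` (U1 \<times> U2 \<inter> UNIV \<inter> (\<lambda>(x, y). F x y) -` U3))" .
  moreover have "D \<subseteq> map_prod \<xi>1 \<xi>2 ` (U1 \<times> U2 \<inter> UNIV \<inter> (\<lambda>(x, y). F x y) -` U3)"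
  proof
    fix s assume s: "s \<in> D"
    then have "s = map_prod \<xi>1 \<xi>2 (X.\<psi> (fst s), Y.\<psi> (snd s))"
      by (auto simp: D_def X.inv_chart Y.inv_chart)
    moreover have "(X.\<psi> (fst s), Y.\<psi> (snd s)) \<in> U1 \<times> U2 \<inter> UNIV \<inter> (\<lambda>(x, y). F x y) -` U3"
      using s X.inv_in Y.inv_in by (auto simp: D_def)
    ultimately show "s \<in> map_prod \<xi>1 \<xi>2 ` (U1 \<times> U2 \<inter> UNIV \<inter> (\<lambda>(x, y). F x y) -` U3)" by (rule image_eqI)
  qed
  ultimately have "Cinf_on (\<xi>3 \<circ> (\<lambda>(x, y). F x y) \<circ> inv_into (U1 \<times> U2) (map_prod \<xi>1 \<xi>2)) D"
    by (rule Cinf_on_subset)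
  then show "Cinf_on (\<lambda>s. \<xi>3 (F (X.\<psi> (fst s)) (Y.\<psi> (snd s)))) D"
  proof (rule Cinf_on_cong[OF D])
    fix s assume "s \<in> D"
    then have "inv_into (U1 \<times> U2) (map_prod \<xi>1 \<xi>2) (fst s, snd s) = (X.\<psi> (fst s), Y.\<psi> (snd s))"
      using inj by (intro inv_into_map_prod) (auto simp: D_def)
    then show "(\<xi>3 \<circ> (\<lambda>(x, y). F x y) \<circ> inv_into (U1 \<times> U2) (map_prod \<xi>1 \<xi>2)) s
      = \<xi>3 (F (X.\<psi> (fst s)) (Y.\<psi> (snd s)))" by simp
  qed
qed

locale lie_group_chart = lie_group G + pointed_chart "atlas G" U \<xi> "\<one>\<^bsub>G\<^esub>"
  for G :: "('g::{t2_space, second_countable_topology}, 'm::real_normed_vector) smooth_group" (structure)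
    and U \<xi>
begin

lemma in_carrier [simp]: "x \<in> carrier G"
  by (simp add: carrier_UNIV)

definition unit_coord where "unit_coord = \<xi> \<one>"

definition mult_coord where "mult_coord a b = \<xi> (\<psi> a \<otimes> \<psi> b)"

definition mult_domain where
  "mult_domain = {s \<in> \<xi> ` U \<times> \<xi> ` U. \<psi> (fst s) \<otimes> \<psi> (snd s) \<in> U}"

text \<open>The left-invariant vector field in coordinates.\<close>

definition field_coord where
  "field_coord Y a = \<D> (mult_coord a) unit_coord Y"

lemma unit_coord_in: "unit_coord \<in> \<xi> ` U"
  unfolding unit_coord_def by (rule base_in)

lemma inv_unit_coord [simp]: "\<psi> unit_coord = \<one>"
  unfolding unit_coord_def by (rule inv_chart[OF x0])

lemma mult_domain_open: "open mult_domain"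
  and mult_coord_smooth: "Cinf_on (\<lambda>s. mult_coord (fst s) (snd s)) mult_domain"
  unfolding mult_domain_def mult_coord_def
  by (rule smooth_map_prod_coordinates[OF smooth_mult smooth_chart_axioms smooth_chart_axioms smooth_chart_axioms])+

lemma mult_domain_unit: "a \<in> \<xi> ` U \<Longrightarrow> (a, unit_coord) \<in> mult_domain"
  using unit_coord_in inv_in by (auto simp: mult_domain_def)

lemma mult_coord_derivative:
  "a \<in> \<xi> ` U \<Longrightarrow> (mult_coord a has_derivative (\<lambda>Y. field_coord Y a)) (at unit_coord)"
  unfolding field_coord_def by (rule partial_has_derivative[OF mult_coord_smooth mult_domain_unit])

lemma field_coord_smooth: "Cinf_on (field_coord Y) (\<xi> ` U)"
  unfolding field_coord_def[abs_def]
  by (rule partial_smooth[OF fd fd mult_coord_smooth mult_domain_open image_open mult_domain_unit])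

lemma field_coord_linear: "a \<in> \<xi> ` U \<Longrightarrow> linear (\<lambda>Y. field_coord Y a)"
  using mult_coord_derivative has_derivative_linear by blast

lemma field_coord_unit: "field_coord Y unit_coord = Y"
proof -
  have "(mult_coord unit_coord has_derivative (\<lambda>Y. Y)) (at unit_coord)"
    by (rule has_derivative_transform_within_open[OF has_derivative_ident image_open unit_coord_in])
      (simp add: mult_coord_def chart_inv)
  from has_derivative_unique[OF mult_coord_derivative[OF unit_coord_in] this] show ?thesis by metis
qed

lemma mult_continuous: "continuous_on UNIV (\<lambda>(x, y). x \<otimes> y)"
  using smooth_mult by (simp add: smooth_map_def)

lemma lie_algebra_coordinates:
  assumes "integrates_lie_algebra G br \<iota>"
  obtains \<alpha> where "linear \<alpha>" "bij \<alpha>" "\<And>x. \<iota> x = tv (\<alpha> x)"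
proof -
  have bij: "bij_betw \<iota> UNIV (range tv)" and lin: "\<And>f. linear (\<lambda>x. \<iota> x f)"
    using assms by (auto simp: integrates_lie_algebra_def tangent_space_eq)
  have "\<forall>x. \<exists>w. \<iota> x = tv w" using bij by (auto simp: bij_betw_def)
  then obtain \<alpha> where \<alpha>: "\<And>x. \<iota> x = tv (\<alpha> x)" by metis
  have "linear \<alpha>"
  proof (rule linearI)
    show "\<alpha> (x + y) = \<alpha> x + \<alpha> y" for x y
    proof (rule tv_inj, rule ext)
      show "tv (\<alpha> (x + y)) f = tv (\<alpha> x + \<alpha> y) f" for f
        using linear_add[OF lin, of x y f] linear_add[OF tv_linear, of "\<alpha> x" "\<alpha> y" f] by (simp add: \<alpha>)
    qed
    show "\<alpha> (c *\<^sub>R x) = c *\<^sub>R \<alpha> x" for c x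
    proof (rule tv_inj, rule ext)
      show "tv (\<alpha> (c *\<^sub>R x)) f = tv (c *\<^sub>R \<alpha> x) f" for f
        using linear_scale[OF lin, of c x f] linear_scale[OF tv_linear, of c "\<alpha> x" f] by (simp add: \<alpha>)
    qed
  qed
  moreover have "bij \<alpha>"
  proof (rule bijI)
    show "inj \<alpha>" using bij \<alpha> by (metis bij_betw_def injD injI)
    show "surj \<alpha>"
    proof (rule surjI)
      fix w
      have "tv w \<in> range \<iota>" using bij by (simp add: bij_betw_def)
      then have "\<exists>x. tv w = tv (\<alpha> x)" using \<alpha> by auto
      then have "\<exists>x. \<alpha> x = w" using tv_inj by metis
      then show "\<alpha> (SOME x. \<alpha> x = w) = w" by (rule someI_ex)
    qed
  qed
  ultimately show thesis using that \<alpha> by blast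
qed

text \<open>
  The bracket defined through operators on functions is, in coordinates, the commutator of the
  left-invariant fields at the unit. It is computed by applying both sides to the coordinate
  functions.
\<close>

lemma bracket_coordinates:
  assumes int: "integrates_lie_algebra G br \<iota>" and \<alpha>: "\<And>x. \<iota> x = tv (\<alpha> x)"
  shows "\<alpha> (br x y) = \<D> (field_coord (\<alpha> y)) unit_coord (\<alpha> x)
    - \<D> (field_coord (\<alpha> x)) unit_coord (\<alpha> y)"
proof (rule functionals_separate)
  fix l :: "'m \<Rightarrow> real" assume l: "bounded_linear l"
  define f where "f = (\<lambda>x. l (\<xi> x))"
  have f: "smooth_near (atlas G) \<one> f" unfolding f_def by (rule smooth_near_functional[OF l])
  have field: "left_invariant_field G (tv w) (\<psi> a) f = l (field_coord w a)" if a: "a \<in> \<xi> ` U" for w a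
  proof -
    let ?W = "U \<inter> {x. \<psi> a \<otimes> x \<in> U}"
    have "continuous_on UNIV (\<lambda>x. (\<lambda>(x, y). x \<otimes> y) (\<psi> a, x))"
      by (intro continuous_on_compose2[OF mult_continuous] continuous_intros) auto
    then have oW': "open {x. \<psi> a \<otimes> x \<in> U}"
      using open_vimage[OF U_open, of "\<lambda>x. \<psi> a \<otimes> x"] by (simp add: vimage_def)
    then have oW: "open ?W" using U_open by blast
    have 1: "\<one> \<in> ?W" using x0 inv_in[OF a] by simp
    have oS: "open (\<xi> ` ?W)" by (rule open_image[OF oW'])
    have bD: "(a, b) \<in> mult_domain" if "b \<in> \<xi> ` ?W" for b
      using that a by (auto simp: mult_domain_def inv_chart)
    have C: "Cinf_on (mult_coord a) (\<xi> ` ?W)"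
    proof -
      have "Cinf_on (\<lambda>b. (a, b)) (\<xi> ` ?W)" by (rule Cinf_on_Pair[OF oS Cinf_on_const Cinf_on_ident[OF oS]])
      from Cinf_on_compose[OF finite_dim_prod[OF fd fd] oS mult_domain_open bD mult_coord_smooth this]
      show ?thesis by simp
    qed
    have eq: "(\<lambda>x. f (\<psi> a \<otimes> x)) \<circ> \<psi> = (\<lambda>b. l (mult_coord a b))" by (auto simp: f_def mult_coord_def)
    have near: "smooth_near (atlas G) \<one> (\<lambda>x. f (\<psi> a \<otimes> x))"
      by (rule smooth_nearI[OF oW 1 Int_lower1]) (unfold eq, rule Cinf_on_bounded_linear_comp[OF oS l C])
    have "\<D> (\<lambda>b. l (mult_coord a b)) unit_coord w = l (field_coord w a)"
      unfolding field_coord_def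
      by (rule frechet_derivative_apply_vector[OF differentiableI[OF mult_coord_derivative[OF a]] l])
    then show ?thesis using near by (simp add: left_invariant_field_def tv_def eq unit_coord_def[symmetric])
  qed
  have deriv: "tv v (\<lambda>g. left_invariant_field G (tv w) g f)
      = l (\<D> (field_coord w) unit_coord v)" for v w
  proof -
    let ?F = "\<lambda>g. left_invariant_field G (tv w) g f"
    have C: "Cinf_on (\<lambda>a. l (field_coord w a)) (\<xi> ` U)"
      by (rule Cinf_on_bounded_linear_comp[OF image_open l field_coord_smooth])
    have "Cinf_on (?F \<circ> \<psi>) (\<xi> ` U)" by (rule Cinf_on_cong[OF image_open C]) (simp add: field)
    then have near: "smooth_near (atlas G) \<one> ?F" by (rule smooth_nearI[OF U_open x0 subset_refl])
    have "\<D> (?F \<circ> \<psi>) unit_coord v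
        = \<D> (\<lambda>a. l (field_coord w a)) unit_coord v"
      by (subst frechet_derivative_cong_open[OF image_open unit_coord_in, of "?F \<circ> \<psi>" "\<lambda>a. l (field_coord w a)"])
        (simp_all add: field)
    also have "\<dots> = l (\<D> (field_coord w) unit_coord v)"
      by (rule frechet_derivative_apply_vector[OF Cinf_on_differentiable[OF field_coord_smooth unit_coord_in] l])
    finally show ?thesis using near by (simp add: tv_def unit_coord_def[symmetric])
  qed
  have "l (\<alpha> (br x y)) = \<iota> (br x y) f" unfolding \<alpha> f_def by (rule tv_functional[OF l, symmetric])
  also have "\<dots> = tangent_bracket G (\<iota> x) (\<iota> y) f" using int by (simp add: integrates_lie_algebra_def)
  also have "\<dots> = l (\<D> (field_coord (\<alpha> y)) unit_coord (\<alpha> x))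
      - l (\<D> (field_coord (\<alpha> x)) unit_coord (\<alpha> y))"
    using f by (simp add: tangent_bracket_def \<alpha> deriv)
  finally show "l (\<alpha> (br x y)) = l (\<D> (field_coord (\<alpha> y)) unit_coord (\<alpha> x)
      - \<D> (field_coord (\<alpha> x)) unit_coord (\<alpha> y))"
    by (simp add: linear_diff[OF bounded_linear.linear[OF l]])
qed

end

section \<open>The semidirect product in a chart\<close>

locale lie_action_chart = G: lie_group_chart G U \<xi> + H: lie_group_chart H V \<eta>
  for G :: "('g::{t2_space, second_countable_topology}, 'm::real_normed_vector) smooth_group" and U \<xi>
    and H :: "('h::{t2_space, second_countable_topology}, 'n::real_normed_vector) smooth_group" and V \<eta> +
  fixes \<Phi> :: "'g \<Rightarrow> 'h \<Rightarrow> 'h"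
  assumes action: "lie_group_action G H \<Phi>"
begin

abbreviation p where "p \<equiv> G.unit_coord"
abbreviation q where "q \<equiv> H.unit_coord"

lemma \<Phi>_mult: "\<Phi> g (h \<otimes>\<^bsub>H\<^esub> h') = \<Phi> g h \<otimes>\<^bsub>H\<^esub> \<Phi> g h'"
  using action by (auto simp: lie_group_action_def lie_group_automorphisms_def iso_def hom_def)

lemma \<Phi>_comp: "\<Phi> (g \<otimes>\<^bsub>G\<^esub> g') h = \<Phi> g (\<Phi> g' h)"
  using action by (simp add: lie_group_action_def)

lemma \<Phi>_inj: "\<Phi> g h = \<Phi> g h' \<Longrightarrow> h = h'"
  using action by (auto simp: lie_group_action_def lie_group_automorphisms_def iso_def bij_betw_def inj_on_def
      H.carrier_UNIV)

lemma \<Phi>_unit [simp]: "\<Phi> g \<one>\<^bsub>H\<^esub> = \<one>\<^bsub>H\<^esub>"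
  using \<Phi>_mult[of g "\<one>\<^bsub>H\<^esub>" "\<one>\<^bsub>H\<^esub>"] H.r_cancel_one'[of "\<Phi> g \<one>\<^bsub>H\<^esub>" "\<Phi> g \<one>\<^bsub>H\<^esub>"] by simp

lemma \<Phi>_one [simp]: "\<Phi> \<one>\<^bsub>G\<^esub> h = h"
  by (rule \<Phi>_inj[of "\<one>\<^bsub>G\<^esub>"]) (use \<Phi>_comp[of "\<one>\<^bsub>G\<^esub>" "\<one>\<^bsub>G\<^esub>" h] in simp)

lemma \<Phi>_inverse: "\<Phi> g (\<Phi> (inv\<^bsub>G\<^esub> g) h) = h" "\<Phi> (inv\<^bsub>G\<^esub> g) (\<Phi> g h) = h"
  using \<Phi>_comp[of g "inv\<^bsub>G\<^esub> g" h] \<Phi>_comp[of "inv\<^bsub>G\<^esub> g" g h] by (simp_all add: G.r_inv G.l_inv)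

lemma \<Phi>_continuous: "continuous_on UNIV (\<lambda>(g, h). \<Phi> g h)"
  using action by (simp add: lie_group_action_def smooth_map_def)

definition act_coord where "act_coord a b = \<eta> (\<Phi> (G.\<psi> a) (H.\<psi> b))"

definition act_domain where
  "act_domain = {s \<in> \<xi> ` U \<times> \<eta> ` V. \<Phi> (G.\<psi> (fst s)) (H.\<psi> (snd s)) \<in> V}"

text \<open>The automorphism of the Lie algebra of \<open>H\<close> induced by a group element, in coordinates.\<close>

definition act_deriv where "act_deriv v a = \<D> (act_coord a) q v"

lemma act_domain_open: "open act_domain"
  and act_coord_smooth: "Cinf_on (\<lambda>s. act_coord (fst s) (snd s)) act_domain"
  unfolding act_domain_def act_coord_def
  by (rule smooth_map_prod_coordinates[OF _ G.smooth_chart_axioms H.smooth_chart_axioms H.smooth_chart_axioms],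
      use action in \<open>simp add: lie_group_action_def\<close>)+

lemma act_domain_unit: "a \<in> \<xi> ` U \<Longrightarrow> (a, q) \<in> act_domain"
  using H.unit_coord_in H.x0 by (auto simp: act_domain_def)

lemma act_coord_derivative:
  "a \<in> \<xi> ` U \<Longrightarrow> (act_coord a has_derivative (\<lambda>v. act_deriv v a)) (at q)"
  unfolding act_deriv_def by (rule partial_has_derivative[OF act_coord_smooth act_domain_unit])

lemma act_coord_unit: "act_coord a q = q"
  by (simp add: act_coord_def) (simp add: H.unit_coord_def)

lemma act_deriv_smooth: "Cinf_on (act_deriv v) (\<xi> ` U)"
  unfolding act_deriv_def[abs_def]
  by (rule partial_smooth[OF G.fd H.fd act_coord_smooth act_domain_open G.image_open act_domain_unit])

lemma act_deriv_unit: "act_deriv v p = v"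
proof -
  have "(act_coord p has_derivative (\<lambda>v. v)) (at q)"
    by (rule has_derivative_transform_within_open[OF has_derivative_ident H.image_open H.unit_coord_in])
      (simp add: act_coord_def H.chart_inv)
  from has_derivative_unique[OF act_coord_derivative[OF G.unit_coord_in] this] show ?thesis by metis
qed

lemma tangent_map_\<Phi>:
  "tangent_map (atlas H) (\<Phi> (G.\<psi> a)) \<one>\<^bsub>H\<^esub> (H.tv v) = H.tv (act_deriv v a)"
proof -
  have "smooth_map (atlas H) (atlas H) UNIV (\<Phi> (G.\<psi> a))"
    using action by (simp add: lie_group_action_def lie_group_automorphisms_def)
  moreover have "\<eta> \<circ> \<Phi> (G.\<psi> a) \<circ> H.\<psi> = act_coord a" by (auto simp: act_coord_def)
  ultimately show ?thesis
    using tangent_map_coordinates[OF H.pointed_chart_axioms, of "atlas H" V \<eta> "\<Phi> (G.\<psi> a)" UNIV v]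
      H.pointed_chart_axioms by (simp add: act_deriv_def H.unit_coord_def)
qed

text \<open>
  The differentiated action is computed along the coordinate lines through the unit of \<open>G\<close>, where
  \<open>tangent_action\<close> is \<open>act_deriv\<close> up to the identification \<open>\<alpha>H\<close>.
\<close>

lemma action_coordinates:
  fixes \<iota>H :: "'b::real_normed_vector \<Rightarrow> 'h tangent_vector"
  assumes \<alpha>G: "\<And>x. \<iota>G x = G.tv (\<alpha>G x)" and \<alpha>H: "linear \<alpha>H" "bij \<alpha>H" "\<And>v. \<iota>H v = H.tv (\<alpha>H v)"
    and fdb: "finite_dim TYPE('b)" and diff: "differentiated_action G \<iota>G H \<iota>H \<Phi> \<phi>"
  shows "\<alpha>H (\<phi> x v) = \<D> (act_deriv (\<alpha>H v)) p (\<alpha>G x)"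
proof -
  have inj: "inj \<iota>H" using \<alpha>H(2,3) H.tv_inj by (metis bij_is_inj injD injI)
  have ta: "\<alpha>H (tangent_action H \<iota>H \<Phi> (G.\<psi> a) v) = act_deriv (\<alpha>H v) a" for a
  proof -
    obtain v' where v': "\<alpha>H v' = act_deriv (\<alpha>H v) a" using \<alpha>H(2) by (metis bij_pointE)
    have "tangent_action H \<iota>H \<Phi> (G.\<psi> a) v = inv_into UNIV \<iota>H (\<iota>H v')"
      unfolding tangent_action_def by (simp add: \<alpha>H(3) tangent_map_\<Phi> v')
    then show ?thesis using inj v' by simp
  qed
  define \<gamma> where "\<gamma> = G.line (\<alpha>G x)"
  have "smooth_curve_at (atlas G) \<one>\<^bsub>G\<^esub> \<gamma> \<and> velocity (atlas G) \<gamma> = \<iota>G x"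
    using G.smooth_curve_line G.velocity_line by (simp add: \<gamma>_def \<alpha>G)
  then have "((\<lambda>t. tangent_action H \<iota>H \<Phi> (\<gamma> t) v) has_vector_derivative \<phi> x v) (at 0)"
    using diff by (simp add: differentiated_action_def)
  then have "((\<lambda>t. \<alpha>H (tangent_action H \<iota>H \<Phi> (\<gamma> t) v)) has_vector_derivative \<alpha>H (\<phi> x v)) (at 0)"
    by (rule bounded_linear.has_vector_derivative[OF finite_dim_linear_bounded[OF fdb \<alpha>H(1)]])
  then have 1: "((\<lambda>t. act_deriv (\<alpha>H v) (p + t *\<^sub>R \<alpha>G x)) has_vector_derivative \<alpha>H (\<phi> x v)) (at 0)"
    by (simp add: \<gamma>_def G.line_def ta G.unit_coord_def)
  have l: "((\<lambda>t. p + t *\<^sub>R \<alpha>G x) has_vector_derivative \<alpha>G x) (at 0)"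
    unfolding has_vector_derivative_def by (auto intro!: derivative_eq_intros)
  have d: "(act_deriv (\<alpha>H v) has_derivative \<D> (act_deriv (\<alpha>H v)) p) (at (p + 0 *\<^sub>R \<alpha>G x))"
    using Cinf_on_has_derivative[OF act_deriv_smooth G.unit_coord_in] by simp
  have "((\<lambda>t. act_deriv (\<alpha>H v) (p + t *\<^sub>R \<alpha>G x)) has_vector_derivative
      \<D> (act_deriv (\<alpha>H v)) p (\<alpha>G x)) (at 0)"
    using vector_derivative_diff_chain_within[OF l has_derivative_at_withinI[OF d]] by (simp add: o_def)
  from vector_derivative_unique_at[OF 1 this] show ?thesis .
qed

text \<open>
  The semidirect product of \<open>H\<close> and \<open>G\<close>. The relative Rota--Baxter identity says that the graph of the
  operator, with the argument as first component, is closed under \<open>kmult\<close>.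
\<close>

definition kmult :: "'h \<times> 'g \<Rightarrow> 'h \<times> 'g \<Rightarrow> 'h \<times> 'g" where
  "kmult k k' = (fst k \<otimes>\<^bsub>H\<^esub> \<Phi> (snd k) (fst k'), snd k \<otimes>\<^bsub>G\<^esub> snd k')"

definition kinv :: "'h \<times> 'g \<Rightarrow> 'h \<times> 'g" where
  "kinv k = (\<Phi> (inv\<^bsub>G\<^esub> snd k) (inv\<^bsub>H\<^esub> fst k), inv\<^bsub>G\<^esub> snd k)"

definition kunit :: "'h \<times> 'g" where "kunit = (\<one>\<^bsub>H\<^esub>, \<one>\<^bsub>G\<^esub>)"

lemma kmult_assoc: "kmult (kmult a b) c = kmult a (kmult b c)"
  by (simp add: kmult_def \<Phi>_mult \<Phi>_comp H.m_assoc G.m_assoc)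

lemma kmult_unit: "kmult kunit a = a" "kmult a kunit = a"
  by (simp_all add: kmult_def kunit_def)

lemma kmult_inv: "kmult (kinv a) a = kunit" "kmult a (kinv a) = kunit"
proof -
  have "\<Phi> g (inv\<^bsub>H\<^esub> h) \<otimes>\<^bsub>H\<^esub> \<Phi> g h = \<one>\<^bsub>H\<^esub>" for g h
    using \<Phi>_mult[of g "inv\<^bsub>H\<^esub> h" h] by (simp add: H.l_inv)
  then show "kmult (kinv a) a = kunit" by (simp add: kmult_def kinv_def kunit_def G.l_inv)
  show "kmult a (kinv a) = kunit" by (simp add: kmult_def kinv_def kunit_def \<Phi>_inverse G.r_inv H.r_inv)
qed

lemma kinv_kinv: "kinv (kinv a) = a"
  by (metis kmult_assoc kmult_inv(1) kmult_inv(2) kmult_unit(1) kmult_unit(2))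

lemma kmult_continuous: "continuous_on UNIV (\<lambda>s. kmult (fst s) (snd s))"
proof -
  have "continuous_on UNIV (\<lambda>s :: ('h \<times> 'g) \<times> 'h \<times> 'g. (\<lambda>(g, h). \<Phi> g h) (snd (fst s), fst (snd s)))"
    by (rule continuous_on_compose2[OF \<Phi>_continuous]) (auto intro!: continuous_intros)
  then have 1: "continuous_on UNIV (\<lambda>s :: ('h \<times> 'g) \<times> 'h \<times> 'g. \<Phi> (snd (fst s)) (fst (snd s)))" by simp
  have "continuous_on UNIV (\<lambda>s :: ('h \<times> 'g) \<times> 'h \<times> 'g.
      (\<lambda>(x, y). x \<otimes>\<^bsub>H\<^esub> y) (fst (fst s), \<Phi> (snd (fst s)) (fst (snd s))))"
    by (rule continuous_on_compose2[OF H.mult_continuous]) (auto intro!: continuous_intros 1)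
  moreover have "continuous_on UNIV (\<lambda>s :: ('h \<times> 'g) \<times> 'h \<times> 'g.
      (\<lambda>(x, y). x \<otimes>\<^bsub>G\<^esub> y) (snd (fst s), snd (snd s)))"
    by (rule continuous_on_compose2[OF G.mult_continuous]) (auto intro!: continuous_intros)
  ultimately show ?thesis unfolding kmult_def by (simp add: continuous_on_Pair)
qed

lemma kinv_continuous: "continuous_on UNIV kinv"
proof -
  have iG: "continuous_on UNIV (\<lambda>x. inv\<^bsub>G\<^esub> x)" and iH: "continuous_on UNIV (\<lambda>x. inv\<^bsub>H\<^esub> x)"
    using G.smooth_inv H.smooth_inv by (simp_all add: smooth_map_def)
  have 1: "continuous_on UNIV (\<lambda>s :: 'h \<times> 'g. inv\<^bsub>G\<^esub> snd s)" "continuous_on UNIV (\<lambda>s :: 'h \<times> 'g. inv\<^bsub>H\<^esub> fst s)"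
    by (rule continuous_on_compose2[OF iG] continuous_on_compose2[OF iH]; auto intro!: continuous_intros)+
  have "continuous_on UNIV (\<lambda>s :: 'h \<times> 'g. (\<lambda>(g, h). \<Phi> g h) (inv\<^bsub>G\<^esub> snd s, inv\<^bsub>H\<^esub> fst s))"
    by (rule continuous_on_compose2[OF \<Phi>_continuous]) (auto intro!: continuous_on_Pair 1)
  then show ?thesis unfolding kinv_def[abs_def] using 1(1) by (simp add: continuous_on_Pair)
qed

definition \<kappa> :: "'h \<times> 'g \<Rightarrow> 'n \<times> 'm" where "\<kappa> k = (\<eta> (fst k), \<xi> (snd k))"
definition \<kappa>i :: "'n \<times> 'm \<Rightarrow> 'h \<times> 'g" where "\<kappa>i z = (H.\<psi> (fst z), G.\<psi> (snd z))"

definition kprod where "kprod z z' = \<kappa> (kmult (\<kappa>i z) (\<kappa>i z'))"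
definition kinverse where "kinverse z = \<kappa> (kinv (\<kappa>i z))"

lemma \<kappa>_inv: "k \<in> V \<times> U \<Longrightarrow> \<kappa>i (\<kappa> k) = k"
  by (auto simp: \<kappa>_def \<kappa>i_def G.inv_chart H.inv_chart)

lemma \<kappa>i_inv: "z \<in> \<eta> ` V \<times> \<xi> ` U \<Longrightarrow> \<kappa> (\<kappa>i z) = z"
  by (auto simp: \<kappa>_def \<kappa>i_def G.inv_chart H.inv_chart)

lemma \<kappa>i_unit: "\<kappa>i (q, p) = kunit"
  by (simp add: \<kappa>i_def kunit_def)

text \<open>
  The conditions on products and inverses hold near the unit by continuity. Closure under inversion
  is then achieved by intersecting with the preimage under the involution \<open>kinv\<close>.
\<close>

lemma good_neighbourhood:
  obtains K where "open K" "kunit \<in> K" "K \<subseteq> V \<times> U" "\<And>k. k \<in> K \<Longrightarrow> kinv k \<in> K"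
    "\<And>k. k \<in> K \<Longrightarrow> inv\<^bsub>H\<^esub> fst k \<in> V"
    "\<And>k k'. k \<in> K \<Longrightarrow> k' \<in> K \<Longrightarrow> kmult k k' \<in> V \<times> U \<and> \<Phi> (snd k) (fst k') \<in> V"
proof -
  have VU: "open (V \<times> U)" "kunit \<in> V \<times> U" using G.U_open H.U_open G.x0 H.x0 by (auto simp: open_Times kunit_def)
  define C where "C = (\<lambda>s. kmult (fst s) (snd s)) -` (V \<times> U) \<inter>
    (\<lambda>s :: ('h \<times> 'g) \<times> 'h \<times> 'g. \<Phi> (snd (fst s)) (fst (snd s))) -` V"
  have "continuous_on UNIV (\<lambda>s :: ('h \<times> 'g) \<times> 'h \<times> 'g. (\<lambda>(g, h). \<Phi> g h) (snd (fst s), fst (snd s)))"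
    by (rule continuous_on_compose2[OF \<Phi>_continuous]) (auto intro!: continuous_intros)
  then have 1: "continuous_on UNIV (\<lambda>s :: ('h \<times> 'g) \<times> 'h \<times> 'g. \<Phi> (snd (fst s)) (fst (snd s)))" by simp
  have C: "open C" "(kunit, kunit) \<in> C"
    unfolding C_def using open_vimage[OF VU(1) kmult_continuous] open_vimage[OF H.U_open 1] VU(2) H.x0
    by (auto simp: kmult_unit) (simp add: kunit_def)
  obtain K1 K2 where K: "open K1" "open K2" "kunit \<in> K1" "kunit \<in> K2" "K1 \<times> K2 \<subseteq> C"
    using open_prod_elim[OF C] by (metis mem_Sigma_iff)
  have iH: "continuous_on UNIV (\<lambda>x. inv\<^bsub>H\<^esub> x)" using H.smooth_inv by (simp add: smooth_map_def)
  have iHc: "continuous_on UNIV (\<lambda>k :: 'h \<times> 'g. inv\<^bsub>H\<^esub> fst k)"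
    by (rule continuous_on_compose2[OF iH]) (auto intro!: continuous_intros)
  define L where "L = K1 \<inter> K2 \<inter> (V \<times> U) \<inter> (\<lambda>k. inv\<^bsub>H\<^esub> fst k) -` V"
  have L: "open L" "kunit \<in> L"
    unfolding L_def using K VU open_vimage[OF H.U_open iHc] H.x0 by (auto simp: kunit_def)
  define K where "K = L \<inter> kinv -` L"
  have ku: "kinv kunit = kunit" using kmult_inv(1)[of kunit] by (simp add: kmult_unit)
  show thesis
  proof (rule that[of K])
    show "open K" unfolding K_def using L(1) open_vimage[OF L(1) kinv_continuous] by blast
    show "kunit \<in> K" using L(2) ku by (simp add: K_def)
    show "K \<subseteq> V \<times> U" by (auto simp: K_def L_def)
    show "kinv k \<in> K" if "k \<in> K" for k using that by (simp add: K_def kinv_kinv)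
    show "inv\<^bsub>H\<^esub> fst k \<in> V" if "k \<in> K" for k using that by (simp add: K_def L_def)
    show "kmult k k' \<in> V \<times> U \<and> \<Phi> (snd k) (fst k') \<in> V" if "k \<in> K" "k' \<in> K" for k k'
    proof -
      have "(k, k') \<in> C" using that K(5) by (auto simp: K_def L_def)
      then show ?thesis by (simp add: C_def)
    qed
  qed
qed

lemma inverse_coord_smooth:
  shows "open {a \<in> \<xi> ` U. inv\<^bsub>G\<^esub> G.\<psi> a \<in> U}" "Cinf_on (\<lambda>a. \<xi> (inv\<^bsub>G\<^esub> G.\<psi> a)) {a \<in> \<xi> ` U. inv\<^bsub>G\<^esub> G.\<psi> a \<in> U}"
    and "open {a \<in> \<eta> ` V. inv\<^bsub>H\<^esub> H.\<psi> a \<in> V}" "Cinf_on (\<lambda>a. \<eta> (inv\<^bsub>H\<^esub> H.\<psi> a)) {a \<in> \<eta> ` V. inv\<^bsub>H\<^esub> H.\<psi> a \<in> V}"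
proof -
  have iG: "open ((\<lambda>x. inv\<^bsub>G\<^esub> x) -` U)" and iH: "open ((\<lambda>x. inv\<^bsub>H\<^esub> x) -` V)"
    using G.smooth_inv H.smooth_inv by (auto simp: smooth_map_def intro!: open_vimage G.U_open H.U_open)
  show "open {a \<in> \<xi> ` U. inv\<^bsub>G\<^esub> G.\<psi> a \<in> U}" using G.preimage_open[OF iG] by simp
  show "open {a \<in> \<eta> ` V. inv\<^bsub>H\<^esub> H.\<psi> a \<in> V}" using H.preimage_open[OF iH] by simp
  show "Cinf_on (\<lambda>a. \<xi> (inv\<^bsub>G\<^esub> G.\<psi> a)) {a \<in> \<xi> ` U. inv\<^bsub>G\<^esub> G.\<psi> a \<in> U}"
    using smooth_map_chart[OF G.smooth_inv G.chart G.chart] G.image_eq[of "(\<lambda>x. inv\<^bsub>G\<^esub> x) -` U"] by (simp add: o_def)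
  show "Cinf_on (\<lambda>a. \<eta> (inv\<^bsub>H\<^esub> H.\<psi> a)) {a \<in> \<eta> ` V. inv\<^bsub>H\<^esub> H.\<psi> a \<in> V}"
    using smooth_map_chart[OF H.smooth_inv H.chart H.chart] H.image_eq[of "(\<lambda>x. inv\<^bsub>H\<^esub> x) -` V"] by (simp add: o_def)
qed

text \<open>
  Domains on which \<open>kprod\<close> is a group law in coordinates and is the expected combination of the
  products and the action in coordinates. The latter may fail when \<open>\<Phi> g h\<close> leaves the chart domain.
\<close>

definition product_domain :: "('n \<times> 'm) set \<Rightarrow> bool" where
  "product_domain N \<longleftrightarrow> local_group kprod kinverse (q, p) N \<and> N \<subseteq> \<eta> ` V \<times> \<xi> ` U \<and>
     (\<forall>z\<in>N. \<forall>z'\<in>N. kmult (\<kappa>i z) (\<kappa>i z') \<in> V \<times> U \<and>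
        kprod z z' = (H.mult_coord (fst z) (act_coord (snd z) (fst z')), G.mult_coord (snd z) (snd z')))"

lemma product_domainD:
  "\<lbrakk>product_domain N; z \<in> N; z' \<in> N\<rbrakk> \<Longrightarrow> kmult (\<kappa>i z) (\<kappa>i z') \<in> V \<times> U"
  by (simp add: product_domain_def)

lemma product_domain_exists: "\<exists>N. product_domain N"
proof -
  obtain K where K: "open K" "kunit \<in> K" "K \<subseteq> V \<times> U" "\<And>k. k \<in> K \<Longrightarrow> kinv k \<in> K"
    "\<And>k. k \<in> K \<Longrightarrow> inv\<^bsub>H\<^esub> fst k \<in> V"
    "\<And>k k'. k \<in> K \<Longrightarrow> k' \<in> K \<Longrightarrow> kmult k k' \<in> V \<times> U \<and> \<Phi> (snd k) (fst k') \<in> V"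
    using good_neighbourhood by metis
  define N where "N = {z \<in> \<eta> ` V \<times> \<xi> ` U. \<kappa>i z \<in> K}"
  have sub: "N \<subseteq> \<eta> ` V \<times> \<xi> ` U" by (auto simp: N_def)
  have "continuous_on (\<eta> ` V \<times> \<xi> ` U) \<kappa>i"
    unfolding \<kappa>i_def[abs_def]
    by (intro continuous_on_Pair continuous_on_compose2[OF G.inv_cont] continuous_on_compose2[OF H.inv_cont]
        continuous_intros) auto
  from continuous_open_preimage[OF this open_Times[OF H.image_open G.image_open] K(1)]
  have N: "open N" by (simp add: N_def vimage_def Int_def)
  have unit: "(q, p) \<in> N" using K(2) G.unit_coord_in H.unit_coord_in by (simp add: N_def \<kappa>i_unit)
  have inN: "fst z \<in> \<eta> ` V" "snd z \<in> \<xi> ` U" "\<kappa>i z \<in> K" if "z \<in> N" for z using that by (auto simp: N_def)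
  have \<kappa>N: "\<kappa> k \<in> N" if "k \<in> K" for k
    using that K(3) by (auto simp: N_def \<kappa>_inv) (auto simp: \<kappa>_def)
  have prod: "\<kappa>i (kprod z z') = kmult (\<kappa>i z) (\<kappa>i z')" if "z \<in> N" "z' \<in> N" for z z'
    unfolding kprod_def by (rule \<kappa>_inv) (use K(6) inN that in blast)
  have act: "(snd z, fst z') \<in> act_domain" "(fst z, act_coord (snd z) (fst z')) \<in> H.mult_domain"
    "(snd z, snd z') \<in> G.mult_domain"
    "kprod z z' = (H.mult_coord (fst z) (act_coord (snd z) (fst z')), G.mult_coord (snd z) (snd z'))"
    if z: "z \<in> N" "z' \<in> N" for z z'
  proof -
    have k: "kmult (\<kappa>i z) (\<kappa>i z') \<in> V \<times> U" "\<Phi> (G.\<psi> (snd z)) (H.\<psi> (fst z')) \<in> V"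
      using K(6)[OF inN(3)[OF z(1)] inN(3)[OF z(2)]] by (simp_all add: \<kappa>i_def)
    have b: "H.\<psi> (act_coord (snd z) (fst z')) = \<Phi> (G.\<psi> (snd z)) (H.\<psi> (fst z'))"
      unfolding act_coord_def by (rule H.inv_chart[OF k(2)])
    show "(snd z, fst z') \<in> act_domain" using inN z k(2) by (simp add: act_domain_def)
    show "(fst z, act_coord (snd z) (fst z')) \<in> H.mult_domain"
      using inN[OF z(1)] k b by (simp add: H.mult_domain_def kmult_def \<kappa>i_def) (simp add: act_coord_def)
    show "(snd z, snd z') \<in> G.mult_domain"
      using inN z k(1) by (simp add: G.mult_domain_def kmult_def \<kappa>i_def)
    show "kprod z z' = (H.mult_coord (fst z) (act_coord (snd z) (fst z')), G.mult_coord (snd z) (snd z'))"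
      by (simp add: kprod_def \<kappa>_def kmult_def \<kappa>i_def H.mult_coord_def G.mult_coord_def b)
  qed
  have NN: "open (N \<times> N)" using N by (simp add: open_Times)
  note fds = finite_dim_prod[OF H.fd H.fd] finite_dim_prod[OF G.fd G.fd] finite_dim_prod[OF G.fd H.fd]
  have group: "local_group kprod kinverse (q, p) N"
  proof
    show "finite_dim TYPE('n \<times> 'm)" by (rule finite_dim_prod[OF H.fd G.fd])
    show "open N" by (rule N)
    show "(q, p) \<in> N" by (rule unit)
    show "Cinf_on (\<lambda>s. kprod (fst s) (snd s)) (N \<times> N)"
    proof (rule Cinf_on_cong[OF NN])
      note c = Cinf_on_fst Cinf_on_snd Cinf_on_ident NN
      have d1: "(snd (fst s), fst (snd s)) \<in> act_domain"
        and d2: "(fst (fst s), act_coord (snd (fst s)) (fst (snd s))) \<in> H.mult_domain"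
        and d3: "(snd (fst s), snd (snd s)) \<in> G.mult_domain" if "s \<in> N \<times> N" for s
        using act(1-3)[of "fst s" "snd s"] that by auto
      have "Cinf_on (\<lambda>s. (snd (fst s), fst (snd s))) (N \<times> N)" by (rule Cinf_on_Pair) (intro c)+
      from Cinf_on_compose[OF fds(3) NN act_domain_open d1 act_coord_smooth this]
      have 1: "Cinf_on (\<lambda>s. act_coord (snd (fst s)) (fst (snd s))) (N \<times> N)" by simp
      have "Cinf_on (\<lambda>s. (fst (fst s), act_coord (snd (fst s)) (fst (snd s)))) (N \<times> N)"
        by (rule Cinf_on_Pair[OF NN _ 1]) (intro c)
      from Cinf_on_compose[OF fds(1) NN H.mult_domain_open d2 H.mult_coord_smooth this]
      have 2: "Cinf_on (\<lambda>s. H.mult_coord (fst (fst s)) (act_coord (snd (fst s)) (fst (snd s)))) (N \<times> N)" by simp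
      have "Cinf_on (\<lambda>s. (snd (fst s), snd (snd s))) (N \<times> N)" by (rule Cinf_on_Pair) (intro c)+
      from Cinf_on_compose[OF fds(2) NN G.mult_domain_open d3 G.mult_coord_smooth this]
      have 3: "Cinf_on (\<lambda>s. G.mult_coord (snd (fst s)) (snd (snd s))) (N \<times> N)" by simp
      show "Cinf_on (\<lambda>s. (H.mult_coord (fst (fst s)) (act_coord (snd (fst s)) (fst (snd s))),
          G.mult_coord (snd (fst s)) (snd (snd s)))) (N \<times> N)"
        by (rule Cinf_on_Pair[OF NN 2 3])
    qed (use act(4) in auto)
    show "kinverse a \<in> N" if "a \<in> N" for a
      unfolding kinverse_def by (rule \<kappa>N[OF K(4)[OF inN(3)[OF that]]])
    show "Cinf_on kinverse N"
    proof (rule Cinf_on_cong[OF N])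
      have iG: "snd z \<in> {a \<in> \<xi> ` U. inv\<^bsub>G\<^esub> G.\<psi> a \<in> U}" if "z \<in> N" for z
        using K(3) K(4)[OF inN(3)[OF that]] inN[OF that] by (auto simp: kinv_def \<kappa>i_def)
      have iH: "fst z \<in> {a \<in> \<eta> ` V. inv\<^bsub>H\<^esub> H.\<psi> a \<in> V}" if "z \<in> N" for z
        using K(5)[OF inN(3)[OF that]] inN[OF that] by (auto simp: \<kappa>i_def)
      have CG: "Cinf_on (\<lambda>z. \<xi> (inv\<^bsub>G\<^esub> G.\<psi> (snd z))) N"
        by (rule Cinf_on_compose[OF G.fd N inverse_coord_smooth(1) _ inverse_coord_smooth(2)
              Cinf_on_bounded_linear[OF N bounded_linear_snd]]) (rule iG)
      have CH: "Cinf_on (\<lambda>z. \<eta> (inv\<^bsub>H\<^esub> H.\<psi> (fst z))) N"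
        by (rule Cinf_on_compose[OF H.fd N inverse_coord_smooth(3) _ inverse_coord_smooth(4)
              Cinf_on_bounded_linear[OF N bounded_linear_fst]]) (rule iH)
      have dom: "(\<xi> (inv\<^bsub>G\<^esub> G.\<psi> (snd z)), \<eta> (inv\<^bsub>H\<^esub> H.\<psi> (fst z))) \<in> act_domain" if "z \<in> N" for z
        using iG[OF that] iH[OF that] K(3) K(4)[OF inN(3)[OF that]]
        by (auto simp: act_domain_def G.inv_chart H.inv_chart kinv_def \<kappa>i_def)
      have "Cinf_on (\<lambda>z. act_coord (\<xi> (inv\<^bsub>G\<^esub> G.\<psi> (snd z))) (\<eta> (inv\<^bsub>H\<^esub> H.\<psi> (fst z)))) N"
        using Cinf_on_compose[OF fds(3) N act_domain_open dom act_coord_smooth Cinf_on_Pair[OF N CG CH]] by simp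
      then show "Cinf_on (\<lambda>z. (act_coord (\<xi> (inv\<^bsub>G\<^esub> G.\<psi> (snd z))) (\<eta> (inv\<^bsub>H\<^esub> H.\<psi> (fst z))),
          \<xi> (inv\<^bsub>G\<^esub> G.\<psi> (snd z)))) N"
        by (rule Cinf_on_Pair[OF N _ CG])
      show "(act_coord (\<xi> (inv\<^bsub>G\<^esub> G.\<psi> (snd z))) (\<eta> (inv\<^bsub>H\<^esub> H.\<psi> (fst z))), \<xi> (inv\<^bsub>G\<^esub> G.\<psi> (snd z)))
          = kinverse z" if "z \<in> N" for z
        using iG[OF that] iH[OF that]
        by (simp add: kinverse_def \<kappa>_def kinv_def \<kappa>i_def act_coord_def G.inv_chart H.inv_chart)
    qed
    show "kprod (q, p) a = a" "kprod a (q, p) = a" if "a \<in> N" for a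
      using that sub by (auto simp: kprod_def \<kappa>i_unit kmult_unit intro!: \<kappa>i_inv)
    show "kprod (kprod a b) c = kprod a (kprod b c)"
      if "a \<in> N" "b \<in> N" "c \<in> N" "kprod a b \<in> N" "kprod b c \<in> N" for a b c
      unfolding kprod_def[of "kprod a b"] kprod_def[of a "kprod b c"] using prod that by (simp add: kmult_assoc)
    have "\<kappa>i (kinverse a) = kinv (\<kappa>i a)" if "a \<in> N" for a
      unfolding kinverse_def by (rule \<kappa>_inv) (use K(3,4) inN[OF that] in blast)
    moreover have "\<kappa> kunit = (q, p)" by (simp add: \<kappa>_def kunit_def G.unit_coord_def H.unit_coord_def)
    ultimately show "kprod (kinverse a) a = (q, p)" "kprod a (kinverse a) = (q, p)" if "a \<in> N" for a
      using that by (simp_all add: kprod_def kmult_inv)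
  qed
  have "product_domain N" unfolding product_domain_def using group sub act(4) K(6) inN(3) by blast
  then show ?thesis by blast
qed

text \<open>
  The bracket of the semidirect product, expressed through the brackets of the factors and the
  derivative of the action. Only the action on the first component contributes mixed terms.
\<close>

lemma bracket_kprod:
  assumes N: "product_domain N"
  shows "local_group.bracket kprod (q, p) (u, x) (v, y) =
    (\<D> (H.field_coord v) q u - \<D> (H.field_coord u) q v
      + \<D> (act_deriv v) p x - \<D> (act_deriv u) p y,
     \<D> (G.field_coord y) p x - \<D> (G.field_coord x) p y)"
proof -
  interpret K: local_group kprod kinverse "(q, p)" N using N by (simp add: product_domain_def)
  have sub: "N \<subseteq> \<eta> ` V \<times> \<xi> ` U" and prod: "\<And>z z'. z \<in> N \<Longrightarrow> z' \<in> N \<Longrightarrow>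
      kprod z z' = (H.mult_coord (fst z) (act_coord (snd z) (fst z')), G.mult_coord (snd z) (snd z'))"
    using N by (auto simp: product_domain_def)
  have field: "K.left_field (v, y) z = (H.field_coord (act_deriv v (snd z)) (fst z), G.field_coord y (snd z))"
    if z: "z \<in> N" for v y z
  proof -
    have zin: "fst z \<in> \<eta> ` V" "snd z \<in> \<xi> ` U" using sub z by auto
    have f: "(fst has_derivative fst) (at (q, p))" and s: "(snd has_derivative snd) (at (q, p))"
      by (auto intro: bounded_linear_imp_has_derivative bounded_linear_fst bounded_linear_snd)
    have 1: "((\<lambda>z'. act_coord (snd z) (fst z')) has_derivative (\<lambda>Z. act_deriv (fst Z) (snd z))) (at (q, p))"
      using has_derivative_compose[OF f, of "act_coord (snd z)"] act_coord_derivative[OF zin(2)] by simp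
    have 2: "((\<lambda>z'. H.mult_coord (fst z) (act_coord (snd z) (fst z'))) has_derivative
        (\<lambda>Z. H.field_coord (act_deriv (fst Z) (snd z)) (fst z))) (at (q, p))"
      using has_derivative_compose[OF 1, of "H.mult_coord (fst z)"] H.mult_coord_derivative[OF zin(1)]
      by (simp add: act_coord_unit)
    have 3: "((\<lambda>z'. G.mult_coord (snd z) (snd z')) has_derivative (\<lambda>Z. G.field_coord (snd Z) (snd z))) (at (q, p))"
      using has_derivative_compose[OF s, of "G.mult_coord (snd z)"] G.mult_coord_derivative[OF zin(2)] by simp
    have "(kprod z has_derivative (\<lambda>Z. (H.field_coord (act_deriv (fst Z) (snd z)) (fst z),
        G.field_coord (snd Z) (snd z)))) (at (q, p))"
      by (rule has_derivative_transform_within_open[OF has_derivative_Pair[OF 2 3] K.N_open K.e_in])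
        (simp add: prod z)
    from fun_cong[OF frechet_derivative_at[OF this], of "(v, y)"]
    show ?thesis by (simp add: K.left_field_def K.transl_def)
  qed
  have D: "\<D> (K.left_field (v, y)) (q, p) (u, x)
    = (\<D> (H.field_coord v) q u + \<D> (act_deriv v) p x,
       \<D> (G.field_coord y) p x)" for u v :: 'n and x y :: 'm
  proof -
    have f: "(fst has_derivative fst) (at (q, p))" and s: "(snd has_derivative snd) (at (q, p))"
      by (auto intro: bounded_linear_imp_has_derivative bounded_linear_fst bounded_linear_snd)
    have 1: "((\<lambda>z. act_deriv v (snd z)) has_derivative (\<lambda>Z. \<D> (act_deriv v) p (snd Z))) (at (q, p))"
      using has_derivative_compose[OF s, of "act_deriv v"] Cinf_on_has_derivative[OF act_deriv_smooth G.unit_coord_in]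
      by simp
    have "((\<lambda>z. H.field_coord (act_deriv v (snd z)) (fst z)) has_derivative
      (\<lambda>Z. \<D> (\<lambda>z. H.field_coord (act_deriv v (snd (q, p))) (fst z)) (q, p) Z
        + H.field_coord (\<D> (act_deriv v) p (snd Z)) (fst (q, p)))) (at (q, p))"
    proof (rule has_derivative_operator_apply[OF K.fd H.fd K.N_open K.e_in _ _ 1])
      show "Cinf_on (\<lambda>z. H.field_coord w (fst z)) N" for w
        by (rule Cinf_on_compose[OF H.fd K.N_open H.image_open _ H.field_coord_smooth
              Cinf_on_bounded_linear[OF K.N_open bounded_linear_fst]]) (use sub in auto)
      show "linear (\<lambda>w. H.field_coord w (fst z))" if "z \<in> N" for z
        using sub that by (intro H.field_coord_linear) auto
    qed
    moreover have "\<D> (\<lambda>z. H.field_coord v (fst z)) (q, p)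
        = (\<lambda>Z. \<D> (H.field_coord v) q (fst Z))"
      using has_derivative_compose[OF f, of "H.field_coord v"]
        Cinf_on_has_derivative[OF H.field_coord_smooth H.unit_coord_in]
      by (intro frechet_derivative_at[symmetric]) simp
    ultimately have 2: "((\<lambda>z. H.field_coord (act_deriv v (snd z)) (fst z)) has_derivative
      (\<lambda>Z. \<D> (H.field_coord v) q (fst Z)
        + \<D> (act_deriv v) p (snd Z))) (at (q, p))"
      by (simp add: act_deriv_unit H.field_coord_unit)
    have 3: "((\<lambda>z. G.field_coord y (snd z)) has_derivative
        (\<lambda>Z. \<D> (G.field_coord y) p (snd Z))) (at (q, p))"
      using has_derivative_compose[OF s, of "G.field_coord y"]
        Cinf_on_has_derivative[OF G.field_coord_smooth G.unit_coord_in] by simp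
    have "(K.left_field (v, y) has_derivative
      (\<lambda>Z. (\<D> (H.field_coord v) q (fst Z) + \<D> (act_deriv v) p (snd Z),
        \<D> (G.field_coord y) p (snd Z)))) (at (q, p))"
      by (rule has_derivative_transform_within_open[OF has_derivative_Pair[OF 2 3] K.N_open K.e_in])
        (simp add: field)
    from fun_cong[OF frechet_derivative_at[OF this], of "(u, x)"] show ?thesis by simp
  qed
  show ?thesis by (simp add: K.bracket_def D algebra_simps)
qed

end

section \<open>Integration of relative Rota--Baxter operators\<close>

context lie_action_chart
begin

context
  fixes brg :: "'a::real_normed_vector \<Rightarrow> 'a \<Rightarrow> 'a" and brh :: "'b::real_normed_vector \<Rightarrow> 'b \<Rightarrow> 'b"
    and \<phi> :: "'a \<Rightarrow> 'b \<Rightarrow> 'b" and B :: "'b \<Rightarrow> 'a"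
    and \<iota>G :: "'a \<Rightarrow> 'g tangent_vector" and \<iota>H :: "'b \<Rightarrow> 'h tangent_vector"
    and \<alpha>G :: "'a \<Rightarrow> 'm" and \<alpha>H :: "'b \<Rightarrow> 'n"
  assumes rrb: "relative_rota_baxter brg brh \<phi> B"
    and intG: "integrates_lie_algebra G brg \<iota>G" and intH: "integrates_lie_algebra H brh \<iota>H"
    and fdb: "finite_dim TYPE('b)" and diff: "differentiated_action G \<iota>G H \<iota>H \<Phi> \<phi>"
    and \<alpha>G: "linear \<alpha>G" "\<And>x. \<iota>G x = G.tv (\<alpha>G x)"
    and \<alpha>H: "linear \<alpha>H" "bij \<alpha>H" "\<And>v. \<iota>H v = H.tv (\<alpha>H v)"
begin

definition \<beta> where "\<beta> w = \<alpha>G (B (inv_into UNIV \<alpha>H w))"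

lemma \<beta>_\<alpha>H: "\<beta> (\<alpha>H v) = \<alpha>G (B v)"
  using \<alpha>H(2) by (simp add: \<beta>_def bij_is_inj)

lemma \<beta>_linear: "linear \<beta>"
proof -
  have B: "linear B" using rrb by (simp add: relative_rota_baxter_def)
  have "\<beta> (\<alpha>H u + \<alpha>H v) = \<beta> (\<alpha>H u) + \<beta> (\<alpha>H v)" "\<beta> (c *\<^sub>R \<alpha>H u) = c *\<^sub>R \<beta> (\<alpha>H u)" for u v c
    unfolding linear_add[OF \<alpha>H(1), symmetric] linear_scale[OF \<alpha>H(1), symmetric] \<beta>_\<alpha>H
    by (simp_all add: linear_add[OF B] linear_scale[OF B] linear_add[OF \<alpha>G(1)] linear_scale[OF \<alpha>G(1)])
  then show ?thesis using \<alpha>H(2) by (intro linearI) (metis bij_pointE)+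
qed

text \<open>
  In the bracket of two points of the graph of \<open>B\<close>, the first component is the argument of \<open>B\<close> on the
  right-hand side of the Rota--Baxter identity, and the second component is its left-hand side.
\<close>

lemma graph_subalgebra_kprod:
  assumes N: "product_domain N"
  shows "graph_subalgebra kprod kinverse q p N \<beta>"
proof -
  interpret K: local_group kprod kinverse "(q, p)" N using N by (simp add: product_domain_def)
  show ?thesis
  proof (intro graph_subalgebra.intro graph_subalgebra_axioms.intro K.local_group_axioms H.fd G.fd \<beta>_linear)
    show "fst (kprod z (b, y)) = fst (kprod z (b, y'))" if "z \<in> N" "(b, y) \<in> N" "(b, y') \<in> N" for z b y y'
      using N that by (simp add: product_domain_def)
    show "snd (K.bracket (u, \<beta> u) (v, \<beta> v)) = \<beta> (fst (K.bracket (u, \<beta> u) (v, \<beta> v)))" for u v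
    proof -
      obtain u0 v0 where uv: "u = \<alpha>H u0" "v = \<alpha>H v0" using \<alpha>H(2) by (metis bij_pointE)
      have "K.bracket (u, \<beta> u) (v, \<beta> v)
        = (\<alpha>H (brh u0 v0) + \<alpha>H (\<phi> (B u0) v0) - \<alpha>H (\<phi> (B v0) u0), \<alpha>G (brg (B u0) (B v0)))"
        unfolding uv \<beta>_\<alpha>H
        by (subst bracket_kprod[OF N])
          (simp add: H.bracket_coordinates[OF intH \<alpha>H(3)] G.bracket_coordinates[OF intG \<alpha>G(2)]
            action_coordinates[OF \<alpha>G(2) \<alpha>H fdb diff])
      also have "\<dots> = (\<alpha>H (\<phi> (B u0) v0 - \<phi> (B v0) u0 + brh u0 v0), \<alpha>G (brg (B u0) (B v0)))"
        by (simp add: linear_add[OF \<alpha>H(1)] linear_diff[OF \<alpha>H(1)])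
      finally show ?thesis using rrb by (simp add: \<beta>_\<alpha>H relative_rota_baxter_def)
    qed
  qed
qed

text \<open>
  Integrating \<open>B\<close> is a condition on the derivative of the operator in coordinates, because tangent
  vectors are determined by their coordinates.
\<close>

lemma integrates_operator_iff:
  assumes sm: "smooth_map (atlas H) (atlas G) W \<B>" and W: "\<one>\<^bsub>H\<^esub> \<in> W" and \<B>1: "\<B> \<one>\<^bsub>H\<^esub> = \<one>\<^bsub>G\<^esub>"
  shows "integrates_operator G \<iota>G H \<iota>H \<B> B \<longleftrightarrow> \<D> (\<xi> \<circ> \<B> \<circ> H.\<psi>) q = \<beta>"
proof -
  have P: "pointed_chart (atlas G) U \<xi> (\<B> \<one>\<^bsub>H\<^esub>)" using G.pointed_chart_axioms by (simp add: \<B>1)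
  have "tangent_map (atlas G) \<B> \<one>\<^bsub>H\<^esub> (\<iota>H u)
      = G.tv (\<D> (\<xi> \<circ> \<B> \<circ> H.\<psi>) q (\<alpha>H u))" for u
    using tangent_map_coordinates[OF H.pointed_chart_axioms P sm W, of "\<alpha>H u"]
    by (simp add: \<alpha>H(3) \<B>1 H.unit_coord_def)
  then have "integrates_operator G \<iota>G H \<iota>H \<B> B \<longleftrightarrow>
      (\<forall>u. G.tv (\<D> (\<xi> \<circ> \<B> \<circ> H.\<psi>) q (\<alpha>H u)) = G.tv (\<beta> (\<alpha>H u)))"
    by (simp add: integrates_operator_def \<alpha>G(2) \<beta>_\<alpha>H)
  also have "\<dots> \<longleftrightarrow> (\<forall>u. \<D> (\<xi> \<circ> \<B> \<circ> H.\<psi>) q (\<alpha>H u) = \<beta> (\<alpha>H u))"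
    using G.tv_inj by metis
  also have "\<dots> \<longleftrightarrow> (\<forall>w. \<D> (\<xi> \<circ> \<B> \<circ> H.\<psi>) q w = \<beta> w)"
    using \<alpha>H(2) by (metis bij_pointE)
  finally show ?thesis by (simp add: fun_eq_iff)
qed

text \<open>
  The operator is defined on the whole coordinate ball over which the graph is closed under the
  product.
\<close>

lemma local_operator_exists:
  "\<exists>W \<B>. local_relative_rota_baxter G H \<Phi> W \<B> \<and> integrates_operator G \<iota>G H \<iota>H \<B> B"
proof -
  obtain N where N: "product_domain N" using product_domain_exists by blast
  interpret K: graph_subalgebra kprod kinverse q p N \<beta> by (rule graph_subalgebra_kprod[OF N])
  obtain r Y where r: "r > 0" "Y q = p" "(Y has_derivative \<beta>) (at q)" "Cinf_on Y (ball q r)"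
    "\<And>a. a \<in> ball q r \<Longrightarrow> (a, Y a) \<in> N"
    "\<And>a c. a \<in> ball q r \<Longrightarrow> c \<in> ball q r \<Longrightarrow> snd (kprod (a, Y a) (c, Y c)) = Y (fst (kprod (a, Y a) (c, Y c)))"
    using K.closed_graph_exists by blast
  define W where "W = {h \<in> V. \<eta> h \<in> ball q r}"
  define \<B> where "\<B> h = G.\<psi> (Y (\<eta> h))" for h
  have W: "open W" "\<one>\<^bsub>H\<^esub> \<in> W" "W \<subseteq> V"
    unfolding W_def using continuous_open_preimage[OF H.chart_cont H.U_open open_ball, of q r] H.x0 r(1)
    by (auto simp: vimage_def Int_def H.unit_coord_def)
  have Yin: "a \<in> \<eta> ` V" "Y a \<in> \<xi> ` U" if "a \<in> ball q r" for a
    using r(5)[OF that] N by (auto simp: product_domain_def)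
  have \<eta>W: "\<eta> ` W = ball q r"
  proof (intro equalityI subsetI)
    fix a assume a: "a \<in> ball q r"
    then have "H.\<psi> a \<in> W" "\<eta> (H.\<psi> a) = a"
      using H.inv_in[OF Yin(1)] H.chart_inv[OF Yin(1)] by (simp_all add: W_def)
    then show "a \<in> \<eta> ` W" by (metis image_eqI)
  qed (auto simp: W_def)
  have sm: "smooth_map (atlas H) (atlas G) W \<B>"
  proof (rule smooth_map_in_charts[OF H.smooth_chart_axioms G.smooth_chart_axioms W(1,3)])
    show "\<B> h \<in> U" if "h \<in> W" for h using that Yin(2) G.inv_in by (simp add: \<B>_def W_def)
    show "Cinf_on (\<xi> \<circ> \<B> \<circ> H.\<psi>) (\<eta> ` W)" unfolding \<eta>W
      by (rule Cinf_on_cong[OF open_ball r(4)])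
        (use Yin H.chart_inv G.chart_inv in \<open>auto simp del: mem_ball simp: \<B>_def\<close>)
  qed
  have \<B>1: "\<B> \<one>\<^bsub>H\<^esub> = \<one>\<^bsub>G\<^esub>"
    using r(2) by (simp add: \<B>_def H.unit_coord_def[symmetric])
  have "\<D> (\<xi> \<circ> \<B> \<circ> H.\<psi>) q = \<D> Y q"
    by (rule frechet_derivative_cong_open[OF open_ball, of q q r])
      (use Yin H.chart_inv G.chart_inv r(1) in \<open>auto simp del: mem_ball simp: \<B>_def\<close>)
  also have "\<dots> = \<beta>" using frechet_derivative_at[OF r(3)] by simp
  finally have "integrates_operator G \<iota>G H \<iota>H \<B> B" using integrates_operator_iff[OF sm W(2) \<B>1] by simp
  moreover have "local_relative_rota_baxter G H \<Phi> W \<B>"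
    unfolding local_relative_rota_baxter_def
  proof (intro conjI ballI impI W sm)
    fix h1 h2 assume h: "h1 \<in> W" "h2 \<in> W"
    define z1 z2 where "z1 = (\<eta> h1, Y (\<eta> h1))" and "z2 = (\<eta> h2, Y (\<eta> h2))"
    have z: "z1 \<in> N" "z2 \<in> N" using r(5) h by (auto simp: z1_def z2_def W_def)
    have \<kappa>: "\<kappa>i z1 = (h1, \<B> h1)" "\<kappa>i z2 = (h2, \<B> h2)"
      using h W(3) H.inv_chart by (auto simp: \<kappa>i_def z1_def z2_def \<B>_def)
    have in_VU: "h1 \<otimes>\<^bsub>H\<^esub> \<Phi> (\<B> h1) h2 \<in> V" "\<B> h1 \<otimes>\<^bsub>G\<^esub> \<B> h2 \<in> U"
      using product_domainD[OF N z] by (simp_all add: \<kappa> kmult_def)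
    have k: "kprod z1 z2 = (\<eta> (h1 \<otimes>\<^bsub>H\<^esub> \<Phi> (\<B> h1) h2), \<xi> (\<B> h1 \<otimes>\<^bsub>G\<^esub> \<B> h2))"
      by (simp add: kprod_def \<kappa> kmult_def \<kappa>_def)
    have "\<xi> (\<B> h1 \<otimes>\<^bsub>G\<^esub> \<B> h2) = Y (\<eta> (h1 \<otimes>\<^bsub>H\<^esub> \<Phi> (\<B> h1) h2))"
      using r(6)[of "\<eta> h1" "\<eta> h2"] h k by (simp add: z1_def z2_def W_def)
    then have "G.\<psi> (\<xi> (\<B> h1 \<otimes>\<^bsub>G\<^esub> \<B> h2)) = \<B> (h1 \<otimes>\<^bsub>H\<^esub> \<Phi> (\<B> h1) h2)"
      unfolding \<B>_def[of "h1 \<otimes>\<^bsub>H\<^esub> \<Phi> (\<B> h1) h2"] by simp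
    then show "\<B> h1 \<otimes>\<^bsub>G\<^esub> \<B> h2 = \<B> (h1 \<otimes>\<^bsub>H\<^esub> \<Phi> (\<B> h1) h2)"
      by (simp add: G.inv_chart in_VU)
  qed
  ultimately show ?thesis by blast
qed

lemma local_operator_closed_graph:
  assumes N: "product_domain N"
    and \<B>: "local_relative_rota_baxter G H \<Phi> W \<B>" "integrates_operator G \<iota>G H \<iota>H \<B> B"
  shows "graph_subalgebra.closed_graph kprod q p N \<beta> {a \<in> \<eta> ` V. H.\<psi> a \<in> W \<inter> \<B> -` U} (\<xi> \<circ> \<B> \<circ> H.\<psi>)"
proof -
  interpret K: graph_subalgebra kprod kinverse q p N \<beta> by (rule graph_subalgebra_kprod[OF N])
  have W: "open W" "\<one>\<^bsub>H\<^esub> \<in> W" and sm: "smooth_map (atlas H) (atlas G) W \<B>"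
    and rb: "\<And>h1 h2. h1 \<in> W \<Longrightarrow> h2 \<in> W \<Longrightarrow> h1 \<otimes>\<^bsub>H\<^esub> \<Phi> (\<B> h1) h2 \<in> W \<Longrightarrow>
        \<B> h1 \<otimes>\<^bsub>G\<^esub> \<B> h2 = \<B> (h1 \<otimes>\<^bsub>H\<^esub> \<Phi> (\<B> h1) h2)"
    using \<B>(1) by (auto simp: local_relative_rota_baxter_def)
  \<comment> \<open>The identity at the pair of units makes \<open>\<B> \<one>\<close> idempotent.\<close>
  have "\<B> \<one>\<^bsub>H\<^esub> \<otimes>\<^bsub>G\<^esub> \<B> \<one>\<^bsub>H\<^esub> = \<B> \<one>\<^bsub>H\<^esub>" using rb[OF W(2) W(2)] W(2) by simp
  then have \<B>1: "\<B> \<one>\<^bsub>H\<^esub> = \<one>\<^bsub>G\<^esub>"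
    using G.r_cancel_one'[of "\<B> \<one>\<^bsub>H\<^esub>" "\<B> \<one>\<^bsub>H\<^esub>"] by simp
  define S where "S = {a \<in> \<eta> ` V. H.\<psi> a \<in> W \<inter> \<B> -` U}"
  define b where "b = \<xi> \<circ> \<B> \<circ> H.\<psi>"
  have S: "open S" unfolding S_def
    using sm by (intro H.preimage_open continuous_open_preimage) (auto simp: smooth_map_def G.U_open)
  have q: "q \<in> S" using H.unit_coord_in W(2) G.x0 by (simp add: S_def \<B>1)
  have b_smooth: "Cinf_on b S"
    using smooth_map_chart[OF sm H.chart G.chart] H.image_eq[of "W \<inter> \<B> -` U"] by (simp add: b_def S_def Int_assoc)
  have bq: "b q = p" by (simp add: b_def \<B>1) (simp add: G.unit_coord_def)
  have "\<D> b q = \<beta>"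
    using integrates_operator_iff[OF sm W(2) \<B>1] \<B>(2) by (simp add: b_def)
  then have bd: "(b has_derivative \<beta>) (at q)" using Cinf_on_has_derivative[OF b_smooth q] by simp
  have closed: "snd (kprod (a, b a) (c, b c)) = b (fst (kprod (a, b a) (c, b c)))"
    if a: "a \<in> S" "(a, b a) \<in> N" and c: "c \<in> S" "(c, b c) \<in> N" and ac: "fst (kprod (a, b a) (c, b c)) \<in> S" for a c
  proof -
    define h1 h2 where "h1 = H.\<psi> a" and "h2 = H.\<psi> c"
    have h: "h1 \<in> W" "\<B> h1 \<in> U" "h2 \<in> W" "\<B> h2 \<in> U" using a(1) c(1) by (auto simp: S_def h1_def h2_def)
    have \<kappa>: "\<kappa>i (a, b a) = (h1, \<B> h1)" "\<kappa>i (c, b c) = (h2, \<B> h2)"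
      using h by (simp_all add: \<kappa>i_def b_def G.inv_chart h1_def h2_def)
    have in_VU: "h1 \<otimes>\<^bsub>H\<^esub> \<Phi> (\<B> h1) h2 \<in> V" "\<B> h1 \<otimes>\<^bsub>G\<^esub> \<B> h2 \<in> U"
      using product_domainD[OF N a(2) c(2)] by (simp_all add: \<kappa> kmult_def)
    have k: "kprod (a, b a) (c, b c) = (\<eta> (h1 \<otimes>\<^bsub>H\<^esub> \<Phi> (\<B> h1) h2), \<xi> (\<B> h1 \<otimes>\<^bsub>G\<^esub> \<B> h2))"
      by (simp add: kprod_def \<kappa> kmult_def \<kappa>_def)
    have "h1 \<otimes>\<^bsub>H\<^esub> \<Phi> (\<B> h1) h2 \<in> W" using ac in_VU(1) by (simp add: k S_def H.inv_chart)
    from rb[OF h(1,3) this] show ?thesis unfolding k by (simp add: b_def H.inv_chart in_VU)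
  qed
  show ?thesis
    unfolding K.closed_graph_def S_def[symmetric] b_def[symmetric]
    using S q bq bd closed Cinf_on_differentiable[OF b_smooth] by blast
qed

lemma local_operator_unique:
  assumes 1: "local_relative_rota_baxter G H \<Phi> W \<B>" "integrates_operator G \<iota>G H \<iota>H \<B> B"
    and 2: "local_relative_rota_baxter G H \<Phi> W' \<B>'" "integrates_operator G \<iota>G H \<iota>H \<B>' B"
  shows "local_operator_eq H W \<B> W' \<B>'"
proof -
  obtain N where N: "product_domain N" using product_domain_exists by blast
  interpret K: graph_subalgebra kprod kinverse q p N \<beta> by (rule graph_subalgebra_kprod[OF N])
  note graph = local_operator_closed_graph[OF N]
  obtain s where s: "s > 0"
    "ball q s \<subseteq> {a \<in> \<eta> ` V. H.\<psi> a \<in> W \<inter> \<B> -` U} \<inter> {a \<in> \<eta> ` V. H.\<psi> a \<in> W' \<inter> \<B>' -` U}"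
    "\<And>a. a \<in> ball q s \<Longrightarrow> (\<xi> \<circ> \<B> \<circ> H.\<psi>) a = (\<xi> \<circ> \<B>' \<circ> H.\<psi>) a"
    using K.closed_graph_unique[OF graph[OF 1] graph[OF 2]] by blast
  define T where "T = {h \<in> V. \<eta> h \<in> ball q s}"
  have T: "open T" "\<one>\<^bsub>H\<^esub> \<in> T"
    unfolding T_def using continuous_open_preimage[OF H.chart_cont H.U_open open_ball, of q s] H.x0 s(1)
    by (auto simp: vimage_def Int_def H.unit_coord_def)
  have in_T: "h \<in> W \<and> h \<in> W' \<and> \<B> h = \<B>' h" if "h \<in> T" for h
  proof -
    have h: "h \<in> V" "\<eta> h \<in> ball q s" using that by (auto simp: T_def)
    have "h \<in> W" "h \<in> W'" "\<B> h \<in> U" "\<B>' h \<in> U" using s(2) h H.inv_chart[OF h(1)] by auto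
    moreover have "\<xi> (\<B> h) = \<xi> (\<B>' h)" using s(3)[OF h(2)] by (simp add: H.inv_chart[OF h(1)])
    ultimately show ?thesis using G.chart_eq by blast
  qed
  show ?thesis unfolding local_operator_eq_def using T in_T by (intro exI[of _ T]) auto
qed

end

end

lemma (in lie_group) chart_at_unit:
  obtains U \<xi> where "lie_group_chart G U \<xi>"
proof -
  have "\<one> \<in> (\<Union>(U, \<xi>)\<in>atlas G. U)" using smooth_atlas by (simp add: smooth_atlas_def)
  then obtain U \<xi> where "(U, \<xi>) \<in> atlas G" "\<one> \<in> U" by auto
  then have "lie_group_chart G U \<xi>" by unfold_locales (auto simp: smooth_atlas finite_dim_model)
  then show thesis by (rule that)
qed

theorem theorem5p3:
  fixes brg :: "'a::real_normed_vector \<Rightarrow> 'a \<Rightarrow> 'a"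
    and brh :: "'b::real_normed_vector \<Rightarrow> 'b \<Rightarrow> 'b"
    and \<phi> :: "'a \<Rightarrow> 'b \<Rightarrow> 'b"
    and B :: "'b \<Rightarrow> 'a"
    and G :: "('g::{t2_space, second_countable_topology}, 'm::real_normed_vector) smooth_group"
    and H :: "('h::{t2_space, second_countable_topology}, 'n::real_normed_vector) smooth_group"
    and \<iota>G :: "'a \<Rightarrow> 'g tangent_vector"
    and \<iota>H :: "'b \<Rightarrow> 'h tangent_vector"
    and \<Phi> :: "'g \<Rightarrow> 'h \<Rightarrow> 'h"
  assumes "lie_algebra brg" and "lie_algebra brh"
    and "lie_algebra_action brg brh \<phi>"
    and "relative_rota_baxter brg brh \<phi> B"
    and "lie_group G" and "connected (UNIV :: 'g set)" and "simply_connected (UNIV :: 'g set)"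
    and "integrates_lie_algebra G brg \<iota>G"
    and "lie_group H" and "connected (UNIV :: 'h set)" and "simply_connected (UNIV :: 'h set)"
    and "integrates_lie_algebra H brh \<iota>H"
    and "lie_group_action G H \<Phi>" and "differentiated_action G \<iota>G H \<iota>H \<Phi> \<phi>"
  shows "(\<exists>U \<B>. local_relative_rota_baxter G H \<Phi> U \<B> \<and> integrates_operator G \<iota>G H \<iota>H \<B> B) \<and>
    (\<forall>U \<B> U' \<B>'.
       local_relative_rota_baxter G H \<Phi> U \<B> \<and> integrates_operator G \<iota>G H \<iota>H \<B> B \<and>
       local_relative_rota_baxter G H \<Phi> U' \<B>' \<and> integrates_operator G \<iota>G H \<iota>H \<B>' B \<longrightarrow>
       local_operator_eq H U \<B> U' \<B>')"
proof -
  obtain U \<xi> where "lie_group_chart G U \<xi>" using lie_group.chart_at_unit[OF \<open>lie_group G\<close>] by metis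
  then interpret G: lie_group_chart G U \<xi> .
  obtain V \<eta> where "lie_group_chart H V \<eta>" using lie_group.chart_at_unit[OF \<open>lie_group H\<close>] by metis
  then interpret H: lie_group_chart H V \<eta> .
  interpret lie_action_chart G U \<xi> H V \<eta> \<Phi> by unfold_locales fact
  obtain \<alpha>G where \<alpha>G: "linear \<alpha>G" "\<And>x. \<iota>G x = G.tv (\<alpha>G x)"
    using G.lie_algebra_coordinates[OF \<open>integrates_lie_algebra G brg \<iota>G\<close>] by metis
  obtain \<alpha>H where \<alpha>H: "linear \<alpha>H" "bij \<alpha>H" "\<And>v. \<iota>H v = H.tv (\<alpha>H v)"
    using H.lie_algebra_coordinates[OF \<open>integrates_lie_algebra H brh \<iota>H\<close>] by metis
  have fdb: "finite_dim TYPE('b)" using \<open>lie_algebra brh\<close> by (rule lie_algebra.finite_dim)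
  note data = \<open>relative_rota_baxter brg brh \<phi> B\<close> \<open>integrates_lie_algebra G brg \<iota>G\<close>
    \<open>integrates_lie_algebra H brh \<iota>H\<close> fdb \<open>differentiated_action G \<iota>G H \<iota>H \<Phi> \<phi>\<close> \<alpha>G \<alpha>H
  show ?thesis using local_operator_exists[OF data] local_operator_unique[OF data] by blast
qed

end
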